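(* Let $\mathcal{T}\subset\mathbb{R}^n$ be a nonempty closed set with compact boundary, and let $f_1,\dots,f_m$ be vector fields belonging to $C_b^{0,1}(\Omega\setminus\mathcal{T})$ for every open, bounded subset $\Omega\subset\mathbb{R}^n$. Consider the control system $$\dot y=\sum_{i=1}^m a_i f_i(y),\qquad y(0)=x\in\mathbb{R}^n\setminus\mathcal{T},\qquad a\in A:=\{\pm e_1,\dots,\pm e_m\},$$ where $e_1,\dots,e_m$ is the canonical basis of $\mathbb{R}^m$. If there exists a degree-$2$ control Lyapunov function (defined through set-valued Lie brackets), then the system is globally asymptotically controllable to $\mathcal{T}$ (GAC to $\mathcal{T}$).
   Context: Function spaces. For an open set $D\subseteq\mathbb{R}^n$, $C^{0,1}(D)$ is the set of locally Lipschitz vector fields on $D$ and $C_b^{0,1}(D)$ is the set of bounded, (globally) Lipschitz continuous vector fields $f:D\to\mathbb{R}^n$. Set-valued Lie bracket. For $f,g\in C^{0,1}(D)$ and $x\in D$, $$[f,g]_{set}(x):=\mathrm{co}\Big\{v\in\mathbb{R}^n:\ v=\lim_{j\to\infty}[f,g](x_j)\ \text{for some sequence } x_j\to x,\ x_j\in DIFF(f)\cap DIFF(g)\Big\},$$ where $\mathrm{co}$ is the convex hull, $DIFF(f)$ and $DIFF(g)$ are the sets of differentiability points of $f$ and $g$, and $[f,g]:=Dg\cdot f-Df\cdot g$ at points of $DIFF(f)\cap DIFF(g)$. Hamiltonians. For $x\in\mathbb{R}^n\setminus\mathcal{T}$ let $$\mathcal{F}^{(1)}(x):=\big\{\{f_\ell(x)\},\{-f_\ell(x)\}:\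 \ell=1,\dots,m\big\},\qquad \mathcal{F}^{(2)}(x):=\mathcal{F}^{(1)}(x)\cup\big\{[f_i,f_j]_{set}(x):\ i,j=1,\dots,m\big\}$$ (families of subsets of $\mathbb{R}^n$) and, for $h=1,2$ and $(x,p)\in(\mathbb{R}^n\setminus\mathcal{T})\times\mathbb{R}^n$, $$H^{(h)}(x,p):=\inf_{v\in\mathcal{F}^{(h)}(x)}\ \sup_{w\in v}\langle p,w\rangle .$$ Nonsmooth notions. A continuous function $F:E\to\mathbb{R}$, $E\subset\mathbb{R}^n$, is semiconcave on $E$ if there is $\rho>0$ with $F(z_1)+F(z_2)-2F\left(\frac{z_1+z_2}{2}\right)\le\rho|z_1-z_2|^2$ for all $z_1,z_2\in E$ such that the segment $[z_1,z_2]\subset E$; it is locally semiconcave on $E$ if it is semiconcave on every compact subset of $E$. Locally semiconcave functions on open sets are locally Lipschitz. For a locally Lipschitz $F$ on an open set, $D^*F(x)$ (the set of limiting gradients at $x$) is the set of all $w=\lim_k\nabla F(x_k)$ with $x_k\to x$, $x_k\ne x$, $F$ differentiable at $x_k$. A continuous $F:\overline{\mathbb{R}^n\setminus\mathcal{T}}\to\mathbb{R}$ is positive definite on $\mathbb{R}^n\setminus\mathcal{T}$ if $F>0$ on $\mathbb{R}^n\setminus\mathcal{T}$ and $F=0$ on $\partial\mathcal{T}$; it is proper on $\mathbb{R}^n\setminus\mathcal{T}$ if $F^{-1}(K)$ is compact for every compact $K\subset[0,+\infty)$. Degree-$2$ control Lyapunov function: a continuous function $U:\overline{\mathbb{R}^n\setminus\mathcal{T}}\to\mathbb{R}$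 which is locally semiconcave, positive definite and proper on $\mathbb{R}^n\setminus\mathcal{T}$ and satisfies $H^{(2)}(x,D^*U(x))<0$ for all $x\in\mathbb{R}^n\setminus\mathcal{T}$, meaning $H^{(2)}(x,p)<0$ for every $p\in D^*U(x)$. Global asymptotic controllability. Let $\mathbf{d}(x)$ be the Euclidean distance of $x$ from $\mathcal{T}$. A pair $(y,\alpha)$, with $\alpha:[0,+\infty)\to A$ measurable, is an admissible trajectory-control pair from $x$ if there is $T\le+\infty$ such that $y$ is a solution on $[0,T)$ of the system with control $a=\alpha(t)$ and $y(0)=x$, with values in $\mathbb{R}^n\setminus\mathcal{T}$, and $\lim_{t\to T}\mathbf{d}(y(t))=0$; if $T<+\infty$, $y$ is extended to $[0,+\infty)$ by setting $y(t)=\bar x$ for $t\ge T$, with $\bar x\in\partial\mathcal{T}$ an arbitrary fixed point. $\mathcal{KL}$ is the set of continuous functions $\beta:[0,+\infty)\times[0,+\infty)\to[0,+\infty)$ such that (1) $\beta(0,s)=0$ and $\beta(\cdot,s)$ is strictly increasing and unbounded for each $s\ge0$; (2) $\beta(\delta,\cdot)$ is decreasing (not necessarily strictly) for each $\delta\ge0$; (3) $\beta(\delta,s)\to0$ as $s\to+\infty$ for each $\delta\ge0$. The system is GAC to $\mathcal{T}$ if there is $\beta\in\mathcal{KL}$ such that for every $x\in\mathbb{R}^n\setminus\mathcal{T}$ there is an admissible trajectory-control pair $(y,\alpha)$ from $x$ with $\mathbf{d}(y(t))\le\beta(\mathbf{d}(x),t)$ for all $t\ge0$. *)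

theory Defs
  imports "HOL-Analysis.Analysis"
begin

definition bounded_lipschitz_on :: "(real^'n) set \<Rightarrow> (real^'n \<Rightarrow> real^'n) \<Rightarrow> bool" where
  "bounded_lipschitz_on D f \<longleftrightarrow> bounded (f ` D) \<and> (\<exists>L. L-lipschitz_on D f)"

definition diff_points :: "(real^'n) set \<Rightarrow> (real^'n \<Rightarrow> real^'n) \<Rightarrow> (real^'n) set" where
  "diff_points D f = {x \<in> D. f differentiable (at x)}"

definition lie_bracket ::
  "(real^'n \<Rightarrow> real^'n) \<Rightarrow> (real^'n \<Rightarrow> real^'n) \<Rightarrow> real^'n \<Rightarrow> real^'n" where
  "lie_bracket f g x = frechet_derivative g (at x) (f x) - frechet_derivative f (at x) (g x)"

definition lie_bracket_set ::
  "(real^'n) set \<Rightarrow> (real^'n \<Rightarrow> real^'n) \<Rightarrow> (real^'n \<Rightarrow> real^'n) \<Rightarrow> real^'n \<Rightarrow> (real^'n) set" where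
  "lie_bracket_set D f g x = convex hull
     {v. \<exists>X. (\<forall>j::nat. X j \<in> diff_points D f \<inter> diff_points D g) \<and> X \<longlonglongrightarrow> x \<and>
             (\<lambda>j. lie_bracket f g (X j)) \<longlonglongrightarrow> v}"

definition family1 :: "('m::finite \<Rightarrow> real^'n \<Rightarrow> real^'n) \<Rightarrow> real^'n \<Rightarrow> (real^'n) set set" where
  "family1 f x = (\<Union>l. {{f l x}, {- f l x}})"

definition family2 ::
  "(real^'n) set \<Rightarrow> ('m::finite \<Rightarrow> real^'n \<Rightarrow> real^'n) \<Rightarrow> real^'n \<Rightarrow> (real^'n) set set" where
  "family2 T f x = family1 f x \<union> {lie_bracket_set (- T) (f i) (f j) x | i j. True}"

text \<open>Infimum and supremum are those of the reals. For locally Lipschitz fields on the open set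
  \<open>- T\<close> and a point \<open>x\<close> of it, \<open>family2 T f x\<close> is a finite nonempty family whose members are
  bounded and, by Rademacher's theorem, nonempty.\<close>

definition hamiltonian2 ::
  "(real^'n) set \<Rightarrow> ('m::finite \<Rightarrow> real^'n \<Rightarrow> real^'n) \<Rightarrow> real^'n \<Rightarrow> real^'n \<Rightarrow> real" where
  "hamiltonian2 T f x p = (INF v \<in> family2 T f x. SUP w \<in> v. p \<bullet> w)"

definition semiconcave_on :: "(real^'n) set \<Rightarrow> (real^'n \<Rightarrow> real) \<Rightarrow> bool" where
  "semiconcave_on E F \<longleftrightarrow> continuous_on E F \<and>
     (\<exists>\<rho>>0. \<forall>z1\<in>E. \<forall>z2\<in>E. closed_segment z1 z2 \<subseteq> E \<longrightarrow>
        F z1 + F z2 - 2 * F ((1/2) *\<^sub>R (z1 + z2)) \<le> \<rho> * (norm (z1 - z2))\<^sup>2)"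

definition locally_semiconcave_on :: "(real^'n) set \<Rightarrow> (real^'n \<Rightarrow> real) \<Rightarrow> bool" where
  "locally_semiconcave_on E F \<longleftrightarrow> (\<forall>K. compact K \<and> K \<subseteq> E \<longrightarrow> semiconcave_on K F)"

definition limiting_gradients ::
  "(real^'n) set \<Rightarrow> (real^'n \<Rightarrow> real) \<Rightarrow> real^'n \<Rightarrow> (real^'n) set" where
  "limiting_gradients D F x =
     {w. \<exists>X G. (\<forall>k::nat. X k \<in> D \<and> X k \<noteq> x \<and> (GDERIV F (X k) :> G k)) \<and>
               X \<longlonglongrightarrow> x \<and> G \<longlonglongrightarrow> w}"

definition positive_definite_off :: "(real^'n) set \<Rightarrow> (real^'n \<Rightarrow> real) \<Rightarrow> bool" where
  "positive_definite_off T F \<longleftrightarrow> (\<forall>x\<in>- T. F x > 0) \<and> (\<forall>x\<in>frontier T. F x = 0)"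

definition proper_off :: "(real^'n) set \<Rightarrow> (real^'n \<Rightarrow> real) \<Rightarrow> bool" where
  "proper_off T F \<longleftrightarrow>
     (\<forall>K. compact K \<and> K \<subseteq> {0..} \<longrightarrow> compact {x \<in> closure (- T). F x \<in> K})"

text \<open>Only the values of \<open>U\<close> on \<open>closure (- T)\<close> matter.\<close>

definition degree2_clf ::
  "(real^'n) set \<Rightarrow> ('m::finite \<Rightarrow> real^'n \<Rightarrow> real^'n) \<Rightarrow> (real^'n \<Rightarrow> real) \<Rightarrow> bool" where
  "degree2_clf T f U \<longleftrightarrow>
     continuous_on (closure (- T)) U \<and> locally_semiconcave_on (- T) U \<and>
     positive_definite_off T U \<and> proper_off T U \<and>
     (\<forall>x\<in>- T. \<forall>p\<in>limiting_gradients (- T) U x. hamiltonian2 T f x p < 0)"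

definition control_set :: "(real^'m) set" where
  "control_set = (\<Union>i. {axis i 1, - axis i 1})"

definition absolutely_continuous_on_interval :: "real \<Rightarrow> real \<Rightarrow> (real \<Rightarrow> real^'n) \<Rightarrow> bool" where
  "absolutely_continuous_on_interval a b y \<longleftrightarrow>
     (\<forall>\<epsilon>>0. \<exists>\<delta>>0. \<forall>I. finite I \<and> (\<forall>(u, v)\<in>I. a \<le> u \<and> u \<le> v \<and> v \<le> b) \<and>
        disjoint_family_on (\<lambda>(u, v). {u<..<v}) I \<and> (\<Sum>(u, v)\<in>I. v - u) < \<delta>
        \<longrightarrow> (\<Sum>(u, v)\<in>I. norm (y v - y u)) < \<epsilon>)"

text \<open>Caratheodory solutions on \<open>[0, S)\<close>: locally absolutely continuous, with the differential
  equation holding almost everywhere.\<close>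

definition solves_system_on ::
  "('m::finite \<Rightarrow> real^'n \<Rightarrow> real^'n) \<Rightarrow> (real \<Rightarrow> real^'m) \<Rightarrow> ereal \<Rightarrow> (real \<Rightarrow> real^'n) \<Rightarrow> bool" where
  "solves_system_on f \<alpha> S y \<longleftrightarrow>
     (\<forall>b\<ge>0. ereal b < S \<longrightarrow> absolutely_continuous_on_interval 0 b y) \<and>
     (AE t in lebesgue. 0 \<le> t \<and> ereal t < S \<longrightarrow>
        (y has_vector_derivative (\<Sum>i\<in>UNIV. (\<alpha> t $ i) *\<^sub>R f i (y t)))
          (at t within {s. 0 \<le> s \<and> ereal s < S}))"

text \<open>For finite \<open>S\<close> the function \<open>y\<close> is extended beyond \<open>S\<close> by a constant point of the boundary of
  the target, which need not be the limit of \<open>y\<close> at \<open>S\<close>.\<close>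

definition admissible_pair ::
  "(real^'n) set \<Rightarrow> ('m::finite \<Rightarrow> real^'n \<Rightarrow> real^'n) \<Rightarrow> real^'n \<Rightarrow>
     (real \<Rightarrow> real^'n) \<Rightarrow> (real \<Rightarrow> real^'m) \<Rightarrow> bool" where
  "admissible_pair T f x y \<alpha> \<longleftrightarrow>
     \<alpha> \<in> borel_measurable (lebesgue_on {0..}) \<and> (\<forall>t\<ge>0. \<alpha> t \<in> control_set) \<and>
     (\<exists>S::ereal. 0 < S \<and> solves_system_on f \<alpha> S y \<and> y 0 = x \<and>
        (\<forall>t\<ge>0. ereal t < S \<longrightarrow> y t \<notin> T) \<and>
        ((\<lambda>t. infdist (y t) T) \<longlongrightarrow> 0)
          (if S = \<infinity> then at_top else at_left (real_of_ereal S)) \<and>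
        (S < \<infinity> \<longrightarrow> (\<exists>xbar\<in>frontier T. \<forall>t. S \<le> ereal t \<longrightarrow> y t = xbar)))"

definition class_KL :: "(real \<Rightarrow> real \<Rightarrow> real) set" where
  "class_KL = {\<beta>.
     continuous_on ({0..} \<times> {0..}) (\<lambda>(\<delta>, s). \<beta> \<delta> s) \<and>
     (\<forall>\<delta>\<ge>0. \<forall>s\<ge>0. \<beta> \<delta> s \<ge> 0) \<and>
     (\<forall>s\<ge>0. \<beta> 0 s = 0 \<and> strict_mono_on {0..} (\<lambda>\<delta>. \<beta> \<delta> s) \<and>
             \<not> bdd_above ((\<lambda>\<delta>. \<beta> \<delta> s) ` {0..})) \<and>
     (\<forall>\<delta>\<ge>0. antimono_on {0..} (\<beta> \<delta>)) \<and>
     (\<forall>\<delta>\<ge>0. (\<beta> \<delta> \<longlongrightarrow> 0) at_top)}"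

definition globally_asymptotically_controllable ::
  "(real^'n) set \<Rightarrow> ('m::finite \<Rightarrow> real^'n \<Rightarrow> real^'n) \<Rightarrow> bool" where
  "globally_asymptotically_controllable T f \<longleftrightarrow>
     (\<exists>\<beta>\<in>class_KL. \<forall>x\<in>- T. \<exists>y \<alpha>. admissible_pair T f x y \<alpha> \<and>
        (\<forall>t\<ge>0. infdist (y t) T \<le> \<beta> (infdist x T) t))"

end

theory Submission
  imports Defs
begin

text \<open>
  Why the theorem holds. At a point \<open>x\<close> off the target the semiconcave function \<open>U\<close> has a limiting
  gradient \<open>p\<close> with \<open>U z \<le> U x + p \<bullet> (z - x) + \<rho> * (norm (z - x))\<^sup>2\<close> near \<open>x\<close>, and
  the Hamiltonian condition says that \<open>p\<close> makes a negative product either with some \<open>f l x\<close> or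
  \<open>- f l x\<close>, or with every element of some set-valued bracket. In the first case the flow of that
  field for a short time \<open>t\<close> lowers \<open>U\<close> by an amount of order \<open>t\<close>. In the second case
  one follows \<open>f i\<close>, \<open>f j\<close>, \<open>- f i\<close>, \<open>- f j\<close> for time \<open>t\<close> each: this loop
  of controls moves the state by \<open>t\<^sup>2\<close> times an average of brackets at nearby points, up to an error of
  order \<open>t ^ 3\<close>, and lowers \<open>U\<close> by an amount of order \<open>t\<^sup>2\<close>. Both cases are in \<open>local_decrease\<close>.

  The delicate point is that the fields are merely Lipschitz, so that their bracket exists only
  almost everywhere. Up to order \<open>t ^ 3\<close>, the component along \<open>p\<close> of the displacement is a
  Riemann sum of \<open>p \<bullet> f i\<close> and \<open>p \<bullet> f j\<close> around a parallelogram with sides of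
  order \<open>t\<close>. That sum splits into difference quotients over the cells of a fine grid. Averaged
  over small translations of the parallelogram, these quotients converge by dominated convergence to
  averages of \<open>p \<bullet> [f i, f j]\<close>, which are controlled because near \<open>x\<close> the pointwise
  bracket stays close to the set-valued one (\<open>parallelogram_sum_le\<close>,
  \<open>bracket_loop_step\<close>). The convergence uses that Lipschitz maps are differentiable almost
  everywhere, which is proved first (\<open>AE_differentiable_lipschitz\<close>).

  Limiting gradients depend on the base point in an upper semicontinuous way, so a compactness
  argument makes the decrease uniform on each shell \<open>a \<le> U x \<le> b\<close> (\<open>step_uniform\<close>).
  Idling back and forth along a field gives every step a duration between \<open>1\<close> and
  \<open>8\<close>; hence infinitely many steps can be concatenated into a trajectory on the whole half-line
  along which \<open>U\<close> at most doubles and falls below any level within a time that depends only on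
  that level and on a bound for \<open>U x\<close> (\<open>steering\<close>). Since \<open>U\<close> is proper and positive definite, smallness
  and boundedness of \<open>U\<close> and of the distance to the target are equivalent, and such uniform bounds are
  dominated by a class KL function (\<open>class_KL_majorant\<close>).
\<close>

section \<open>Almost everywhere one-sided differentiability of Lipschitz functions on the line\<close>

text \<open>The last point where \<open>h\<close> is at least \<open>h a\<close> can only be \<open>b\<close>. This is how infinitesimal growth at every point is
  integrated below, without any derivative.\<close>

lemma le_if_right_rise:
  fixes h :: "real \<Rightarrow> real"
  assumes "a \<le> b" and cont: "continuous_on {a..b} h"
    and rise: "\<And>x. a \<le> x \<Longrightarrow> x < b \<Longrightarrow> \<exists>y. x < y \<and> y \<le> b \<and> h x \<le> h y"
  shows "h a \<le> h b"
proof -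
  let ?S = "{x \<in> {a..b}. h a \<le> h x}"
  have "?S = {a..b} \<inter> h -` {h a..}" by auto
  then have "closed ?S"
    using continuous_closed_preimage[OF cont closed_atLeastAtMost closed_atLeast] by simp
  moreover have "bounded ?S" by (rule bounded_subset[of "{a..b}"]) auto
  ultimately have "compact ?S" by (simp add: compact_eq_bounded_closed)
  moreover have "a \<in> ?S" using \<open>a \<le> b\<close> by simp
  ultimately obtain c where c: "c \<in> ?S" "\<And>x. x \<in> ?S \<Longrightarrow> x \<le> c"
    using compact_attains_sup[of ?S] by blast
  have "c = b"
  proof (rule ccontr)
    assume "c \<noteq> b"
    then obtain y where "c < y" "y \<le> b" "h c \<le> h y" using rise[of c] c(1) by auto
    then show False using c(1) c(2)[of y] by auto
  qed
  then show ?thesis using c(1) by simp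
qed

lemma cumulative_measure:
  fixes A :: "real set"
  assumes "A \<in> sets borel" "a \<le> x" "x \<le> y"
  defines "K \<equiv> \<lambda>x. measure lborel (A \<inter> {a..x})"
  shows "K y = K x + measure lborel (A \<inter> {x<..y})"
    and "K x \<le> K y" and "K y - K x \<le> y - x"
    and "{x<..y} \<subseteq> A \<Longrightarrow> K y - K x = y - x"
    and "A \<inter> {x<..y} = {} \<Longrightarrow> K y = K x"
proof -
  have fin: "emeasure lborel (A \<inter> {u..v}) \<noteq> \<infinity>" for u v :: real
    using emeasure_mono[of "A \<inter> {u..v}" "{u..v}" lborel] assms(1)
    by (auto simp: top_unique emeasure_lborel_Icc_eq split: if_splits)
  have fin': "emeasure lborel (A \<inter> {u<..v}) \<noteq> \<infinity>" for u v :: real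
  proof -
    have "emeasure lborel (A \<inter> {u<..v}) \<le> emeasure lborel (A \<inter> {u..v})"
      using assms(1) by (intro emeasure_mono) auto
    then show ?thesis using fin[of u v] by (auto simp: top_unique)
  qed
  have "A \<inter> {a..y} = (A \<inter> {a..x}) \<union> (A \<inter> {x<..y})" using assms by auto
  then show eq: "K y = K x + measure lborel (A \<inter> {x<..y})"
    unfolding K_def using assms(1) fin fin'
    by (simp add: measure_Un2 measure_Union Int_Un_distrib disjoint_iff)
  have "measure lborel (A \<inter> {x<..y}) \<le> measure lborel {x<..y}"
    using assms by (intro measure_mono_fmeasurable) (auto simp: fmeasurable_def)
  also have "\<dots> = y - x" using assms by simp
  finally show "K y - K x \<le> y - x" using eq by simp
  show "K x \<le> K y" using eq by simp
  show "K y - K x = y - x" if "{x<..y} \<subseteq> A"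
  proof -
    have "A \<inter> {x<..y} = {x<..y}" using that by auto
    then show ?thesis using eq assms by simp
  qed
  show "K y = K x" if "A \<inter> {x<..y} = {}" using eq that by simp
qed

lemma measure_Int_singleton: "measure lborel (A \<inter> {a}) = (0::real)" for a :: real
  by (cases "a \<in> A") auto

lemma continuous_cumulative_measure:
  fixes A :: "real set"
  assumes "A \<in> sets borel"
  shows "continuous_on {a..b} (\<lambda>x. measure lborel (A \<inter> {a..x}))"
proof (rule lipschitz_on_continuous_on)
  show "1-lipschitz_on {a..b} (\<lambda>x. measure lborel (A \<inter> {a..x}))"
  proof (rule lipschitz_onI)
    fix x y assume xy: "x \<in> {a..b}" "y \<in> {a..b}"
    show "dist (measure lborel (A \<inter> {a..x})) (measure lborel (A \<inter> {a..y})) \<le> 1 * dist x y"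
    proof (cases "x \<le> y")
      case True
      then show ?thesis using cumulative_measure(2,3)[OF assms, of a x y] xy by (auto simp: dist_real_def)
    next
      case False
      then show ?thesis using cumulative_measure(2,3)[OF assms, of a y x] xy by (auto simp: dist_real_def)
    qed
  qed simp
qed

text \<open>Where the upper right slope is at least \<open>q\<close> the function gains \<open>q\<close> per unit length, and elsewhere it loses at
  most \<open>L\<close>. Subtracting \<open>q + L\<close> times the measure of \<open>C\<close> met so far therefore leaves a function that can always rise
  to the right: inside \<open>C\<close> because that measure grows with slope at most one, outside the closed set \<open>C\<close> because it is
  locally constant.\<close>

lemma increment_ge_on_steep_set:
  fixes g :: "real \<Rightarrow> real"
  assumes lip: "L-lipschitz_on UNIV g" and "closed C" "a \<le> b" "- L \<le> q"
    and steep: "\<And>x d. x \<in> C \<Longrightarrow> d > 0 \<Longrightarrow> \<exists>y. x < y \<and> y < x + d \<and> q * (y - x) \<le> g y - g x"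
  shows "(q + L) * measure lborel (C \<inter> {a..b}) \<le> g b - g a + L * (b - a)"
proof -
  have C: "C \<in> sets borel" using \<open>closed C\<close> by simp
  define K where "K = (\<lambda>x. measure lborel (C \<inter> {a..x}))"
  define h where "h x = g x + L * x - (q + L) * K x" for x
  have gl: "g y - g x \<ge> - L * (y - x)" if "x < y" for x y
    using lipschitz_onD[OF lip, of x y] that by (auto simp: dist_real_def)
  have "h a \<le> h b"
  proof (rule le_if_right_rise[OF \<open>a \<le> b\<close>])
    show "continuous_on {a..b} h" unfolding h_def K_def
      by (intro continuous_intros continuous_cumulative_measure C
          continuous_on_subset[OF lipschitz_on_continuous_on[OF lip]]) auto
    fix x assume x: "a \<le> x" "x < b"
    show "\<exists>y. x < y \<and> y \<le> b \<and> h x \<le> h y"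
    proof (cases "x \<in> C")
      case True
      then obtain y where y: "x < y" "y < x + (b - x)" "q * (y - x) \<le> g y - g x"
        using steep[of x "b - x"] x by auto
      have "(q + L) * (K y - K x) \<le> (q + L) * (y - x)"
        unfolding K_def by (intro mult_left_mono cumulative_measure(3)[OF C]) (use x y \<open>- L \<le> q\<close> in auto)
      then have "h x \<le> h y" unfolding h_def using y(3) by (simp add: algebra_simps)
      then show ?thesis using y by auto
    next
      case False
      then obtain e where e: "e > 0" "ball x e \<inter> C = {}"
        using \<open>closed C\<close> by (metis Compl_iff closed_def disjoint_eq_subset_Compl openE)
      define y where "y = min b (x + e/2)"
      have y: "x < y" "y \<le> b" "y < x + e" using e x by (auto simp: y_def min_def)
      have "C \<inter> {x<..y} = {}" using e(2) y(3) by (auto simp: dist_real_def disjoint_iff)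
      then have "K y = K x" unfolding K_def by (intro cumulative_measure(5)[OF C]) (use x y in auto)
      then have "h x \<le> h y" unfolding h_def using gl[OF y(1)] by (simp add: algebra_simps)
      then show ?thesis using y by auto
    qed
  qed
  moreover have "K a = 0"
    unfolding K_def by (simp add: measure_Int_singleton)
  ultimately show ?thesis unfolding h_def K_def by (simp add: algebra_simps)
qed

text \<open>Cover \<open>C\<close> by an open set \<open>U\<close> of nearly the same measure. On \<open>U\<close> the length grows with slope one and the measure of
  \<open>C\<close> only with slope \<open>\<theta>\<close>, so \<open>measure C \<le> \<theta> * measure U\<close>; letting \<open>U\<close> shrink to \<open>C\<close> forces measure zero.\<close>

lemma null_if_density_lt_one:
  assumes "compact C" "\<theta> < 1" "0 \<le> \<theta>"
    and dens: "\<And>a b. a \<le> b \<Longrightarrow> measure lborel (C \<inter> {a..b}) \<le> \<theta> * (b - a)"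
  shows "measure lborel C = 0"
proof (rule ccontr)
  assume "measure lborel C \<noteq> 0"
  define m where "m = measure lborel C"
  have m: "m > 0" using \<open>measure lborel C \<noteq> 0\<close> by (simp add: m_def zero_less_measure_iff)
  have C: "C \<in> sets borel" using assms(1) by (intro borel_compact)
  have finC: "emeasure lborel C < \<infinity>" using emeasure_compact_finite[OF assms(1)] .
  define e where "e = m * (1 - \<theta>)"
  have e: "e > 0" using m assms by (simp add: e_def)
  obtain a b where ab: "C \<subseteq> {a..b}" "a \<le> b"
  proof -
    obtain B where "\<And>x. x \<in> C \<Longrightarrow> norm x \<le> B" "B > 0"
      using compact_imp_bounded[OF assms(1)] by (auto simp: bounded_pos)
    then show ?thesis using that[of "- B" B] by (force simp: abs_le_iff)
  qed
  obtain U where U: "open U" "C \<subseteq> U" "emeasure lborel (U - C) < ennreal e"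
    using outer_regular_lborel[OF C e] by blast
  define K where "K = (\<lambda>x. measure lborel (C \<inter> {a..x}))"
  define W where "W = (\<lambda>x. measure lborel (U \<inter> {a..x}))"
  have UB: "U \<in> sets borel" using U by simp
  define h where "h x = \<theta> * W x - K x" for x
  have "h a \<le> h b"
  proof (rule le_if_right_rise[OF ab(2)])
    show "continuous_on {a..b} h" unfolding h_def K_def W_def
      by (intro continuous_intros continuous_cumulative_measure C UB)
    fix x assume x: "a \<le> x" "x < b"
    show "\<exists>y. x < y \<and> y \<le> b \<and> h x \<le> h y"
    proof (cases "x \<in> C")
      case True
      then obtain d where d: "d > 0" "ball x d \<subseteq> U"
        using U by (meson openE subsetD)
      define y where "y = min b (x + d/2)"
      have y: "x < y" "y \<le> b" "y < x + d" using d x by (auto simp: y_def min_def)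
      have "{x<..y} \<subseteq> U" using d(2) y(3) by (auto simp: dist_real_def subset_eq)
      then have "W y - W x = y - x" unfolding W_def by (intro cumulative_measure(4)[OF UB]) (use x y in auto)
      moreover have "K y - K x \<le> \<theta> * (y - x)"
      proof -
        have "K y = K x + measure lborel (C \<inter> {x<..y})"
          unfolding K_def by (intro cumulative_measure(1)[OF C]) (use x y in auto)
        moreover have "measure lborel (C \<inter> {x<..y}) \<le> measure lborel (C \<inter> {x..y})"
          using C finC fmeasurableI2[of C lborel "C \<inter> {x..y}"]
          by (intro measure_mono_fmeasurable) (auto simp: fmeasurable_def)
        ultimately show ?thesis using dens[of x y] y by simp
      qed
      moreover have "h y - h x = \<theta> * (W y - W x) - (K y - K x)" by (simp add: h_def algebra_simps)
      ultimately have "h x \<le> h y" by simp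
      then show ?thesis using y by auto
    next
      case False
      then obtain e where e: "e > 0" "ball x e \<inter> C = {}"
        using compact_imp_closed[OF assms(1)] by (metis Compl_iff closed_def disjoint_eq_subset_Compl openE)
      define y where "y = min b (x + e/2)"
      have y: "x < y" "y \<le> b" "y < x + e" using e x by (auto simp: y_def min_def)
      have "C \<inter> {x<..y} = {}" using e(2) y(3) by (auto simp: dist_real_def disjoint_iff)
      then have "K y = K x" unfolding K_def by (intro cumulative_measure(5)[OF C]) (use x y in auto)
      moreover have "W x \<le> W y" unfolding W_def by (intro cumulative_measure(2)[OF UB]) (use x y in auto)
      ultimately have "h x \<le> h y" unfolding h_def using \<open>0 \<le> \<theta>\<close> by (simp add: mult_left_mono)
      then show ?thesis using y by auto
    qed
  qed
  moreover have "h a = 0" unfolding h_def K_def W_def by (simp add: measure_Int_singleton)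
  moreover have "K b = m" unfolding K_def m_def using ab by (simp add: Int_absorb2)
  ultimately have "m \<le> \<theta> * W b" by (simp add: h_def)
  moreover have "W b < m + e"
  proof -
    have "emeasure lborel U \<le> emeasure lborel C + emeasure lborel (U - C)"
      using U C UB emeasure_subadditive[of C lborel "U - C"] by (simp add: Un_absorb1)
    also have "\<dots> < ennreal m + ennreal e"
      using U(3) finC emeasure_eq_ennreal_measure[of lborel C] by (simp add: m_def)
    finally have "emeasure lborel U < ennreal (m + e)" using m e by simp
    moreover have "emeasure lborel (U \<inter> {a..b}) \<le> emeasure lborel U"
      using UB by (intro emeasure_mono) auto
    ultimately have "emeasure lborel (U \<inter> {a..b}) < ennreal (m + e)" by simp
    moreover from this have "emeasure lborel (U \<inter> {a..b}) = ennreal (W b)"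
      unfolding W_def by (intro emeasure_eq_ennreal_measure) auto
    ultimately show ?thesis using ennreal_less_iff[of "W b"] by (simp add: W_def)
  qed
  ultimately have "m \<le> \<theta> * (m + e)" using assms(3) by (meson less_imp_le mult_left_mono order_trans)
  also have "\<dots> = m - (1 - \<theta>) * (1 - \<theta>) * m" by (simp add: e_def algebra_simps)
  finally have "(1 - \<theta>) * (1 - \<theta>) * m \<le> 0" by simp
  moreover have "(1 - \<theta>) * (1 - \<theta>) * m > 0" using m assms(2) by simp
  ultimately show False by simp
qed

lemma null_if_compact_subsets_null:
  fixes E :: "real set"
  assumes E: "E \<in> sets borel" and null: "\<And>C. compact C \<Longrightarrow> C \<subseteq> E \<Longrightarrow> emeasure lborel C = 0"
  shows "emeasure lborel E = 0"
proof -
  have "emeasure lborel (E \<inter> {- real n..real n}) = 0" for n :: nat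
  proof -
    define M where "M = density lborel (indicator {- real n..real n} :: real \<Rightarrow> ennreal)"
    have M: "emeasure M A = emeasure lborel (A \<inter> {- real n..real n})" if "A \<in> sets borel" for A
      using that by (simp add: M_def emeasure_density Int_commute flip: indicator_inter_arith)
    have "emeasure M K = 0" if "K \<subseteq> E" "compact K" for K
    proof -
      have K: "K \<in> sets borel" using that by (simp add: borel_compact)
      have "emeasure lborel (K \<inter> {- real n..real n}) \<le> emeasure lborel K"
        using K by (intro emeasure_mono) auto
      then show ?thesis using M[OF K] null[OF that(2,1)] by simp
    qed
    moreover have "emeasure M E = (SUP K \<in> {K. K \<subseteq> E \<and> compact K}. emeasure M K)"
    proof (rule inner_regular[OF _ _ E])
      show "sets M = sets borel" by (simp add: M_def)
      have "emeasure M (space M) = emeasure lborel {- real n..real n}"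
        using M[of UNIV] by (simp add: M_def)
      then show "emeasure M (space M) \<noteq> \<infinity>" by (simp add: emeasure_lborel_Icc_eq)
    qed
    ultimately have "emeasure M E = 0" by (auto simp: SUP_eq_const intro!: antisym SUP_least)
    then show ?thesis using M[OF E] by simp
  qed
  then have "emeasure lborel (\<Union>n::nat. E \<inter> {- real n..real n}) = 0"
    using E by (intro emeasure_UN_eq_0) auto
  moreover have "(\<Union>n::nat. E \<inter> {- real n..real n}) = E"
  proof -
    have "\<exists>n::nat. x \<in> {- real n..real n}" for x :: real
    proof -
      obtain n :: nat where "\<bar>x\<bar> \<le> real n" using real_arch_simple by blast
      then show ?thesis by (auto intro!: exI[of _ n])
    qed
    then show ?thesis by auto
  qed
  ultimately show ?thesis by simp
qed


text \<open>On a compact part \<open>C\<close> of \<open>E\<close> the increment of \<open>g\<close> is estimated from below by the slope \<open>q\<close> and, applied to \<open>- g\<close>,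
  from above by the slope \<open>p\<close>. The two estimates leave room for \<open>C\<close> in an interval only up to the proportion
  \<open>2 * L / (2 * L + (q - p))\<close>, which is less than one.\<close>

lemma null_disagreeing_slopes:
  fixes g :: "real \<Rightarrow> real"
  assumes lip: "L-lipschitz_on UNIV g" and E: "E \<in> sets borel" and "p < q"
    and up: "\<And>x d. x \<in> E \<Longrightarrow> d > 0 \<Longrightarrow> \<exists>y. x < y \<and> y < x + d \<and> q * (y - x) \<le> g y - g x"
    and lo: "\<And>x d. x \<in> E \<Longrightarrow> d > 0 \<Longrightarrow> \<exists>y. x < y \<and> y < x + d \<and> g y - g x \<le> p * (y - x)"
  shows "emeasure lborel E = 0"
proof (cases "E = {}")
  case False
  have gl: "\<bar>g y - g x\<bar> \<le> L * (y - x)" if "x < y" for x y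
    using lipschitz_onD[OF lip, of x y] that by (auto simp: dist_real_def)
  obtain x where "x \<in> E" using False by auto
  obtain y where y: "x < y" "q * (y - x) \<le> g y - g x" using up[OF \<open>x \<in> E\<close>, of 1] by auto
  then have "q * (y - x) \<le> L * (y - x)" using gl[of x y] by linarith
  then have qL: "q \<le> L" using y mult_le_cancel_right_pos[of "y - x" q L] by simp
  obtain z where z: "x < z" "g z - g x \<le> p * (z - x)" using lo[OF \<open>x \<in> E\<close>, of 1] by auto
  then have "- L * (z - x) \<le> p * (z - x)" using gl[of x z] by linarith
  then have pL: "- L \<le> p" using z mult_le_cancel_right_pos[of "z - x" "- L" p] by simp
  \<comment> \<open>The proportion of an interval that the two opposite slope estimates leave to the set.\<close>
  define \<theta> where "\<theta> = 2 * L / (2 * L + (q - p))"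
  have L: "0 \<le> L" using lipschitz_on_nonneg[OF lip] .
  have \<theta>: "\<theta> < 1" "0 \<le> \<theta>" using L \<open>p < q\<close> by (auto simp: \<theta>_def)
  have lip': "L-lipschitz_on UNIV (\<lambda>x. - g x)" using lip by (simp add: lipschitz_on_minus)
  have null: "measure lborel C = 0" if C: "compact C" "C \<subseteq> E" for C
  proof (rule null_if_density_lt_one[OF C(1) \<theta>])
    fix a b :: real assume ab: "a \<le> b"
    have 1: "(q + L) * measure lborel (C \<inter> {a..b}) \<le> g b - g a + L * (b - a)"
      by (rule increment_ge_on_steep_set[OF lip compact_imp_closed[OF C(1)] ab]) (use \<open>p < q\<close> pL C(2) up in auto)
    have 2: "(- p + L) * measure lborel (C \<inter> {a..b}) \<le> - g b - - g a + L * (b - a)"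
    proof (rule increment_ge_on_steep_set[OF lip' compact_imp_closed[OF C(1)] ab])
      show "- L \<le> - p" using \<open>p < q\<close> qL by simp
      fix x d :: real assume "x \<in> C" "0 < d"
      then obtain y where "x < y" "y < x + d" "g y - g x \<le> p * (y - x)" using lo[of x d] C(2) by blast
      then show "\<exists>y>x. y < x + d \<and> - p * (y - x) \<le> - g y - - g x" by auto
    qed
    have "(2 * L + (q - p)) * measure lborel (C \<inter> {a..b}) \<le> 2 * L * (b - a)"
      using 1 2 by (simp add: algebra_simps)
    then show "measure lborel (C \<inter> {a..b}) \<le> \<theta> * (b - a)"
      using L \<open>p < q\<close> by (simp add: \<theta>_def field_simps)
  qed
  show ?thesis
  proof (rule ccontr)
    assume "emeasure lborel E \<noteq> 0"
    then obtain C where C: "compact C" "C \<subseteq> E" "emeasure lborel C \<noteq> 0"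
      using null_if_compact_subsets_null[OF E] by blast
    then show False using null[OF C(1,2)] emeasure_compact_finite[OF C(1)]
      by (simp add: measure_def enn2real_eq_0_iff)
  qed
qed simp

section \<open>Directional derivatives of Lipschitz functions\<close>

text \<open>The limit is the supremum of the values that \<open>Q\<close> frequently exceeds. Rational thresholds suffice, which later leaves
  only countably many exceptional sets.\<close>

lemma convergent_if_no_oscillation:
  fixes Q :: "'b \<Rightarrow> real"
  assumes F: "F \<noteq> bot" and bd: "eventually (\<lambda>s. \<bar>Q s\<bar> \<le> B) F"
    and osc: "\<And>p q. p \<in> \<rat> \<Longrightarrow> q \<in> \<rat> \<Longrightarrow> p < q \<Longrightarrow> \<not> (frequently (\<lambda>s. Q s > q) F \<and> frequently (\<lambda>s. Q s < p) F)"
  shows "\<exists>l. (Q \<longlongrightarrow> l) F"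
proof -
  let ?S = "{c. frequently (\<lambda>s. Q s > c) F}"
  have "eventually (\<lambda>s. Q s > - B - 1) F" using bd by eventually_elim auto
  then have ne: "- B - 1 \<in> ?S" using F by (simp add: eventually_frequently)
  have ub: "c \<le> B" if c: "c \<in> ?S" for c
  proof (rule ccontr)
    assume "\<not> c \<le> B"
    have "eventually (\<lambda>s. \<not> Q s > c) F"
      using bd by eventually_elim (use \<open>\<not> c \<le> B\<close> in auto)
    then show False using c by (simp add: frequently_def)
  qed
  define l where "l = Sup ?S"
  have bdd: "bdd_above ?S" using ub by (auto simp: bdd_above_def)
  have "(Q \<longlongrightarrow> l) F"
  proof (rule order_tendstoI)
    fix a assume "a < l"
    then obtain c where c: "c \<in> ?S" "a < c"
      unfolding l_def using less_cSup_iff[of ?S a] ne bdd by blast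
    obtain p where p: "p \<in> \<rat>" "a < p" "p < c" using Rats_dense_in_real c(2) by blast
    obtain q where q: "q \<in> \<rat>" "p < q" "q < c" using Rats_dense_in_real p(3) by blast
    have "frequently (\<lambda>s. Q s > q) F"
      using c(1) q(3) by (auto elim!: frequently_elim1)
    then have "eventually (\<lambda>s. \<not> Q s < p) F" using osc[OF p(1) q(1,2)] by (simp add: frequently_def)
    then show "eventually (\<lambda>s. a < Q s) F" by eventually_elim (use p(2) in auto)
  next
    fix a assume "l < a"
    then obtain c where c: "l < c" "c < a" using dense by blast
    then have "c \<notin> ?S" using bdd cSup_upper[of c ?S] by (auto simp: l_def)
    then have "eventually (\<lambda>s. \<not> Q s > c) F" by (simp add: frequently_def)
    then show "eventually (\<lambda>s. Q s < a) F" by eventually_elim (use c(2) in auto)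
  qed
  then show ?thesis by blast
qed

lemma nn_integral_lborel_translation:
  fixes f :: "'a::euclidean_space \<Rightarrow> ennreal"
  assumes [measurable]: "f \<in> borel_measurable borel"
  shows "(\<integral>\<^sup>+x. f (x + c) \<partial>lborel) = (\<integral>\<^sup>+x. f x \<partial>lborel)"
proof -
  have "(\<integral>\<^sup>+x. f x \<partial>lborel) = (\<integral>\<^sup>+x. f x \<partial>distr lborel borel ((+) c))"
    by (simp add: lborel_distr_plus)
  also have "\<dots> = (\<integral>\<^sup>+x. f (c + x) \<partial>lborel)" by (intro nn_integral_distr) auto
  finally show ?thesis by (simp add: add.commute)
qed

text \<open>By translation invariance \<open>N\<close> has the same measure as each of its translates along \<open>v\<close>; averaging over the translates
  and exchanging the integrals turns that measure into an integral of the measures of line sections.\<close>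

lemma null_if_line_sections_null:
  fixes N :: "'a::euclidean_space set"
  assumes N: "N \<in> sets borel"
    and sec: "\<And>x. emeasure lborel {s::real. x + s *\<^sub>R v \<in> N} = 0"
  shows "emeasure lborel N = 0"
proof -
  have [measurable]: "N \<in> sets borel" by fact
  define I where "I = (indicator {0..1::real} :: real \<Rightarrow> ennreal)"
  have [measurable]: "I \<in> borel_measurable borel" by (simp add: I_def)
  have "emeasure lborel N = (\<integral>\<^sup>+s. I s * emeasure lborel N \<partial>lborel)"
    by (simp add: I_def nn_integral_multc)
  also have "\<dots> = (\<integral>\<^sup>+s. (\<integral>\<^sup>+x. I s * indicator N (x + s *\<^sub>R v) \<partial>lborel) \<partial>lborel)"
  proof (rule nn_integral_cong)
    fix s :: real
    have "(\<integral>\<^sup>+x. indicator N (x + s *\<^sub>R v) \<partial>lborel) = emeasure lborel N"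
      using nn_integral_lborel_translation[of "indicator N" "s *\<^sub>R v"] by simp
    then show "I s * emeasure lborel N = (\<integral>\<^sup>+x. I s * indicator N (x + s *\<^sub>R v) \<partial>lborel)"
      by (simp add: nn_integral_cmult)
  qed
  also have "\<dots> = (\<integral>\<^sup>+x. (\<integral>\<^sup>+s. I s * indicator N (x + s *\<^sub>R v) \<partial>lborel) \<partial>lborel)"
    by (rule lborel_pair.Fubini') measurable
  also have "\<dots> = (\<integral>\<^sup>+x. 0 \<partial>(lborel :: 'a measure))"
  proof (rule nn_integral_cong)
    fix x :: 'a
    have [measurable]: "{s. x + s *\<^sub>R v \<in> N} \<in> sets borel"
      using measurable_sets[of "\<lambda>s. x + s *\<^sub>R v" borel borel N] N by (simp add: vimage_def)
    have "(\<integral>\<^sup>+s. I s * indicator N (x + s *\<^sub>R v) \<partial>lborel)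
        \<le> (\<integral>\<^sup>+s. indicator {s. x + s *\<^sub>R v \<in> N} s \<partial>lborel)"
      by (intro nn_integral_mono) (auto simp: I_def indicator_def)
    also have "\<dots> = 0" using sec[of x] by simp
    finally show "(\<integral>\<^sup>+s. I s * indicator N (x + s *\<^sub>R v) \<partial>lborel) = 0" by simp
  qed
  finally show ?thesis by simp
qed

definition diff_quot :: "('a::real_vector \<Rightarrow> real) \<Rightarrow> 'a \<Rightarrow> 'a \<Rightarrow> real \<Rightarrow> real" where
  "diff_quot u v x s = (u (x + s *\<^sub>R v) - u x) / s"

lemma abs_diff_quot_le:
  fixes u :: "'a::real_normed_vector \<Rightarrow> real"
  assumes "L-lipschitz_on UNIV u" "s > 0"
  shows "\<bar>diff_quot u v x s\<bar> \<le> L * norm v"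
proof -
  have "\<bar>u (x + s *\<^sub>R v) - u x\<bar> \<le> L * (s * norm v)"
    using lipschitz_onD[OF assms(1), of "x + s *\<^sub>R v" x] assms(2) by (auto simp: dist_norm)
  then show ?thesis using assms(2) by (simp add: diff_quot_def field_simps)
qed

text \<open>If the right difference quotients at \<open>x\<close> oscillate, they do so across two rationals \<open>p < q\<close>. For fixed \<open>p\<close> and \<open>q\<close>
  such points form a Borel set, and on each line parallel to \<open>v\<close> they are points where the slopes of a Lipschitz
  function of one variable disagree.\<close>

lemma AE_right_directional_derivative:
  fixes u :: "'a::euclidean_space \<Rightarrow> real"
  assumes lip: "L-lipschitz_on UNIV u"
  shows "AE x in lborel. \<exists>l. (diff_quot u v x \<longlongrightarrow> l) (at_right 0)"
proof -
  have cu: "continuous_on UNIV u" using lipschitz_on_continuous_on[OF lip] .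
  define A where "A q n = (\<Union>s\<in>{0<..<inverse (Suc n)}. {x. u (x + s *\<^sub>R v) - u x > q * s})" for q :: real and n :: nat
  define B where "B p n = (\<Union>s\<in>{0<..<inverse (Suc n)}. {x. u (x + s *\<^sub>R v) - u x < p * s})" for p :: real and n :: nat
  define N where "N p q = (\<Inter>n. A q n \<inter> B p n)" for p q
  have cont: "continuous_on UNIV (\<lambda>x. u (x + s *\<^sub>R v) - u x)" for s
    by (intro continuous_intros continuous_on_compose2[OF cu] cu) auto
  have "open (A q n)" for q n unfolding A_def
    by (intro open_UN ballI open_Collect_less continuous_on_const cont)
  moreover have "open (B p n)" for p n unfolding B_def
    by (intro open_UN ballI open_Collect_less continuous_on_const cont)
  ultimately have N: "N p q \<in> sets borel" for p q unfolding N_def by auto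
  have null: "emeasure lborel (N p q) = 0" if "p < q" for p q
  proof (rule null_if_line_sections_null[OF N, where v = v])
    fix x
    have sm: "\<exists>n. inverse (Suc n) < d" if "d > 0" for d :: real
      using reals_Archimedean[OF that] by auto
    show "emeasure lborel {s. x + s *\<^sub>R v \<in> N p q} = 0"
    proof (rule null_disagreeing_slopes[OF _ _ \<open>p < q\<close>])
      show "(L * norm v)-lipschitz_on UNIV (\<lambda>s. u (x + s *\<^sub>R v))"
      proof (rule lipschitz_onI)
        fix s t :: real
        have "dist (u (x + s *\<^sub>R v)) (u (x + t *\<^sub>R v)) \<le> L * dist (x + s *\<^sub>R v) (x + t *\<^sub>R v)"
          using lipschitz_onD[OF lip] by blast
        also have "dist (x + s *\<^sub>R v) (x + t *\<^sub>R v) = norm v * dist s t"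
          by (simp add: dist_norm flip: scaleR_diff_left)
        finally show "dist (u (x + s *\<^sub>R v)) (u (x + t *\<^sub>R v)) \<le> L * norm v * dist s t" by simp
      qed (use lipschitz_on_nonneg[OF lip] in simp)
      show "{s. x + s *\<^sub>R v \<in> N p q} \<in> sets borel"
        using measurable_sets[of "\<lambda>s. x + s *\<^sub>R v" borel borel "N p q"] N by (simp add: vimage_def)
    next
      fix s d :: real assume s: "s \<in> {s. x + s *\<^sub>R v \<in> N p q}" and "d > 0"
      obtain n where n: "inverse (Suc n) < d" using sm[OF \<open>d > 0\<close>] by auto
      have "x + s *\<^sub>R v \<in> A q n" using s by (simp add: N_def)
      then obtain r where r: "0 < r" "r < inverse (Suc n)" "u (x + s *\<^sub>R v + r *\<^sub>R v) - u (x + s *\<^sub>R v) > q * r"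
        by (auto simp: A_def)
      then show "\<exists>y>s. y < s + d \<and> q * (y - s) \<le> u (x + y *\<^sub>R v) - u (x + s *\<^sub>R v)"
        using n by (intro exI[of _ "s + r"]) (auto simp: scaleR_add_left add.assoc)
    next
      fix s d :: real assume s: "s \<in> {s. x + s *\<^sub>R v \<in> N p q}" and "d > 0"
      obtain n where n: "inverse (Suc n) < d" using sm[OF \<open>d > 0\<close>] by auto
      have "x + s *\<^sub>R v \<in> B p n" using s by (simp add: N_def)
      then obtain r where r: "0 < r" "r < inverse (Suc n)" "u (x + s *\<^sub>R v + r *\<^sub>R v) - u (x + s *\<^sub>R v) < p * r"
        by (auto simp: B_def)
      then show "\<exists>y>s. y < s + d \<and> u (x + y *\<^sub>R v) - u (x + s *\<^sub>R v) \<le> p * (y - s)"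
        using n by (intro exI[of _ "s + r"]) (auto simp: scaleR_add_left add.assoc)
    qed
  qed
  have cR: "countable {(p, q). p \<in> \<rat> \<and> q \<in> \<rat> \<and> (p::real) < (q::real)}"
    by (rule countable_subset[of _ "\<rat> \<times> \<rat>"]) (auto simp: countable_rat)
  have "AE x in lborel. \<forall>(p, q)\<in>{(p, q). p \<in> \<rat> \<and> q \<in> \<rat> \<and> p < q}. x \<notin> N p q"
    unfolding AE_ball_countable[OF cR]
  proof safe
    fix p q :: real assume "p < q"
    have "N p q \<in> null_sets lborel" using null[OF \<open>p < q\<close>] N by (simp add: null_sets_def)
    then show "AE x in lborel. x \<notin> N p q" by (rule AE_not_in)
  qed
  then show ?thesis
  proof eventually_elim
    case (elim x)
    have quot: "(diff_quot u v x s > q) = (u (x + s *\<^sub>R v) - u x > q * s)"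
      "(diff_quot u v x s < q) = (u (x + s *\<^sub>R v) - u x < q * s)" if "s > 0" for s q
      using that by (auto simp: diff_quot_def field_simps)
    show ?case
    proof (rule convergent_if_no_oscillation)
      show "\<forall>\<^sub>F s in at_right 0. \<bar>diff_quot u v x s\<bar> \<le> L * norm v"
        using eventually_at_right_less by eventually_elim (rule abs_diff_quot_le[OF lip])
      fix p q :: real assume pq: "p \<in> \<rat>" "q \<in> \<rat>" "p < q"
      show "\<not> ((\<exists>\<^sub>F s in at_right 0. q < diff_quot u v x s) \<and> (\<exists>\<^sub>F s in at_right 0. diff_quot u v x s < p))"
      proof (intro notI, elim conjE)
        assume f: "\<exists>\<^sub>F s in at_right 0. q < diff_quot u v x s" "\<exists>\<^sub>F s in at_right 0. diff_quot u v x s < p"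
        have "x \<in> N p q" unfolding N_def
        proof (intro INT_I IntI)
          fix n :: nat
          have ev: "\<forall>\<^sub>F s in at_right 0. s \<in> {0<..<inverse (real (Suc n))}"
            by (rule eventually_at_right_real) simp
          obtain s where "s \<in> {0<..<inverse (real (Suc n))}" "q < diff_quot u v x s"
            using frequently_eventually_conj[OF f(1) ev] by (auto dest: frequently_ex)
          then show "x \<in> A q n" unfolding A_def using quot by auto
          obtain s where "s \<in> {0<..<inverse (real (Suc n))}" "diff_quot u v x s < p"
            using frequently_eventually_conj[OF f(2) ev] by (auto dest: frequently_ex)
          then show "x \<in> B p n" unfolding B_def using quot by auto
        qed
        then show False using elim pq by auto
      qed
    qed simp
  qed
qed

lemma integral_lborel_translation:
  fixes f :: "'a::euclidean_space \<Rightarrow> real"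
  assumes [measurable]: "f \<in> borel_measurable borel"
  shows "(\<integral>x. f (x + c) \<partial>lborel) = (\<integral>x. f x \<partial>lborel)"
    and "integrable lborel f \<Longrightarrow> integrable lborel (\<lambda>x. f (x + c))"
proof -
  have "(\<integral>x. f x \<partial>lborel) = (\<integral>x. f x \<partial>distr lborel borel ((+) c))"
    by (simp add: lborel_distr_plus)
  also have "\<dots> = (\<integral>x. f (c + x) \<partial>lborel)" by (intro integral_distr) auto
  finally show "(\<integral>x. f (x + c) \<partial>lborel) = (\<integral>x. f x \<partial>lborel)" by (simp add: add.commute)
  assume "integrable lborel f"
  then have "integrable (distr lborel borel ((+) c)) f" by (simp add: lborel_distr_plus)
  then have "integrable lborel (\<lambda>x. f (c + x))" by (subst (asm) integrable_distr_eq) auto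
  then show "integrable lborel (\<lambda>x. f (x + c))" by (simp add: add.commute)
qed

definition dir_deriv :: "('a::euclidean_space \<Rightarrow> real) \<Rightarrow> 'a \<Rightarrow> 'a \<Rightarrow> real" where
  "dir_deriv u v x = lim (\<lambda>n. diff_quot u v x (inverse (real (Suc n))))"

lemma inverse_Suc_at_right: "filterlim (\<lambda>n. inverse (real (Suc n))) (at_right 0) sequentially"
  unfolding filterlim_at using LIMSEQ_inverse_real_of_nat by auto

lemma measurable_diff_quot:
  fixes u :: "'a::euclidean_space \<Rightarrow> real"
  assumes "continuous_on UNIV u"
  shows "(\<lambda>x. diff_quot u v x s) \<in> borel_measurable borel"
proof -
  have [measurable]: "u \<in> borel_measurable borel" using assms by (rule borel_measurable_continuous_onI)
  show ?thesis unfolding diff_quot_def by measurable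
qed

lemma measurable_dir_deriv:
  assumes "continuous_on UNIV u"
  shows "dir_deriv u v \<in> borel_measurable borel"
  unfolding dir_deriv_def[abs_def]
  by (intro borel_measurable_lim_metric measurable_diff_quot assms)

lemma AE_tendsto_dir_deriv:
  assumes lip: "L-lipschitz_on UNIV u"
  shows "AE x in lborel. (diff_quot u v x \<longlongrightarrow> dir_deriv u v x) (at_right 0)"
  using AE_right_directional_derivative[OF lip, of v]
proof eventually_elim
  case (elim x)
  then obtain l where l: "(diff_quot u v x \<longlongrightarrow> l) (at_right 0)" by auto
  have "dir_deriv u v x = l" unfolding dir_deriv_def
    by (intro limI filterlim_compose[OF l inverse_Suc_at_right])
  then show ?case using l by simp
qed

text \<open>Away from the faces of the box, the indicator of a small translate eventually agrees with that of the box.\<close>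

lemma indicator_box_translation_L1:
  fixes l h v :: "'a::euclidean_space"
  assumes r: "r \<longlonglongrightarrow> 0" "\<And>n. \<bar>r n\<bar> \<le> 1"
  defines "B \<equiv> box l h"
  shows "(\<lambda>n. \<integral>x. \<bar>indicator B (x + r n *\<^sub>R v) - indicator B x :: real\<bar> \<partial>lborel) \<longlonglongrightarrow> 0"
    and "\<And>n. integrable lborel (\<lambda>x. \<bar>indicator B (x + r n *\<^sub>R v) - indicator B x :: real\<bar>)"
proof -
  obtain R where R: "R > 0" "\<And>x. x \<in> B \<Longrightarrow> norm x \<le> R"
    using bounded_box[of l h] unfolding B_def bounded_pos by auto
  define w where "w = (indicator (cball 0 (R + norm v)) :: 'a \<Rightarrow> real)"
  have iw: "integrable lborel w" unfolding w_def
    by (intro integrable_real_indicator) (use emeasure_compact_finite[OF compact_cball] in auto)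
  have [measurable]: "B \<in> sets borel" by (simp add: B_def)
  have AE: "AE x in lborel. (\<lambda>n. \<bar>indicator B (x + r n *\<^sub>R v) - indicator B x :: real\<bar>) \<longlonglongrightarrow> 0"
  proof -
    have "negligible (cbox l h - box l h)" by (rule negligible_frontier_interval)
    then have null: "cbox l h - box l h \<in> null_sets lborel"
      by (simp add: negligible_iff_null_sets null_sets_completion_iff)
    show ?thesis
    proof (rule AE_I'[OF null], safe)
      fix x assume x: "x \<in> space lborel" "\<not> (\<lambda>n. \<bar>indicator B (x + r n *\<^sub>R v) - indicator B x :: real\<bar>) \<longlonglongrightarrow> 0"
      have lim: "(\<lambda>n. x + r n *\<^sub>R v) \<longlonglongrightarrow> x" using tendsto_add[OF tendsto_const tendsto_scaleR[OF r(1) tendsto_const]] by auto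
      have sp: "x \<notin> S" if "open S" "\<And>x y. x \<in> S \<Longrightarrow> y \<in> S \<Longrightarrow> indicator B x = (indicator B y::real)" for S
      proof
        assume "x \<in> S"
        then have "\<forall>\<^sub>F n in sequentially. x + r n *\<^sub>R v \<in> S" using lim \<open>open S\<close> topological_tendstoD by blast
        then have "\<forall>\<^sub>F n in sequentially. 0 = \<bar>indicator B (x + r n *\<^sub>R v) - indicator B x :: real\<bar>"
        proof eventually_elim
          case (elim n)
          show ?case using that(2)[OF elim \<open>x \<in> S\<close>] by simp
        qed
        then have "(\<lambda>n. \<bar>indicator B (x + r n *\<^sub>R v) - indicator B x :: real\<bar>) \<longlonglongrightarrow> 0"
          by (rule Lim_transform_eventually[OF tendsto_const])
        then show False using x by simp
      qed
      have BC: "B \<subseteq> cbox l h" unfolding B_def by (rule box_subset_cbox)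
      have "x \<notin> - cbox l h" by (rule sp) (use BC in \<open>auto simp: indicator_def closed_cbox\<close>)
      then show "x \<in> cbox l h" by simp
      have "x \<notin> B" by (rule sp) (auto simp: B_def open_box)
      then show False if "x \<in> box l h" using that by (simp add: B_def)
    qed
  qed
  have bd: "AE x in lborel. norm (\<bar>indicator B (x + r n *\<^sub>R v) - indicator B x :: real\<bar>) \<le> w x" for n
  proof (rule AE_I2)
    fix x :: 'a
    have "norm x \<le> R + norm v" if "x + r n *\<^sub>R v \<in> B"
    proof -
      have "norm x \<le> norm (x + r n *\<^sub>R v) + norm (r n *\<^sub>R v)" by (metis add_diff_cancel norm_triangle_ineq4)
      also have "norm (r n *\<^sub>R v) \<le> 1 * norm v" using r(2)[of n] by (simp add: mult_right_mono mult_left_le_one_le)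
      finally show ?thesis using R(2)[OF that] by simp
    qed
    moreover have "norm x \<le> R + norm v" if "x \<in> B" using R(2)[OF that] by (simp add: add_increasing2)
    ultimately show "norm (\<bar>indicator B (x + r n *\<^sub>R v) - indicator B x :: real\<bar>) \<le> w x"
      by (auto simp: w_def indicator_def)
  qed
  show "(\<lambda>n. \<integral>x. \<bar>indicator B (x + r n *\<^sub>R v) - indicator B x :: real\<bar> \<partial>lborel) \<longlonglongrightarrow> 0"
    using integral_dominated_convergence[OF _ _ iw AE bd] by simp
  show "integrable lborel (\<lambda>x. \<bar>indicator B (x + r n *\<^sub>R v) - indicator B x :: real\<bar>)" for n
    using integrable_dominated_convergence2[OF _ _ iw AE bd] by simp
qed

text \<open>Adding a constant multiple of \<open>f\<close> to the constant density \<open>1\<close> does not change the measure of boxes, hence does not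
  change Lebesgue measure, and densities are unique up to null sets.\<close>

lemma AE_zero_if_box_integrals_zero:
  fixes f :: "'a::euclidean_space \<Rightarrow> real"
  assumes [measurable]: "f \<in> borel_measurable borel" and bd: "AE x in lborel. \<bar>f x\<bar> \<le> C"
    and zero: "\<And>l h. (\<integral>x. indicator (box l h) x * f x \<partial>lborel) = 0"
  shows "AE x in lborel. f x = 0"
proof -
  define D where "D = \<bar>C\<bar> + 1"
  have D: "D > 0" by (simp add: D_def)
  define g where "g x = ennreal (1 + f x / D)" for x
  have pos: "AE x in lborel. 0 \<le> 1 + f x / D" using bd
  proof eventually_elim
    case (elim x)
    then have "- D \<le> f x" by (simp add: D_def)
    then show ?case using D by (simp add: field_simps)
  qed
  have [measurable]: "g \<in> borel_measurable borel" unfolding g_def by measurable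
  \<comment> \<open>Lebesgue measure is determined by its values on boxes.\<close>
  have eq: "lborel = density lborel g"
  proof (rule lborel_eqI)
    fix l h :: 'a assume le: "\<And>b. b \<in> Basis \<Longrightarrow> l \<bullet> b \<le> h \<bullet> b"
    let ?I = "indicator (box l h) :: 'a \<Rightarrow> real"
    have iI: "integrable lborel ?I"
      by (intro integrable_real_indicator) (use emeasure_lborel_box_finite[of l h] in auto)
    have iF: "integrable lborel (\<lambda>x. ?I x * f x)"
    proof (rule Bochner_Integration.integrable_bound[OF integrable_mult_right[OF iI, of C]])
      show "AE x in lborel. norm (?I x * f x) \<le> norm (C * ?I x)"
        using bd by eventually_elim (auto simp: indicator_def)
    qed simp
    have "emeasure (density lborel g) (box l h) = (\<integral>\<^sup>+x. g x * indicator (box l h) x \<partial>lborel)"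
      by (intro emeasure_density) auto
    also have "\<dots> = (\<integral>\<^sup>+x. ennreal (?I x + (?I x * f x) / D) \<partial>lborel)"
      by (intro nn_integral_cong) (auto simp: g_def indicator_def)
    also have "\<dots> = ennreal (\<integral>x. ?I x + (?I x * f x) / D \<partial>lborel)"
    proof (rule nn_integral_eq_integral)
      show "integrable lborel (\<lambda>x. ?I x + (?I x * f x) / D)" using iI iF by auto
      show "AE x in lborel. 0 \<le> ?I x + (?I x * f x) / D" using pos
        by eventually_elim (auto simp: indicator_def)
    qed
    also have "(\<integral>x. ?I x + (?I x * f x) / D \<partial>lborel) = measure lborel (box l h)"
      using iI iF zero[of l h] by (subst Bochner_Integration.integral_add) auto
    also have "ennreal (measure lborel (box l h)) = emeasure lborel (box l h)"
      using emeasure_lborel_box_finite[of l h] by (intro emeasure_eq_ennreal_measure[symmetric]) auto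
    also have "\<dots> = (\<Prod>b\<in>Basis. (h - l) \<bullet> b)" using le by simp
    finally show "emeasure (density lborel g) (box l h) = (\<Prod>b\<in>Basis. (h - l) \<bullet> b)" .
  qed simp
  have eq1: "density lborel g = density lborel (\<lambda>_. 1)"
    by (rule trans[OF eq[symmetric] density_1[symmetric]])
  have "AE x in lborel. g x = 1"
    by (rule sigma_finite_measure.density_unique[OF sigma_finite_lborel _ _ eq1]) measurable
  with pos show ?thesis
  proof eventually_elim
    case (elim x)
    then have "1 + f x / D = 1" by (simp add: g_def)
    then show ?case using D by simp
  qed
qed

text \<open>The defect of additivity of the difference quotients at step \<open>r\<close> is the difference between the bounded function
  \<open>k x = diff_quot u w x r\<close> at \<open>x + r *\<^sub>R v\<close> and at \<open>x\<close>. Its integral over a box is the integral of \<open>k\<close> over the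
  difference between the box and its translate, which vanishes in the limit.\<close>

lemma AE_dir_deriv_add:
  fixes u :: "'a::euclidean_space \<Rightarrow> real"
  assumes lip: "L-lipschitz_on UNIV u"
  shows "AE x in lborel. dir_deriv u (v + w) x = dir_deriv u v x + dir_deriv u w x"
proof -
  have cu: "continuous_on UNIV u" using lipschitz_on_continuous_on[OF lip] .
  have L: "0 \<le> L" using lipschitz_on_nonneg[OF lip] .
  define \<psi> where "\<psi> x = dir_deriv u (v + w) x - dir_deriv u v x - dir_deriv u w x" for x
  define r where "r n = inverse (real (Suc n))" for n
  have r: "r n > 0" "\<bar>r n\<bar> \<le> 1" for n by (auto simp: r_def field_simps)
  have r0: "r \<longlonglongrightarrow> 0" unfolding r_def using LIMSEQ_inverse_real_of_nat by auto
  define S where "S n x = diff_quot u (v + w) x (r n) - diff_quot u v x (r n) - diff_quot u w x (r n)" for n x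
  define C where "C = L * norm (v + w) + L * norm v + L * norm w"
  note [measurable] = measurable_dir_deriv[OF cu] measurable_diff_quot[OF cu]
  have m\<psi>[measurable]: "\<psi> \<in> borel_measurable borel" unfolding \<psi>_def by measurable
  have mS[measurable]: "S n \<in> borel_measurable borel" for n unfolding S_def by measurable
  have lim: "AE x in lborel. (\<lambda>n. S n x) \<longlonglongrightarrow> \<psi> x"
    using AE_tendsto_dir_deriv[OF lip, of "v + w"] AE_tendsto_dir_deriv[OF lip, of v] AE_tendsto_dir_deriv[OF lip, of w]
  proof eventually_elim
    case (elim x)
    show ?case unfolding S_def \<psi>_def r_def
      by (intro tendsto_diff elim[THEN filterlim_compose[OF _ inverse_Suc_at_right]])
  qed
  have bS: "\<bar>S n x\<bar> \<le> C" for n x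
    using abs_diff_quot_le[OF lip r(1)[of n], of "v + w" x] abs_diff_quot_le[OF lip r(1)[of n], of v x]
      abs_diff_quot_le[OF lip r(1)[of n], of w x] unfolding S_def C_def by linarith
  have "AE x in lborel. \<bar>\<psi> x\<bar> \<le> C" using lim
  proof eventually_elim
    case (elim x)
    show ?case by (rule tendsto_upperbound[OF tendsto_rabs[OF elim]]) (auto simp: bS)
  qed
  then have "AE x in lborel. \<psi> x = 0"
  proof (rule AE_zero_if_box_integrals_zero[OF m\<psi>])
    fix l h :: 'a
    let ?I = "indicator (box l h) :: 'a \<Rightarrow> real"
    have iI: "integrable lborel ?I"
      by (intro integrable_real_indicator) (use emeasure_lborel_box_finite[of l h] in auto)
    have bdd_int: "integrable lborel (\<lambda>x. ?I x * k x)" if "k \<in> borel_measurable borel" "\<And>x. \<bar>k x\<bar> \<le> K" for k K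
    proof (rule Bochner_Integration.integrable_bound[OF integrable_mult_right[OF iI, of K]])
      show "(\<lambda>x. ?I x * k x) \<in> borel_measurable lborel" using that(1) by measurable
      show "AE x in lborel. norm (?I x * k x) \<le> norm (K * ?I x)"
        using order_trans[OF that(2) abs_ge_self] by (auto simp: indicator_def)
    qed
    have 1: "(\<lambda>n. \<integral>x. ?I x * S n x \<partial>lborel) \<longlonglongrightarrow> (\<integral>x. ?I x * \<psi> x \<partial>lborel)"
    proof (rule integral_dominated_convergence[OF _ _ integrable_mult_right[OF iI, of C]])
      show "AE x in lborel. (\<lambda>n. ?I x * S n x) \<longlonglongrightarrow> ?I x * \<psi> x"
        using lim by eventually_elim (intro tendsto_intros)
      show "AE x in lborel. norm (?I x * S n x) \<le> C * ?I x" for n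
        using bS by (auto simp: indicator_def)
    qed simp_all
    have 2: "(\<lambda>n. \<integral>x. ?I x * S n x \<partial>lborel) \<longlonglongrightarrow> 0"
    proof (rule Lim_null_comparison)
      show "(\<lambda>n. L * norm w * (\<integral>x. \<bar>?I (x + r n *\<^sub>R (- v)) - ?I x\<bar> \<partial>lborel)) \<longlonglongrightarrow> 0"
        using tendsto_mult[OF tendsto_const indicator_box_translation_L1(1)[OF r0 r(2), of l h "- v"]] by simp
      show "\<forall>\<^sub>F n in sequentially. norm (\<integral>x. ?I x * S n x \<partial>lborel)
          \<le> L * norm w * (\<integral>x. \<bar>?I (x + r n *\<^sub>R (- v)) - ?I x\<bar> \<partial>lborel)"
      proof (rule always_eventually, rule allI)
        fix n
        define k where "k x = diff_quot u w x (r n)" for x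
        have mk[measurable]: "k \<in> borel_measurable borel" unfolding k_def by measurable
        have bk: "\<bar>k x\<bar> \<le> L * norm w" for x unfolding k_def by (rule abs_diff_quot_le[OF lip r(1)])
        have S: "S n x = k (x + r n *\<^sub>R v) - k x" for x
          unfolding S_def k_def diff_quot_def by (simp add: scaleR_add_right add.assoc diff_divide_distrib)
        let ?g = "\<lambda>x. ?I x * k (x + r n *\<^sub>R v)"
        have mg: "?g \<in> borel_measurable borel" by measurable
        have ig: "integrable lborel ?g" by (rule bdd_int[where K = "L * norm w"]) (auto simp: bk)
        have tg: "?g (x + r n *\<^sub>R (- v)) = ?I (x + r n *\<^sub>R (- v)) * k x" for x by simp
        have "(\<integral>x. ?I x * S n x \<partial>lborel) = (\<integral>x. ?g x - ?I x * k x \<partial>lborel)"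
          by (simp add: S right_diff_distrib)
        also have "\<dots> = (\<integral>x. ?g x \<partial>lborel) - (\<integral>x. ?I x * k x \<partial>lborel)"
          by (intro Bochner_Integration.integral_diff ig bdd_int[where K = "L * norm w"]) (auto simp: bk)
        also have "(\<integral>x. ?g x \<partial>lborel) = (\<integral>x. ?I (x + r n *\<^sub>R (- v)) * k x \<partial>lborel)"
          using integral_lborel_translation(1)[OF mg, of "r n *\<^sub>R (- v)"] unfolding tg by simp
        also have "\<dots> - (\<integral>x. ?I x * k x \<partial>lborel) = (\<integral>x. ?I (x + r n *\<^sub>R (- v)) * k x - ?I x * k x \<partial>lborel)"
          using integral_lborel_translation(2)[OF mg ig, of "r n *\<^sub>R (- v)"] unfolding tg
          by (intro Bochner_Integration.integral_diff[symmetric] bdd_int[where K = "L * norm w"]) (auto simp: bk)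
        finally have eq: "(\<integral>x. ?I x * S n x \<partial>lborel) = (\<integral>x. (?I (x + r n *\<^sub>R (- v)) - ?I x) * k x \<partial>lborel)"
          by (simp add: left_diff_distrib)
        have "norm (\<integral>x. (?I (x + r n *\<^sub>R (- v)) - ?I x) * k x \<partial>lborel)
            \<le> (\<integral>x. L * norm w * \<bar>?I (x + r n *\<^sub>R (- v)) - ?I x\<bar> \<partial>lborel)"
        proof (rule Bochner_Integration.integral_norm_bound_integral)
          show i: "integrable lborel (\<lambda>x. L * norm w * \<bar>?I (x + r n *\<^sub>R (- v)) - ?I x\<bar>)"
            by (intro integrable_mult_right indicator_box_translation_L1(2)[OF r0 r(2)])
          show b: "norm ((?I (x + r n *\<^sub>R (- v)) - ?I x) * k x) \<le> L * norm w * \<bar>?I (x + r n *\<^sub>R (- v)) - ?I x\<bar>" for x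
            unfolding real_norm_def abs_mult by (subst mult.commute) (rule mult_right_mono[OF bk abs_ge_zero])
          show "integrable lborel (\<lambda>x. (?I (x + r n *\<^sub>R (- v)) - ?I x) * k x)"
          proof (rule Bochner_Integration.integrable_bound[OF i])
            show "AE x in lborel. norm ((?I (x + r n *\<^sub>R (- v)) - ?I x) * k x)
                \<le> norm (L * norm w * \<bar>?I (x + r n *\<^sub>R (- v)) - ?I x\<bar>)"
              by (intro AE_I2 order_trans[OF b]) simp
          qed measurable
        qed
        then show "norm (\<integral>x. ?I x * S n x \<partial>lborel)
          \<le> L * norm w * (\<integral>x. \<bar>?I (x + r n *\<^sub>R (- v)) - ?I x\<bar> \<partial>lborel)" using eq by simp
      qed
    qed
    show "(\<integral>x. ?I x * \<psi> x \<partial>lborel) = 0" by (rule LIMSEQ_unique[OF 1 2])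
  qed
  then show ?thesis by eventually_elim (simp add: \<psi>_def)
qed

section \<open>Rademacher's theorem\<close>

lemma tendsto_diff_quot_scaleR:
  assumes "(diff_quot u w x \<longlongrightarrow> l) (at_right 0)" "c > 0"
  shows "(diff_quot u (c *\<^sub>R w) x \<longlongrightarrow> c * l) (at_right 0)"
proof -
  have "filterlim (\<lambda>s. c * s) (at_right 0) (at_right (0::real))"
    unfolding filterlim_at
  proof
    show "((*) c \<longlongrightarrow> 0) (at_right 0)"
      using tendsto_mult_left[OF tendsto_ident_at, of c 0 "{0<..}"] by simp
    show "\<forall>\<^sub>F s in at_right 0. c * s \<in> {0<..} \<and> c * s \<noteq> 0"
      using eventually_at_right_less by eventually_elim (use assms(2) in auto)
  qed
  from filterlim_compose[OF assms(1) this]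
  have "((\<lambda>s. c * diff_quot u w x (c * s)) \<longlongrightarrow> c * l) (at_right 0)" by (rule tendsto_mult_left)
  moreover have "(\<lambda>s. c * diff_quot u w x (c * s)) = diff_quot u (c *\<^sub>R w) x"
    using assms(2) by (auto simp: diff_quot_def fun_eq_iff mult.commute)
  ultimately show ?thesis by simp
qed

lemma AE_dir_deriv_scaleR:
  fixes u :: "'a::euclidean_space \<Rightarrow> real"
  assumes lip: "L-lipschitz_on UNIV u"
  shows "AE x in lborel. dir_deriv u (c *\<^sub>R w) x = c * dir_deriv u w x"
proof -
  have pos: "AE x in lborel. dir_deriv u (c *\<^sub>R w) x = c * dir_deriv u w x" if "c > 0" for c
    using AE_tendsto_dir_deriv[OF lip, of w] AE_tendsto_dir_deriv[OF lip, of "c *\<^sub>R w"]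
  proof eventually_elim
    case (elim x)
    show ?case
      using tendsto_unique[OF _ elim(2) tendsto_diff_quot_scaleR[OF elim(1) that]] by simp
  qed
  have zero: "dir_deriv u 0 x = 0" for x
    by (simp add: dir_deriv_def diff_quot_def)
  consider "c > 0" | "c = 0" | "- c > 0" by linarith
  then show ?thesis
  proof cases
    case 3
    show ?thesis using pos[OF 3] AE_dir_deriv_add[OF lip, of "c *\<^sub>R w" "(- c) *\<^sub>R w"]
      by eventually_elim (simp add: zero)
  qed (use pos zero in auto)
qed

lemma AE_dir_deriv_linear:
  fixes u :: "'a::euclidean_space \<Rightarrow> real"
  assumes lip: "L-lipschitz_on UNIV u"
  shows "AE x in lborel. dir_deriv u v x = v \<bullet> (\<Sum>b\<in>Basis. dir_deriv u b x *\<^sub>R b)"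
proof -
  have "AE x in lborel. dir_deriv u (\<Sum>b\<in>F. (v \<bullet> b) *\<^sub>R b) x = (\<Sum>b\<in>F. (v \<bullet> b) * dir_deriv u b x)"
    if "finite F" for F using that
  proof induction
    case empty
    show ?case by (simp add: dir_deriv_def diff_quot_def)
  next
    case (insert b F)
    show ?case
      using insert.IH AE_dir_deriv_scaleR[OF lip, of "v \<bullet> b" b]
        AE_dir_deriv_add[OF lip, of "(v \<bullet> b) *\<^sub>R b" "\<Sum>b\<in>F. (v \<bullet> b) *\<^sub>R b"]
      by eventually_elim (simp add: insert.hyps)
  qed
  from this[OF finite_Basis] show ?thesis
    by eventually_elim (simp add: euclidean_representation inner_sum_right mult.commute)
qed

text \<open>The Lipschitz property lets finitely many directions, chosen from \<open>V\<close> close to every unit vector, control the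
  difference quotients in all directions at once.\<close>

lemma has_derivative_if_dense_directions:
  fixes u :: "'a::euclidean_space \<Rightarrow> real"
  assumes lip: "L-lipschitz_on UNIV u"
    and dense: "\<And>X. open X \<Longrightarrow> X \<noteq> {} \<Longrightarrow> \<exists>v\<in>V. v \<in> X"
    and dir: "\<And>v. v \<in> V \<Longrightarrow> (diff_quot u v x \<longlongrightarrow> v \<bullet> G) (at_right 0)"
  shows "(u has_derivative (\<lambda>h. h \<bullet> G)) (at x)"
  unfolding has_derivative_at_alt
proof (intro conjI allI impI)
  show "bounded_linear (\<lambda>h. h \<bullet> G)" by (rule bounded_linear_inner_left)
  fix e :: real assume "e > 0"
  have L: "0 \<le> L" using lipschitz_on_nonneg[OF lip] .
  define \<epsilon> where "\<epsilon> = e / (1 + L + norm G)"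
  have D: "1 + L + norm G > 0" using L by (simp add: add_pos_nonneg)
  have \<epsilon>: "\<epsilon> > 0" using \<open>e > 0\<close> D by (simp add: \<epsilon>_def)
  have "sphere 0 1 \<subseteq> (\<Union>v\<in>V. ball v \<epsilon>)"
  proof
    fix w :: 'a assume "w \<in> sphere 0 1"
    obtain v where "v \<in> V" "v \<in> ball w \<epsilon>" using dense[of "ball w \<epsilon>"] \<epsilon> by auto
    then show "w \<in> (\<Union>v\<in>V. ball v \<epsilon>)" by (auto simp: dist_commute)
  qed
  then obtain F where F: "F \<subseteq> V" "finite F" "sphere 0 1 \<subseteq> (\<Union>v\<in>F. ball v \<epsilon>)"
    using compactE_image[OF compact_sphere, of V "\<lambda>v. ball v \<epsilon>" 0 1] by blast
  have "\<forall>\<^sub>F s in at_right 0. \<forall>v\<in>F. \<bar>diff_quot u v x s - v \<bullet> G\<bar> < \<epsilon>"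
  proof (rule eventually_ball_finite[OF F(2)], rule ballI)
    fix v assume "v \<in> F"
    then show "\<forall>\<^sub>F s in at_right 0. \<bar>diff_quot u v x s - v \<bullet> G\<bar> < \<epsilon>"
      using tendstoD[OF dir \<epsilon>] F(1) by (auto simp: dist_real_def)
  qed
  then obtain d where d: "d > 0" "\<And>s v. 0 < s \<Longrightarrow> s < d \<Longrightarrow> v \<in> F \<Longrightarrow> \<bar>diff_quot u v x s - v \<bullet> G\<bar> < \<epsilon>"
    unfolding eventually_at_right_field by auto
  show "\<exists>d>0. \<forall>y. norm (y - x) < d \<longrightarrow> norm (u y - u x - (y - x) \<bullet> G) \<le> e * norm (y - x)"
  proof (intro exI[of _ d] conjI allI impI d(1))
    fix y assume y: "norm (y - x) < d"
    show "norm (u y - u x - (y - x) \<bullet> G) \<le> e * norm (y - x)"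
    proof (cases "y = x")
      case False
      define s where "s = norm (y - x)"
      define w where "w = (y - x) /\<^sub>R s"
      have s: "s > 0" "s < d" using False y by (auto simp: s_def)
      have yx: "y = x + s *\<^sub>R w" using s by (simp add: w_def)
      have "w \<in> sphere 0 1" using s by (simp add: w_def s_def)
      then obtain v where v: "v \<in> F" "norm (v - w) < \<epsilon>" using F(3) by (auto simp: dist_norm)
      have 1: "\<bar>u (x + s *\<^sub>R v) - u x - s * (v \<bullet> G)\<bar> \<le> s * \<epsilon>"
      proof -
        have "u (x + s *\<^sub>R v) - u x - s * (v \<bullet> G) = s * (diff_quot u v x s - v \<bullet> G)"
          using s by (simp add: diff_quot_def field_simps)
        then show ?thesis using d(2)[OF s v(1)] s by (simp add: abs_mult)
      qed
      have 2: "\<bar>u (x + s *\<^sub>R w) - u (x + s *\<^sub>R v)\<bar> \<le> L * (s * \<epsilon>)"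
      proof -
        have "dist (u (x + s *\<^sub>R w)) (u (x + s *\<^sub>R v)) \<le> L * dist (x + s *\<^sub>R w) (x + s *\<^sub>R v)"
          using lipschitz_onD[OF lip] by blast
        also have "dist (x + s *\<^sub>R w) (x + s *\<^sub>R v) = s * norm (v - w)"
          using s by (simp add: dist_norm norm_minus_commute flip: scaleR_diff_right)
        also have "L * \<dots> \<le> L * (s * \<epsilon>)" using L s v(2) by (intro mult_left_mono) auto
        finally show ?thesis by (simp add: dist_real_def)
      qed
      have 3: "\<bar>s * (v \<bullet> G) - s * (w \<bullet> G)\<bar> \<le> s * (\<epsilon> * norm G)"
      proof -
        have "\<bar>(v - w) \<bullet> G\<bar> \<le> \<epsilon> * norm G"
          using Cauchy_Schwarz_ineq2[of "v - w" G] v(2) by (meson less_imp_le mult_right_mono norm_ge_zero order_trans)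
        then have "s * \<bar>(v - w) \<bullet> G\<bar> \<le> s * (\<epsilon> * norm G)" using s by (intro mult_left_mono) auto
        then show ?thesis using s by (simp add: abs_mult inner_diff_left flip: right_diff_distrib)
      qed
      have "\<bar>u y - u x - s * (w \<bullet> G)\<bar> \<le> s * \<epsilon> + L * (s * \<epsilon>) + s * (\<epsilon> * norm G)"
        using 1 2 3 unfolding yx by linarith
      also have "\<dots> = s * (\<epsilon> * (1 + L + norm G))" by (simp add: algebra_simps)
      also have "\<epsilon> * (1 + L + norm G) = e" using D by (simp add: \<epsilon>_def)
      finally have "\<bar>u y - u x - s * (w \<bullet> G)\<bar> \<le> s * e" .
      moreover have "(y - x) \<bullet> G = s * (w \<bullet> G)" by (simp add: yx)
      ultimately show ?thesis by (metis mult.commute real_norm_def s_def)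
    qed simp
  qed
qed

text \<open>Rademacher's theorem. For a countable dense set of directions, the directional derivatives exist and depend linearly on
  the direction outside a single null set; there the function is differentiable.\<close>

lemma AE_differentiable_lipschitz_real:
  fixes u :: "'a::euclidean_space \<Rightarrow> real"
  assumes lip: "L-lipschitz_on UNIV u"
  shows "AE x in lborel. u differentiable (at x)"
proof -
  obtain V :: "'a set" where V: "countable V" "\<And>X. open X \<Longrightarrow> X \<noteq> {} \<Longrightarrow> \<exists>v\<in>V. v \<in> X"
    by (rule countable_dense_setE) blast
  have "AE x in lborel. \<forall>v\<in>V. (diff_quot u v x \<longlongrightarrow> dir_deriv u v x) (at_right 0)"
    by (simp add: AE_ball_countable[OF V(1)] AE_tendsto_dir_deriv[OF lip])
  moreover have "AE x in lborel. \<forall>v\<in>V. dir_deriv u v x = v \<bullet> (\<Sum>b\<in>Basis. dir_deriv u b x *\<^sub>R b)"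
    using AE_dir_deriv_linear[OF lip] by (simp add: AE_ball_countable[OF V(1)])
  ultimately show ?thesis
  proof eventually_elim
    case (elim x)
    then have "(u has_derivative (\<lambda>h. h \<bullet> (\<Sum>b\<in>Basis. dir_deriv u b x *\<^sub>R b))) (at x)"
      by (intro has_derivative_if_dense_directions[OF lip V(2)]) auto
    then show ?case by (auto simp: differentiable_def)
  qed
qed

lemma AE_differentiable_lipschitz:
  fixes f :: "'a::euclidean_space \<Rightarrow> 'b::euclidean_space"
  assumes lip: "L-lipschitz_on UNIV f"
  shows "AE x in lborel. f differentiable (at x)"
proof -
  have "AE x in lborel. \<forall>b\<in>Basis. (\<lambda>x. f x \<bullet> b) differentiable (at x)"
  proof (rule AE_finite_allI[OF finite_Basis])
    fix b :: 'b assume b: "b \<in> Basis"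
    have "L-lipschitz_on UNIV (\<lambda>x. f x \<bullet> b)"
    proof (rule lipschitz_onI)
      fix x y
      have "dist (f x \<bullet> b) (f y \<bullet> b) \<le> dist (f x) (f y)"
        using Basis_le_norm[OF b, of "f x - f y"] by (simp add: dist_norm inner_diff_left)
      also have "\<dots> \<le> L * dist x y" using lipschitz_onD[OF lip] by blast
      finally show "dist (f x \<bullet> b) (f y \<bullet> b) \<le> L * dist x y" .
    qed (rule lipschitz_on_nonneg[OF lip])
    then show "AE x in lborel. (\<lambda>x. f x \<bullet> b) differentiable (at x)"
      by (rule AE_differentiable_lipschitz_real)
  qed
  then show ?thesis
    by eventually_elim (subst differentiable_componentwise_within, simp)
qed

section \<open>The loop sum of a parallelogram\<close>

lemma tendsto_diff_quot_has_derivative: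
  assumes "(u has_derivative u') (at y)"
  shows "(diff_quot u v y \<longlongrightarrow> u' v) (at_right 0)"
proof -
  have lin: "linear u'" using assms by (rule has_derivative_linear)
  have "((\<lambda>s. u (y + s *\<^sub>R v)) has_derivative (\<lambda>s. u' (s *\<^sub>R v))) (at 0)"
    by (rule has_derivative_compose[of "\<lambda>s. y + s *\<^sub>R v" "\<lambda>s. s *\<^sub>R v" 0 UNIV u u', simplified])
      (use assms in \<open>auto intro!: derivative_eq_intros\<close>)
  then have "((\<lambda>s. u (y + s *\<^sub>R v)) has_real_derivative u' v) (at 0)"
    by (rule has_derivative_imp_has_field_derivative) (simp add: linear_cmul[OF lin])
  then have "(diff_quot u v y \<longlongrightarrow> u' v) (at 0)"
    by (simp add: DERIV_def diff_quot_def[abs_def])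
  then show ?thesis by (rule tendsto_mono[rotated]) (simp add: at_le)
qed

text \<open>A discrete Green formula: the left-hand side samples \<open>u\<close> and \<open>w\<close> on the sides of the parallelogram spanned by
  \<open>t *\<^sub>R a\<close> and \<open>t *\<^sub>R b\<close>, the right-hand side adds up its cells, whose inner edges cancel.\<close>

lemma parallelogram_sum_eq:
  fixes u w :: "'a::real_vector \<Rightarrow> real"
  assumes "N > 0" "t \<noteq> 0"
  defines "\<delta> \<equiv> t / real N"
  shows "(\<Sum>i<N. \<delta> * (u (x + (real i * \<delta>) *\<^sub>R a) - u (x + (real i * \<delta>) *\<^sub>R a + t *\<^sub>R b)))
      + (\<Sum>j<N. \<delta> * (w (x + t *\<^sub>R a + (real j * \<delta>) *\<^sub>R b) - w (x + (real j * \<delta>) *\<^sub>R b)))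
    = (\<Sum>i<N. \<Sum>j<N. \<delta> * \<delta> * (diff_quot w a (x + (real i * \<delta>) *\<^sub>R a + (real j * \<delta>) *\<^sub>R b) \<delta>
        - diff_quot u b (x + (real i * \<delta>) *\<^sub>R a + (real j * \<delta>) *\<^sub>R b) \<delta>))"
proof -
  define P where "P i j = x + (real i * \<delta>) *\<^sub>R a + (real j * \<delta>) *\<^sub>R b" for i j :: nat
  have d: "\<delta> \<noteq> 0" "real N * \<delta> = t" using assms by (auto simp: \<delta>_def)
  have 1: "\<delta> * \<delta> * diff_quot u b (P i j) \<delta> = \<delta> * (u (P i (Suc j)) - u (P i j))" for i j
  proof -
    have "P i (Suc j) = P i j + \<delta> *\<^sub>R b" by (simp add: P_def algebra_simps)
    then show ?thesis using d by (simp add: diff_quot_def)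
  qed
  have 2: "\<delta> * \<delta> * diff_quot w a (P i j) \<delta> = \<delta> * (w (P (Suc i) j) - w (P i j))" for i j
  proof -
    have "P (Suc i) j = P i j + \<delta> *\<^sub>R a" by (simp add: P_def algebra_simps)
    then show ?thesis using d by (simp add: diff_quot_def)
  qed
  have "(\<Sum>i<N. \<Sum>j<N. \<delta> * \<delta> * (diff_quot w a (P i j) \<delta> - diff_quot u b (P i j) \<delta>))
      = (\<Sum>i<N. \<Sum>j<N. \<delta> * \<delta> * diff_quot w a (P i j) \<delta>) - (\<Sum>i<N. \<Sum>j<N. \<delta> * \<delta> * diff_quot u b (P i j) \<delta>)"
    by (simp add: right_diff_distrib sum_subtractf)
  also have "(\<Sum>i<N. \<Sum>j<N. \<delta> * \<delta> * diff_quot w a (P i j) \<delta>) = (\<Sum>j<N. \<Sum>i<N. \<delta> * (w (P (Suc i) j) - w (P i j)))"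
    unfolding 2 by (rule sum.swap)
  also have "\<dots> = (\<Sum>j<N. \<delta> * (w (P N j) - w (P 0 j)))"
  proof (rule sum.cong[OF refl])
    fix j
    show "(\<Sum>i<N. \<delta> * (w (P (Suc i) j) - w (P i j))) = \<delta> * (w (P N j) - w (P 0 j))"
      using sum_lessThan_telescope[of "\<lambda>i. w (P i j)" N] by (simp flip: sum_distrib_left)
  qed
  also have "(\<Sum>i<N. \<Sum>j<N. \<delta> * \<delta> * diff_quot u b (P i j) \<delta>) = (\<Sum>i<N. \<delta> * (u (P i N) - u (P i 0)))"
    unfolding 1
  proof (rule sum.cong[OF refl])
    fix i
    show "(\<Sum>j<N. \<delta> * (u (P i (Suc j)) - u (P i j))) = \<delta> * (u (P i N) - u (P i 0))"
      using sum_lessThan_telescope[of "\<lambda>j. u (P i j)" N] by (simp flip: sum_distrib_left)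
  qed
  finally show ?thesis using d(2)
    by (simp add: P_def right_diff_distrib sum_subtractf)
qed

text \<open>The number \<open>w' a - u' b\<close> is the density of circulation of the pair \<open>(u, w)\<close> around the parallelogram. It is known
  only almost everywhere, and the parallelogram may well lie in the exceptional null set; therefore the sum is averaged over small translations of
  \<open>x\<close>, which changes it little because \<open>u\<close> and \<open>w\<close> are Lipschitz. The excess of the difference quotients over \<open>- \<kappa>\<close>
  tends to zero in \<open>L\<^sup>1\<close> of the ball by dominated convergence, which handles all cells of the grid with a
  single integral.\<close>

lemma parallelogram_sum_le:
  fixes u w :: "'a::euclidean_space \<Rightarrow> real"
  assumes lu: "L-lipschitz_on UNIV u" and lw: "L-lipschitz_on UNIV w"
    and curl: "AE y in lborel. y \<in> ball z \<epsilon> \<longrightarrow>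
      (\<exists>u' w'. (u has_derivative u') (at y) \<and> (w has_derivative w') (at y) \<and> w' a - u' b \<le> - \<kappa>)"
    and "t > 0" and par: "\<And>s r. s \<in> {0..t} \<Longrightarrow> r \<in> {0..t} \<Longrightarrow> dist z (x + s *\<^sub>R a + r *\<^sub>R b) \<le> \<epsilon>'"
    and "\<epsilon>' < \<epsilon>" "\<mu> > 0"
  shows "\<forall>\<^sub>F N in sequentially.
      (\<Sum>i<N. t / N * (u (x + (real i * (t / N)) *\<^sub>R a) - u (x + (real i * (t / N)) *\<^sub>R a + t *\<^sub>R b)))
      + (\<Sum>j<N. t / N * (w (x + t *\<^sub>R a + (real j * (t / N)) *\<^sub>R b) - w (x + (real j * (t / N)) *\<^sub>R b)))
      \<le> - \<kappa> * t\<^sup>2 + \<mu>"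
proof -
  have L: "0 \<le> L" using lipschitz_on_nonneg[OF lu] .
  note cu = lipschitz_on_continuous_on[OF lu] note cw = lipschitz_on_continuous_on[OF lw]
  define R where "R N y = (\<Sum>i<N. t / N * (u (y + (real i * (t / N)) *\<^sub>R a) - u (y + (real i * (t / N)) *\<^sub>R a + t *\<^sub>R b)))
      + (\<Sum>j<N. t / N * (w (y + t *\<^sub>R a + (real j * (t / N)) *\<^sub>R b) - w (y + (real j * (t / N)) *\<^sub>R b)))" for N :: nat and y
  define q where "q N y = diff_quot w a y (t / real N) - diff_quot u b y (t / real N)" for N :: nat and y
  define g where "g N y = indicator (ball z \<epsilon>) y * max 0 (q N y + \<kappa>)" for N y
  define P where "P N i j = x + (real i * (t / N)) *\<^sub>R a + (real j * (t / N)) *\<^sub>R b" for N i j :: nat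
  have mg[measurable]: "g N \<in> borel_measurable borel" for N unfolding g_def q_def
    by (intro borel_measurable_times borel_measurable_indicator borel_measurable_max
        borel_measurable_add borel_measurable_diff measurable_diff_quot cu cw) auto
  define C where "C = L * norm a + L * norm b + \<bar>\<kappa>\<bar>"
  have iI: "integrable lborel (indicator (ball z \<epsilon>) :: 'a \<Rightarrow> real)"
    by (intro integrable_real_indicator) (use emeasure_bounded_finite[OF bounded_ball] in auto)
  have gN: "norm (g N y) \<le> C * indicator (ball z \<epsilon>) y" if "N > 0" for N y
  proof -
    have s: "t / real N > 0" using that \<open>t > 0\<close> by simp
    have "\<bar>q N y + \<kappa>\<bar> \<le> C"
      using abs_diff_quot_le[OF lw s, of a y] abs_diff_quot_le[OF lu s, of b y]
      unfolding q_def C_def by linarith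
    then show ?thesis by (auto simp: g_def indicator_def)
  qed
  have g0: "g N y \<ge> 0" for N y by (simp add: g_def)
  have \<delta>0: "filterlim (\<lambda>N. t / real (Suc N)) (at_right 0) sequentially"
    unfolding filterlim_at
  proof
    show "(\<lambda>N. t / real (Suc N)) \<longlonglongrightarrow> 0"
      using tendsto_mult[OF tendsto_const LIMSEQ_inverse_real_of_nat, of t] by (simp add: field_simps)
    show "\<forall>\<^sub>F N in sequentially. t / real (Suc N) \<in> {0<..} \<and> t / real (Suc N) \<noteq> 0" using \<open>t > 0\<close> by simp
  qed
  have int_g: "(\<lambda>N. \<integral>y. g (Suc N) y \<partial>lborel) \<longlonglongrightarrow> (\<integral>y. 0 \<partial>(lborel :: 'a measure))"
  proof (rule integral_dominated_convergence[OF _ _ integrable_mult_right[OF iI, of C]])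
    show "AE y in lborel. (\<lambda>N. g (Suc N) y) \<longlonglongrightarrow> 0" using curl
    proof eventually_elim
      case (elim y)
      show ?case
      proof (cases "y \<in> ball z \<epsilon>")
        case True
        then obtain u' w' where D: "(u has_derivative u') (at y)" "(w has_derivative w') (at y)" "w' a - u' b \<le> - \<kappa>"
          using elim by auto
        have "(\<lambda>N. q (Suc N) y) \<longlonglongrightarrow> w' a - u' b" unfolding q_def
          by (intro tendsto_diff filterlim_compose[OF _ \<delta>0] tendsto_diff_quot_has_derivative D)
        then have "(\<lambda>N. max 0 (q (Suc N) y + \<kappa>)) \<longlonglongrightarrow> max 0 (w' a - u' b + \<kappa>)" by (intro tendsto_intros)
        then show ?thesis using D(3) True by (simp add: g_def)
      qed (simp add: g_def)
    qed
    show "AE y in lborel. norm (g (Suc N) y) \<le> C * indicator (ball z \<epsilon>) y" for N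
      using gN by simp
  qed simp_all
  \<comment> \<open>Translations by less than this keep the parallelogram in the ball and cost at most half of the tolerance.\<close>
  define \<rho> where "\<rho> = min (\<epsilon> - \<epsilon>') (\<mu> / (8 * (L * t + 1)))"
  have Lt: "L * t + 1 > 0" using L \<open>t > 0\<close> by (simp add: add_nonneg_pos)
  have \<rho>: "\<rho> > 0" "\<rho> \<le> \<epsilon> - \<epsilon>'" using \<open>\<epsilon>' < \<epsilon>\<close> \<open>\<mu> > 0\<close> Lt by (auto simp: \<rho>_def)
  have L\<rho>: "4 * L * t * \<rho> \<le> \<mu> / 2"
  proof -
    have "4 * (L * t) * \<rho> \<le> 4 * (L * t + 1) * (\<mu> / (8 * (L * t + 1)))"
      using L \<open>t > 0\<close> Lt \<rho> by (intro mult_mono) (auto simp: \<rho>_def)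
    also have "\<dots> = \<mu> / 2" using Lt by (simp add: field_simps)
    finally show ?thesis by simp
  qed
  define m where "m = measure lborel (ball (0::'a) \<rho>)"
  have m: "m > 0" unfolding m_def using content_ball_pos[OF \<rho>(1)] by simp
  have ev: "\<forall>\<^sub>F N in sequentially. t\<^sup>2 * (\<integral>y. g (Suc N) y \<partial>lborel) < m * \<mu> / 2"
  proof (rule order_tendstoD)
    show "(\<lambda>N. t\<^sup>2 * (\<integral>y. g (Suc N) y \<partial>lborel)) \<longlonglongrightarrow> 0"
      using tendsto_mult[OF tendsto_const int_g, of "t\<^sup>2"] by simp
  qed (use m \<open>\<mu> > 0\<close> in simp)
  have main: "R N x \<le> - \<kappa> * t\<^sup>2 + \<mu>" if N: "N > 0" and small: "t\<^sup>2 * (\<integral>y. g N y \<partial>lborel) < m * \<mu> / 2" for N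
  proof -
    define \<delta> where "\<delta> = t / real N"
    have \<delta>: "\<delta> > 0" "real N * \<delta> = t" using N \<open>t > 0\<close> by (auto simp: \<delta>_def)
    have Req: "R N y = (\<Sum>i<N. \<Sum>j<N. \<delta> * \<delta> * q N (y - x + P N i j))" for y
    proof -
      have "R N y = (\<Sum>i<N. \<Sum>j<N. \<delta> * \<delta> * q N (y + (real i * \<delta>) *\<^sub>R a + (real j * \<delta>) *\<^sub>R b))"
        unfolding R_def q_def \<delta>_def
        by (rule parallelogram_sum_eq) (use N \<open>t > 0\<close> in auto)
      then show ?thesis by (simp add: P_def \<delta>_def algebra_simps)
    qed
    have Rlip: "R N x \<le> R N (x + h) + 4 * L * t * norm h" for h
    proof -
      have l: "\<bar>v (y + h) - v y\<bar> \<le> L * norm h" if "L-lipschitz_on UNIV v" for v :: "'a \<Rightarrow> real" and y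
        using lipschitz_onD[OF that, of "y + h" y] by (simp add: dist_norm)
      have uu: "t / N * (u (x + y) - u (x + y + v)) \<le> t / N * (u (x + h + y) - u (x + h + y + v)) + t / N * (2 * L * norm h)" for y v
        unfolding distrib_left[symmetric]
        using l[OF lu, of "x + y"] l[OF lu, of "x + y + v"] \<open>t > 0\<close>
        by (intro mult_left_mono) (auto simp: algebra_simps)
      have ww: "t / N * (w (x + v + y) - w (x + y)) \<le> t / N * (w (x + h + v + y) - w (x + h + y)) + t / N * (2 * L * norm h)" for y v
        unfolding distrib_left[symmetric]
        using l[OF lw, of "x + y"] l[OF lw, of "x + v + y"] \<open>t > 0\<close>
        by (intro mult_left_mono) (auto simp: algebra_simps)
      have "R N x \<le> (\<Sum>i<N. t / N * (u (x + h + (real i * (t / N)) *\<^sub>R a) - u (x + h + (real i * (t / N)) *\<^sub>R a + t *\<^sub>R b)) + t / N * (2 * L * norm h))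
        + (\<Sum>j<N. t / N * (w (x + h + t *\<^sub>R a + (real j * (t / N)) *\<^sub>R b) - w (x + h + (real j * (t / N)) *\<^sub>R b)) + t / N * (2 * L * norm h))"
        unfolding R_def by (intro add_mono sum_mono uu ww)
      also have "\<dots> = R N (x + h) + 2 * (real N * (t / N * (2 * L * norm h)))"
        unfolding R_def by (simp add: sum.distrib)
      finally show ?thesis using N by (simp add: mult_ac)
    qed
    have Pin: "P N i j + h \<in> ball z \<epsilon>" if "i < N" "j < N" "h \<in> ball 0 \<rho>" for i j h
    proof -
      have *: "real k * (t / N) \<in> {0..t}" if "k < N" for k
        using that N \<open>t > 0\<close> by (auto simp: field_simps)
      have "dist z (P N i j + h) \<le> dist z (P N i j) + norm h"
        using dist_triangle[of z "P N i j + h" "P N i j"] by (simp add: dist_norm)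
      also have "dist z (P N i j) \<le> \<epsilon>'" unfolding P_def by (rule par[OF *[OF that(1)] *[OF that(2)]])
      finally show ?thesis using that(3) \<rho>(2) by (simp add: dist_norm)
    qed
    define c where "c = R N x - \<mu> / 2 + \<kappa> * t\<^sup>2"
    \<comment> \<open>The averaging inequality before integration in the translation \<open>h\<close>.\<close>
    have pt: "c * indicator (ball 0 \<rho>) h \<le> (\<Sum>i<N. \<Sum>j<N. \<delta> * \<delta> * g N (h + P N i j))" for h
    proof (cases "h \<in> ball 0 \<rho>")
      case True
      have "R N x \<le> R N (x + h) + \<mu> / 2"
      proof -
        have "4 * L * t * norm h \<le> 4 * L * t * \<rho>" using True L \<open>t > 0\<close> by (intro mult_left_mono) auto
        then show ?thesis using Rlip[of h] L\<rho> by linarith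
      qed
      also have "R N (x + h) = (\<Sum>i<N. \<Sum>j<N. \<delta> * \<delta> * q N (h + P N i j))" by (simp add: Req)
      also have "\<dots> \<le> (\<Sum>i<N. \<Sum>j<N. \<delta> * \<delta> * (g N (h + P N i j) - \<kappa>))"
      proof (intro sum_mono mult_left_mono)
        fix i j assume "i \<in> {..<N}" "j \<in> {..<N}"
        then have "h + P N i j \<in> ball z \<epsilon>" using Pin[of i j h] True by (simp add: add.commute)
        then show "q N (h + P N i j) \<le> g N (h + P N i j) - \<kappa>" by (simp add: g_def)
      qed (use \<delta> in auto)
      also have "\<dots> = (\<Sum>i<N. \<Sum>j<N. \<delta> * \<delta> * g N (h + P N i j)) - \<kappa> * t\<^sup>2"
        unfolding \<delta>(2)[symmetric] by (simp add: right_diff_distrib sum_subtractf power2_eq_square algebra_simps)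
      finally show ?thesis using True by (simp add: c_def)
    next
      case False
      then show ?thesis using g0 \<delta> by (auto intro!: sum_nonneg mult_nonneg_nonneg)
    qed
    have ig: "integrable lborel (g N)"
      by (rule Bochner_Integration.integrable_bound[OF integrable_mult_right[OF iI, of C]])
        (use order_trans[OF gN[OF N] abs_ge_self] in auto)
    have "c * m = (\<integral>h. c * indicator (ball (0::'a) \<rho>) h \<partial>lborel)" by (simp add: m_def)
    also have "\<dots> \<le> (\<integral>h. (\<Sum>i<N. \<Sum>j<N. \<delta> * \<delta> * g N (h + P N i j)) \<partial>lborel)"
    proof (rule integral_mono[OF _ _ pt])
      show "integrable lborel (\<lambda>h. c * indicat_real (ball (0::'a) \<rho>) h)"
        by (intro integrable_mult_right integrable_real_indicator) (use emeasure_bounded_finite[OF bounded_ball] in auto)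
      show "integrable lborel (\<lambda>h. \<Sum>i<N. \<Sum>j<N. \<delta> * \<delta> * g N (h + P N i j))"
        by (intro Bochner_Integration.integrable_sum integrable_mult_right integral_lborel_translation(2)[OF mg ig])
    qed
    also have "\<dots> = (\<Sum>i<N. \<Sum>j<N. \<delta> * \<delta> * (\<integral>y. g N y \<partial>lborel))"
      by (simp add: Bochner_Integration.integral_sum integral_lborel_translation[OF mg] ig integrable_mult_right)
    also have "\<dots> = t\<^sup>2 * (\<integral>y. g N y \<partial>lborel)"
      unfolding \<delta>(2)[symmetric] by (simp add: power2_eq_square algebra_simps)
    also have "\<dots> < m * \<mu> / 2" by (rule small)
    finally have "c * m < \<mu> / 2 * m" by (simp add: mult.commute)
    then have "c < \<mu> / 2" using m by simp
    then show ?thesis by (simp add: c_def)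
  qed
  have "\<forall>\<^sub>F N in sequentially. R (Suc N) x \<le> - \<kappa> * t\<^sup>2 + \<mu>"
    using ev by eventually_elim (rule main, auto)
  then have "\<forall>\<^sub>F N in sequentially. R N x \<le> - \<kappa> * t\<^sup>2 + \<mu>" by (rule eventually_sequentially_Suc[THEN iffD1])
  then show ?thesis unfolding R_def .
qed

section \<open>Flows and trajectories\<close>

lemma norm_increment_le:
  fixes g :: "real \<Rightarrow> 'a::euclidean_space"
  assumes "finite N" "a \<le> b" "continuous_on {a..b} g"
    and "\<And>s. s \<in> {a<..<b} - N \<Longrightarrow> (g has_vector_derivative g' s) (at s)"
    and bd: "\<And>s. s \<in> {a..b} \<Longrightarrow> norm (g' s) \<le> B"
  shows "norm (g b - g a) \<le> B * (b - a)"
proof -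
  have "(g' has_integral (g b - g a)) (cbox a b)"
    unfolding cbox_interval
    by (rule fundamental_theorem_of_calculus_interior_strong[OF assms(1,2) _ assms(3)]) (rule assms(4))
  moreover have "0 \<le> B" by (rule order_trans[OF norm_ge_zero bd[of a]]) (use \<open>a \<le> b\<close> in auto)
  ultimately show ?thesis using has_integral_bound[of B g' "g b - g a" a b] bd content_real[OF \<open>a \<le> b\<close>] by simp
qed

text \<open>Contraction principle on bounded continuous functions on the line; constant continuation outside \<open>{0..\<tau>}\<close> makes
  the integral operator act on that space.\<close>

lemma picard_lindeloef:
  fixes F :: "'a::euclidean_space \<Rightarrow> 'a"
  assumes lip: "L-lipschitz_on UNIV F" and \<tau>: "0 \<le> \<tau>" "L * \<tau> < 1"
  shows "\<exists>y. y 0 = x \<and> (\<forall>t\<in>{0..\<tau>}. (y has_vector_derivative F (y t)) (at t within {0..\<tau>}))"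
proof -
  have L: "0 \<le> L" using lipschitz_on_nonneg[OF lip] .
  have cF: "continuous_on UNIV F" using lipschitz_on_continuous_on[OF lip] .
  define I where "I y t = x + integral {0..t} (\<lambda>s. F (apply_bcontfun y s))" for y :: "real \<Rightarrow>\<^sub>C 'a" and t
  define c where "c t = max 0 (min \<tau> t)" for t :: real
  have c: "c t \<in> {0..\<tau>}" for t using \<tau> by (auto simp: c_def)
  have cid: "c t = t" if "t \<in> {0..\<tau>}" for t using that by (auto simp: c_def)
  have cc: "continuous_on UNIV c" unfolding c_def by (intro continuous_intros)
  have cont: "continuous_on S (\<lambda>s. F (apply_bcontfun y s))" for y :: "real \<Rightarrow>\<^sub>C 'a" and S
    by (rule continuous_on_compose2[OF cF]) auto
  have cI: "continuous_on {0..\<tau>} (I y)" for y unfolding I_def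
    by (intro continuous_intros indefinite_integral_continuous_1 integrable_continuous_real cont)
  have bc: "(\<lambda>t. I y (c t)) \<in> bcontfun" for y
  proof -
    have "continuous_on UNIV (\<lambda>t. I y (c t))" by (rule continuous_on_compose2[OF cI cc]) (use c in auto)
    moreover have "bounded (I y ` {0..\<tau>})" by (intro compact_imp_bounded compact_continuous_image cI) auto
    then have "bounded (range (\<lambda>t. I y (c t)))" by (rule bounded_subset) (use c in auto)
    ultimately show ?thesis by (simp add: bcontfun_def)
  qed
  \<comment> \<open>The Picard operator; \<open>c\<close> is the retraction of the line onto \<open>{0..\<tau>}\<close>.\<close>
  define \<Phi> where "\<Phi> y = Bcontfun (\<lambda>t. I y (c t))" for y
  have \<Phi>: "apply_bcontfun (\<Phi> y) t = I y (c t)" for y t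
    unfolding \<Phi>_def by (simp add: Bcontfun_inverse[OF bc])
  have "\<exists>!y. \<Phi> y = y"
  proof (rule banach_fix_type)
    show "0 \<le> L * \<tau>" "L * \<tau> < 1" using L \<tau> by auto
    show "\<forall>y z. dist (\<Phi> y) (\<Phi> z) \<le> L * \<tau> * dist y z"
    proof (intro allI dist_bound)
      fix y z t
      have ct: "0 \<le> c t" "c t \<le> \<tau>" using c[of t] by auto
      have "dist (I y (c t)) (I z (c t)) = norm (integral {0..c t} (\<lambda>s. F (apply_bcontfun y s) - F (apply_bcontfun z s)))"
        unfolding I_def dist_norm
        by (subst integral_diff) (auto intro!: integrable_continuous_real cont)
      also have "\<dots> \<le> (L * dist y z) * (c t - 0)"
      proof (rule integral_bound[OF ct(1)])
        show "continuous_on {0..c t} (\<lambda>s. F (apply_bcontfun y s) - F (apply_bcontfun z s))"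
          by (intro continuous_on_diff cont)
        fix s
        have "norm (F (apply_bcontfun y s) - F (apply_bcontfun z s)) \<le> L * dist (apply_bcontfun y s) (apply_bcontfun z s)"
          using lipschitz_onD[OF lip] by (simp add: dist_norm)
        also have "\<dots> \<le> L * dist y z" using L dist_bounded by (intro mult_left_mono) auto
        finally show "norm (F (apply_bcontfun y s) - F (apply_bcontfun z s)) \<le> L * dist y z" .
      qed
      also have "\<dots> \<le> (L * dist y z) * \<tau>" using L ct by (intro mult_left_mono) auto
      finally show "dist (apply_bcontfun (\<Phi> y) t) (apply_bcontfun (\<Phi> z) t) \<le> L * \<tau> * dist y z"
        unfolding \<Phi> by (simp add: mult_ac)
    qed
  qed
  then obtain y where y: "\<Phi> y = y" by auto
  have eq: "apply_bcontfun y t = I y t" if "t \<in> {0..\<tau>}" for t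
    using \<Phi>[of y t] cid[OF that] by (simp add: y)
  show ?thesis
  proof (intro exI[of _ "apply_bcontfun y"] conjI ballI)
    show "apply_bcontfun y 0 = x" using eq[of 0] \<tau> by (simp add: I_def)
    fix t assume t: "t \<in> {0..\<tau>}"
    have "((\<lambda>u. integral {0..u} (\<lambda>s. F (apply_bcontfun y s))) has_vector_derivative F (apply_bcontfun y t)) (at t within {0..\<tau>})"
      by (rule integral_has_vector_derivative[OF cont t])
    then have "(I y has_vector_derivative F (apply_bcontfun y t)) (at t within {0..\<tau>})"
      unfolding I_def by (auto intro!: derivative_eq_intros)
    then show "(apply_bcontfun y has_vector_derivative F (apply_bcontfun y t)) (at t within {0..\<tau>})"
      by (rule has_vector_derivative_transform[OF t, rotated]) (simp add: eq)
  qed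
qed

definition control_field :: "('m::finite \<Rightarrow> real^'n \<Rightarrow> real^'n) \<Rightarrow> real^'m \<Rightarrow> real^'n \<Rightarrow> real^'n" where
  "control_field f c z = (\<Sum>i\<in>UNIV. (c $ i) *\<^sub>R f i z)"

lemma control_field_axis [simp]:
  "control_field f (axis l 1) z = f l z" "control_field f (- axis l 1) z = - f l z"
  "control_field f (- c) z = - control_field f c z"
  by (simp_all add: control_field_def axis_def if_distrib[of "\<lambda>a. a *\<^sub>R _"] sum_negf cong: if_cong)

lemma control_setE:
  assumes "c \<in> control_set"
  obtains l where "c = axis l 1" | l where "c = - axis l 1"
  using assms by (auto simp: control_set_def)

lemma axis_in_control_set [simp]: "axis l 1 \<in> control_set" "- axis l 1 \<in> control_set"
  by (auto simp: control_set_def)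

lemma uminus_in_control_set: "c \<in> control_set \<Longrightarrow> - c \<in> control_set"
  by (auto simp: control_set_def)

lemma norm_control_field_le:
  assumes "c \<in> control_set" "\<And>i. norm (f i z) \<le> M"
  shows "norm (control_field f c z) \<le> M"
  using assms(1) by (rule control_setE) (use assms(2) in auto)

text \<open>Concatenations of flows are only piecewise differentiable. A finite exceptional set, rather than a null set, keeps the fundamental theorem
  of calculus applicable without any theory of absolutely continuous functions.\<close>

definition trajectory ::
  "('m::finite \<Rightarrow> real^'n \<Rightarrow> real^'n) \<Rightarrow> real \<Rightarrow> (real \<Rightarrow> real^'n) \<Rightarrow> (real \<Rightarrow> real^'m) \<Rightarrow> bool" where
  "trajectory f \<theta> y \<alpha> \<longleftrightarrow> 0 \<le> \<theta> \<and> continuous_on {0..\<theta>} y \<and>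
     \<alpha> \<in> borel_measurable borel \<and> (\<forall>t. \<alpha> t \<in> control_set) \<and>
     (\<exists>N. finite N \<and> (\<forall>t\<in>{0<..<\<theta>} - N. (y has_vector_derivative control_field f (\<alpha> t) (y t)) (at t)))"

lemma trajectory_lipschitz:
  assumes tr: "trajectory f \<theta> y \<alpha>" and bd: "\<And>t i. t \<in> {0..\<theta>} \<Longrightarrow> norm (f i (y t)) \<le> M"
  shows "M-lipschitz_on {0..\<theta>} y"
proof -
  obtain N where N: "finite N" "\<And>t. t\<in>{0<..<\<theta>} - N \<Longrightarrow> (y has_vector_derivative control_field f (\<alpha> t) (y t)) (at t)"
    using tr by (auto simp: trajectory_def)
  have le: "norm (y t - y s) \<le> M * (t - s)" if "0 \<le> s" "s \<le> t" "t \<le> \<theta>" for s t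
  proof (rule norm_increment_le[OF N(1) that(2)])
    show "continuous_on {s..t} y"
      using tr that by (auto simp: trajectory_def intro: continuous_on_subset)
    show "(y has_vector_derivative control_field f (\<alpha> r) (y r)) (at r)" if "r \<in> {s<..<t} - N" for r
      using N(2) that \<open>0 \<le> s\<close> \<open>t \<le> \<theta>\<close> by auto
    show "norm (control_field f (\<alpha> r) (y r)) \<le> M" if "r \<in> {s..t}" for r
      using tr bd that \<open>0 \<le> s\<close> \<open>t \<le> \<theta>\<close> by (intro norm_control_field_le) (auto simp: trajectory_def)
  qed
  show ?thesis
  proof (rule lipschitz_onI)
    have "0 \<le> \<theta>" using tr by (simp add: trajectory_def)
    then show "0 \<le> M" using order_trans[OF norm_ge_zero bd[of 0 undefined]] by simp
    fix s t assume st: "s \<in> {0..\<theta>}" "t \<in> {0..\<theta>}"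
    show "dist (y s) (y t) \<le> M * dist s t"
      using le[of s t] le[of t s] st by (cases "s \<le> t") (auto simp: dist_norm norm_minus_commute abs_if)
  qed
qed

lemma trajectory_concat:
  assumes tr1: "trajectory f \<theta>1 y1 \<alpha>1" and tr2: "trajectory f \<theta>2 y2 \<alpha>2" and eq: "y2 0 = y1 \<theta>1"
  shows "trajectory f (\<theta>1 + \<theta>2) (\<lambda>t. if t \<le> \<theta>1 then y1 t else y2 (t - \<theta>1))
    (\<lambda>t. if t < \<theta>1 then \<alpha>1 t else \<alpha>2 (t - \<theta>1))" (is "trajectory f _ ?y ?\<alpha>")
  unfolding trajectory_def
proof (intro conjI allI)
  note t1 = tr1[unfolded trajectory_def] note t2 = tr2[unfolded trajectory_def]
  show "0 \<le> \<theta>1 + \<theta>2" using t1 t2 by auto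
  have [measurable]: "\<alpha>1 \<in> borel_measurable borel" "\<alpha>2 \<in> borel_measurable borel" using t1 t2 by auto
  show "?\<alpha> \<in> borel_measurable borel" by measurable
  show "?\<alpha> t \<in> control_set" for t using t1 t2 by auto
  have "continuous_on ({0..\<theta>1} \<union> {\<theta>1..\<theta>1 + \<theta>2}) ?y"
  proof (rule continuous_on_If)
    show "continuous_on {\<theta>1..\<theta>1 + \<theta>2} (\<lambda>t. y2 (t - \<theta>1))"
      by (rule continuous_on_compose2[of "{0..\<theta>2}" y2]) (use t2 in \<open>auto intro!: continuous_intros\<close>)
  qed (use t1 t2 eq in \<open>auto dest: order_antisym\<close>)
  moreover have "{0..\<theta>1} \<union> {\<theta>1..\<theta>1 + \<theta>2} = {0..\<theta>1 + \<theta>2}" using t1 t2 by auto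
  ultimately show "continuous_on {0..\<theta>1 + \<theta>2} ?y" by simp
  obtain N1 where N1: "finite N1" "\<And>t. t\<in>{0<..<\<theta>1} - N1 \<Longrightarrow> (y1 has_vector_derivative control_field f (\<alpha>1 t) (y1 t)) (at t)"
    using t1 by auto
  obtain N2 where N2: "finite N2" "\<And>t. t\<in>{0<..<\<theta>2} - N2 \<Longrightarrow> (y2 has_vector_derivative control_field f (\<alpha>2 t) (y2 t)) (at t)"
    using t2 by auto
  let ?N = "insert \<theta>1 (N1 \<union> (\<lambda>t. t + \<theta>1) ` N2)"
  have "(?y has_vector_derivative control_field f (?\<alpha> t) (?y t)) (at t)" if t: "t \<in> {0<..<\<theta>1 + \<theta>2} - ?N" for t
  proof (cases "t < \<theta>1")
    case True
    have "(y1 has_vector_derivative control_field f (\<alpha>1 t) (y1 t)) (at t)" using N1(2)[of t] t True by auto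
    then have "(?y has_vector_derivative control_field f (\<alpha>1 t) (y1 t)) (at t)"
      by (rule has_vector_derivative_transform_within_open[of _ _ _ "{..<\<theta>1}"]) (use True in auto)
    then show ?thesis using True by simp
  next
    case False
    then have gt: "\<theta>1 < t" using t by auto
    have "t - \<theta>1 \<notin> N2"
    proof
      assume "t - \<theta>1 \<in> N2"
      then have "t - \<theta>1 + \<theta>1 \<in> (\<lambda>t. t + \<theta>1) ` N2" by (rule imageI)
      then show False using t by auto
    qed
    then have "(y2 has_vector_derivative control_field f (\<alpha>2 (t - \<theta>1)) (y2 (t - \<theta>1))) (at (t - \<theta>1))"
      using N2(2)[of "t - \<theta>1"] t gt by auto
    moreover have d: "((\<lambda>t. t - \<theta>1) has_vector_derivative 1) (at t)" by (auto intro!: derivative_eq_intros)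
    ultimately have "((\<lambda>t. y2 (t - \<theta>1)) has_vector_derivative control_field f (\<alpha>2 (t - \<theta>1)) (y2 (t - \<theta>1))) (at t)"
      using vector_diff_chain_at[OF d, of y2]
      by (simp add: o_def)
    then have "(?y has_vector_derivative control_field f (\<alpha>2 (t - \<theta>1)) (y2 (t - \<theta>1))) (at t)"
      by (rule has_vector_derivative_transform_within_open[of _ _ _ "{\<theta>1<..}"]) (use gt in auto)
    then show ?thesis using gt by simp
  qed
  then show "\<exists>N. finite N \<and> (\<forall>t\<in>{0<..<\<theta>1 + \<theta>2} - N. (?y has_vector_derivative control_field f (?\<alpha> t) (?y t)) (at t))"
    using N1(1) N2(1) by (intro exI[of _ ?N]) blast
qed

lemma trajectory_reverse:
  assumes tr: "trajectory f \<theta> y \<alpha>"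
  shows "trajectory f \<theta> (\<lambda>t. y (\<theta> - t)) (\<lambda>t. - \<alpha> (\<theta> - t))"
  unfolding trajectory_def
proof (intro conjI allI)
  note t = tr[unfolded trajectory_def]
  have [measurable]: "\<alpha> \<in> borel_measurable borel" using t by auto
  show "(\<lambda>t. - \<alpha> (\<theta> - t)) \<in> borel_measurable borel" by measurable
  show "- \<alpha> (\<theta> - s) \<in> control_set" for s using t by (auto intro: uminus_in_control_set)
  show "continuous_on {0..\<theta>} (\<lambda>t. y (\<theta> - t))"
    by (rule continuous_on_compose2[of "{0..\<theta>}" y]) (use t in \<open>auto intro!: continuous_intros\<close>)
  obtain N where N: "finite N" "\<And>t. t\<in>{0<..<\<theta>} - N \<Longrightarrow> (y has_vector_derivative control_field f (\<alpha> t) (y t)) (at t)"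
    using t by auto
  have "((\<lambda>t. y (\<theta> - t)) has_vector_derivative control_field f (- \<alpha> (\<theta> - s)) (y (\<theta> - s))) (at s)"
    if s: "s \<in> {0<..<\<theta>} - (\<lambda>t. \<theta> - t) ` N" for s
  proof -
    have "\<theta> - s \<notin> N"
    proof
      assume "\<theta> - s \<in> N"
      then have "\<theta> - (\<theta> - s) \<in> (\<lambda>t. \<theta> - t) ` N" by (rule imageI)
      then show False using s by auto
    qed
    then have "(y has_vector_derivative control_field f (\<alpha> (\<theta> - s)) (y (\<theta> - s))) (at (\<theta> - s))"
      using N(2)[of "\<theta> - s"] s by auto
    moreover have d: "((\<lambda>t. \<theta> - t) has_vector_derivative - 1) (at s)" by (auto intro!: derivative_eq_intros)
    ultimately show ?thesis
      using vector_diff_chain_at[OF d, of y] by (simp add: o_def)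
  qed
  then show "\<exists>N. finite N \<and> (\<forall>s\<in>{0<..<\<theta>} - N. ((\<lambda>t. y (\<theta> - t)) has_vector_derivative control_field f (- \<alpha> (\<theta> - s)) (y (\<theta> - s))) (at s))"
    using N(1) by (intro exI[of _ "(\<lambda>t. \<theta> - t) ` N"]) blast
qed (use tr in \<open>auto simp: trajectory_def\<close>)

definition reach ::
  "('m::finite \<Rightarrow> real^'n \<Rightarrow> real^'n) \<Rightarrow> real \<Rightarrow> (real^'n) set \<Rightarrow> real^'n \<Rightarrow> real^'n \<Rightarrow> bool" where
  "reach f \<theta> W x z \<longleftrightarrow> (\<exists>y \<alpha>. trajectory f \<theta> y \<alpha> \<and> y 0 = x \<and> y \<theta> = z \<and> y ` {0..\<theta>} \<subseteq> W)"

lemma reachI: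
  "trajectory f \<theta> y \<alpha> \<Longrightarrow> y 0 = x \<Longrightarrow> y \<theta> = z \<Longrightarrow> y ` {0..\<theta>} \<subseteq> W \<Longrightarrow> reach f \<theta> W x z"
  unfolding reach_def by blast

lemma reach_mono: "reach f \<theta> W x z \<Longrightarrow> W \<subseteq> W' \<Longrightarrow> reach f \<theta> W' x z"
  unfolding reach_def by blast

lemma reach_trans:
  assumes "reach f \<theta>1 W x z" "reach f \<theta>2 W z v"
  shows "reach f (\<theta>1 + \<theta>2) W x v"
proof -
  obtain y1 \<alpha>1 where 1: "trajectory f \<theta>1 y1 \<alpha>1" "y1 0 = x" "y1 \<theta>1 = z" "y1 ` {0..\<theta>1} \<subseteq> W"
    using assms(1) by (auto simp: reach_def)
  obtain y2 \<alpha>2 where 2: "trajectory f \<theta>2 y2 \<alpha>2" "y2 0 = z" "y2 \<theta>2 = v" "y2 ` {0..\<theta>2} \<subseteq> W"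
    using assms(2) by (auto simp: reach_def)
  have "\<theta>1 \<ge> 0" "\<theta>2 \<ge> 0" using 1 2 by (auto simp: trajectory_def)
  have "trajectory f (\<theta>1 + \<theta>2) (\<lambda>t. if t \<le> \<theta>1 then y1 t else y2 (t - \<theta>1))
      (\<lambda>t. if t < \<theta>1 then \<alpha>1 t else \<alpha>2 (t - \<theta>1))"
    using trajectory_concat[OF 1(1) 2(1)] 1 2 by simp
  then show ?thesis
    by (rule reachI) (use 1(2-4) 2(2-4) \<open>\<theta>1 \<ge> 0\<close> \<open>\<theta>2 \<ge> 0\<close> in \<open>auto simp: image_subset_iff\<close>)
qed

lemma reach_reverse:
  assumes "reach f \<theta> W x z"
  shows "reach f \<theta> W z x"
proof -
  obtain y \<alpha> where 1: "trajectory f \<theta> y \<alpha>" "y 0 = x" "y \<theta> = z" "y ` {0..\<theta>} \<subseteq> W"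
    using assms(1) by (auto simp: reach_def)
  have "\<theta> \<ge> 0" using 1 by (simp add: trajectory_def)
  from trajectory_reverse[OF 1(1)] show ?thesis
    by (rule reachI) (use \<open>\<theta> \<ge> 0\<close> 1(2-4) in \<open>auto simp: image_subset_iff\<close>)
qed

lemma reach_self: "x \<in> W \<Longrightarrow> reach f 0 W x x"
  unfolding reach_def trajectory_def
  by (rule exI[of _ "\<lambda>_. x"], rule exI[of _ "\<lambda>_. axis undefined 1"]) auto

text \<open>The controls are symmetric, so a path can be retraced; this spends time without moving.\<close>

lemma reach_back_and_forth:
  assumes "reach f \<theta> W x z" "x \<in> W"
  shows "reach f (real n * (2 * \<theta>)) W x x"
proof (induction n)
  case 0
  then show ?case using reach_self[OF assms(2)] by simp
next
  case (Suc n)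
  show ?case
    using reach_trans[OF Suc reach_trans[OF assms(1) reach_reverse[OF assms(1)]]]
    by (simp add: algebra_simps)
qed

locale fields_on_ball =
  fixes f :: "'m::finite \<Rightarrow> real^'n \<Rightarrow> real^'n" and x0 :: "real^'n" and R L M :: real
  assumes R: "0 < R" and lip: "\<And>i. L-lipschitz_on (cball x0 R) (f i)"
    and bound: "\<And>i z. z \<in> cball x0 R \<Longrightarrow> norm (f i z) \<le> M"
begin

text \<open>Locally the fields are replaced by globally bounded Lipschitz ones, obtained by precomposition with the
  nearest-point projection onto a ball. Their flows exist for all initial points and agree with the original ones as
  long as they stay in the ball.\<close>

definition ext :: "'m \<Rightarrow> real^'n \<Rightarrow> real^'n" where
  "ext i z = f i (closest_point (cball x0 R) z)"

lemma L_nonneg: "0 \<le> L" using lipschitz_on_nonneg[OF lip] .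

lemma M_nonneg: "0 \<le> M"
  by (rule order_trans[OF norm_ge_zero bound[of x0 undefined]]) (use R in auto)

lemma closest_in: "closest_point (cball x0 R) z \<in> cball x0 R"
  using R by (intro closest_point_in_set) auto

lemma ext_lipschitz: "L-lipschitz_on UNIV (ext i)"
proof (rule lipschitz_onI)
  fix x y
  have "dist (ext i x) (ext i y) \<le> L * dist (closest_point (cball x0 R) x) (closest_point (cball x0 R) y)"
    unfolding ext_def using lipschitz_onD[OF lip closest_in closest_in] .
  also have "\<dots> \<le> L * dist x y"
    using R by (intro mult_left_mono closest_point_lipschitz L_nonneg) auto
  finally show "dist (ext i x) (ext i y) \<le> L * dist x y" .
qed (rule L_nonneg)

lemma ext_bound: "norm (ext i z) \<le> M"
  unfolding ext_def by (rule bound[OF closest_in])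

lemma ext_eq: "z \<in> cball x0 R \<Longrightarrow> ext i z = f i z"
  by (simp add: ext_def closest_point_self)

lemma control_field_ext_lipschitz:
  assumes "c \<in> control_set" shows "L-lipschitz_on UNIV (control_field ext c)"
  using assms
proof (rule control_setE)
  fix l assume "c = axis l 1"
  then show ?thesis using ext_lipschitz[of l] by (simp add: lipschitz_on_def)
next
  fix l assume "c = - axis l 1"
  then show ?thesis using ext_lipschitz[of l] by (simp add: lipschitz_on_def dist_minus)
qed

lemma norm_control_field_ext: "c \<in> control_set \<Longrightarrow> norm (control_field ext c z) \<le> M"
  using norm_control_field_le ext_bound by blast

lemma flow:
  assumes c: "c \<in> control_set" and t: "0 \<le> t" "L * t < 1" and inside: "dist x0 x + M * t \<le> R"
  obtains y where "y 0 = x"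
    and "\<And>s. s \<in> {0..t} \<Longrightarrow> (y has_vector_derivative control_field ext c (y s)) (at s within {0..t})"
    and "\<And>s. s \<in> {0..t} \<Longrightarrow> norm (y s - x) \<le> M * s"
    and "reach f t (cball x (M * t)) x (y t)"
proof -
  obtain y where y: "y 0 = x"
      "\<And>s. s \<in> {0..t} \<Longrightarrow> (y has_vector_derivative control_field ext c (y s)) (at s within {0..t})"
    using picard_lindeloef[OF control_field_ext_lipschitz[OF c] t, of x] by auto
  have cy: "continuous_on {0..t} y"
    using y(2) has_vector_derivative_continuous continuous_on_eq_continuous_within by blast
  have at: "(y has_vector_derivative control_field ext c (y s)) (at s)" if "s \<in> {0<..<t}" for s
    using y(2)[of s] that by (simp add: at_within_Icc_at)
  have near: "norm (y s - x) \<le> M * s" if s: "s \<in> {0..t}" for s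
  proof -
    have "norm (y s - y 0) \<le> M * (s - 0)"
      by (rule norm_increment_le[where N = "{}" and g' = "\<lambda>s. control_field ext c (y s)"])
        (use s at norm_control_field_ext[OF c] continuous_on_subset[OF cy, of "{0..s}"] in auto)
    then show ?thesis by (simp add: y(1))
  qed
  have near': "norm (y s - x) \<le> M * t" if "s \<in> {0..t}" for s
    using near[OF that] mult_left_mono[OF _ M_nonneg, of s t] that by auto
  have in_ball: "y s \<in> cball x0 R" if "s \<in> {0..t}" for s
    using near'[OF that] dist_triangle[of x0 "y s" x] inside by (simp add: dist_norm norm_minus_commute)
  have "trajectory f t y (\<lambda>_. c)" unfolding trajectory_def
  proof (intro conjI allI t(1) cy c)
    have "(y has_vector_derivative control_field f c (y s)) (at s)" if "s \<in> {0<..<t}" for s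
      using at[OF that] in_ball[of s] that by (simp add: control_field_def ext_eq)
    then show "\<exists>N. finite N \<and> (\<forall>s\<in>{0<..<t} - N. (y has_vector_derivative control_field f c (y s)) (at s))"
      by (intro exI[of _ "{}"]) auto
  qed simp
  then have "reach f t (cball x (M * t)) x (y t)" unfolding reach_def
    using y(1) near' by (intro exI[of _ y] exI[of _ "\<lambda>_. c"]) (auto simp: dist_norm norm_minus_commute)
  then show ?thesis using that y near by blast
qed

end

lemma flow_increment:
  fixes y :: "real \<Rightarrow> 'a::euclidean_space"
  assumes lip: "L-lipschitz_on UNIV F"
    and y: "\<And>s. s \<in> {0..t} \<Longrightarrow> (y has_vector_derivative F (y s)) (at s within {0..t})"
    and ab: "0 \<le> a" "a \<le> b" "b \<le> t" and near: "\<And>s. s \<in> {a..b} \<Longrightarrow> norm (y s - q) \<le> \<eta>"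
  shows "norm (y b - y a - (b - a) *\<^sub>R F q) \<le> (b - a) * (L * \<eta>)"
proof -
  have cy: "continuous_on {0..t} y"
    using y has_vector_derivative_continuous continuous_on_eq_continuous_within by blast
  have "norm ((y b - b *\<^sub>R F q) - (y a - a *\<^sub>R F q)) \<le> (L * \<eta>) * (b - a)"
  proof (rule norm_increment_le[where N = "{}" and g' = "\<lambda>s. F (y s) - F q"])
    show "continuous_on {a..b} (\<lambda>s. y s - s *\<^sub>R F q)"
      by (intro continuous_intros continuous_on_subset[OF cy]) (use ab in auto)
    show "((\<lambda>s. y s - s *\<^sub>R F q) has_vector_derivative F (y s) - F q) (at s)" if "s \<in> {a<..<b} - {}" for s
    proof -
      have "(y has_vector_derivative F (y s)) (at s)"
        using y[of s] that ab by (simp add: at_within_Icc_at)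
      then show ?thesis by (auto intro!: derivative_eq_intros)
    qed
    show "norm (F (y s) - F q) \<le> L * \<eta>" if "s \<in> {a..b}" for s
    proof -
      have "norm (F (y s) - F q) \<le> L * norm (y s - q)"
        using lipschitz_onD[OF lip, of "y s" q] by (simp add: dist_norm)
      also have "\<dots> \<le> L * \<eta>" using near[OF that] lipschitz_on_nonneg[OF lip] by (rule mult_left_mono)
      finally show ?thesis .
    qed
  qed (use ab in auto)
  then show ?thesis by (simp add: algebra_simps)
qed

text \<open>The increment of a solution is compared with a Riemann sum of the field along prescribed points \<open>q i\<close>, which need not lie
  on the solution.\<close>

lemma flow_sampled_sum:
  fixes y :: "real \<Rightarrow> 'a::euclidean_space"
  assumes lip: "L-lipschitz_on UNIV F"
    and y: "\<And>s. s \<in> {0..t} \<Longrightarrow> (y has_vector_derivative F (y s)) (at s within {0..t})"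
    and N: "N > 0" and t: "0 \<le> t"
    and near: "\<And>i s. i < N \<Longrightarrow> s \<in> {real i * (t / N)..real (Suc i) * (t / N)} \<Longrightarrow> norm (y s - q i) \<le> \<eta>"
  shows "norm (y t - y 0 - (\<Sum>i<N. (t / N) *\<^sub>R F (q i))) \<le> t * (L * \<eta>)"
proof -
  define \<delta> where "\<delta> = t / N"
  have \<delta>: "0 \<le> \<delta>" "real N * \<delta> = t" using N t by (auto simp: \<delta>_def)
  have "y t - y 0 = (\<Sum>i<N. y (real (Suc i) * \<delta>) - y (real i * \<delta>))"
    using sum_lessThan_telescope[of "\<lambda>i. y (real i * \<delta>)" N] \<delta> by simp
  then have "y t - y 0 - (\<Sum>i<N. \<delta> *\<^sub>R F (q i)) = (\<Sum>i<N. y (real (Suc i) * \<delta>) - y (real i * \<delta>) - \<delta> *\<^sub>R F (q i))"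
    by (simp add: sum_subtractf)
  also have "norm \<dots> \<le> (\<Sum>i<N. \<delta> * (L * \<eta>))"
  proof (rule sum_norm_le)
    fix i assume i: "i \<in> {..<N}"
    have "real (Suc i) * \<delta> \<le> real N * \<delta>" using i \<delta>(1) by (intro mult_right_mono) auto
    then have "norm (y (real (Suc i) * \<delta>) - y (real i * \<delta>) - (real (Suc i) * \<delta> - real i * \<delta>) *\<^sub>R F (q i))
        \<le> (real (Suc i) * \<delta> - real i * \<delta>) * (L * \<eta>)"
    proof (intro flow_increment[OF lip y])
      show "real i * \<delta> \<le> real (Suc i) * \<delta>" using \<delta>(1) by (intro mult_right_mono) auto
      show "norm (y s - q i) \<le> \<eta>" if "s \<in> {real i * \<delta>..real (Suc i) * \<delta>}" for s
        using near[of i s] i that by (simp add: \<delta>_def)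
    qed (use \<delta> in auto)
    then show "norm (y (real (Suc i) * \<delta>) - y (real i * \<delta>) - \<delta> *\<^sub>R F (q i)) \<le> \<delta> * (L * \<eta>)"
      by (simp add: algebra_simps)
  qed
  also have "\<dots> = t * (L * \<eta>)" using \<delta>(2) by (simp flip: mult.assoc)
  finally show ?thesis by (simp add: \<delta>_def)
qed

text \<open>Here \<open>c\<close> and \<open>a\<close> are approximations, with errors \<open>A\<close> and \<open>B\<close>, of the initial point and of the initial velocity. This form can
  be iterated along the four sides of a loop.\<close>

lemma flow_first_order:
  fixes y :: "real \<Rightarrow> 'a::euclidean_space"
  assumes lip: "L-lipschitz_on UNIV F"
    and y: "\<And>s. s \<in> {0..t} \<Longrightarrow> (y has_vector_derivative F (y s)) (at s within {0..t})"
    and near: "\<And>s. s \<in> {0..t} \<Longrightarrow> norm (y s - y 0) \<le> M * s" and "0 \<le> M"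
    and c: "norm (y 0 - c) \<le> A" "norm (F (y 0) - a) \<le> B" and s: "s \<in> {0..t}"
  shows "norm (y s - (c + s *\<^sub>R a)) \<le> A + t * B + L * M * t\<^sup>2"
proof -
  have L: "0 \<le> L" using lipschitz_on_nonneg[OF lip] .
  have B: "0 \<le> B" using order_trans[OF norm_ge_zero c(2)] .
  have "norm (y s - y 0 - (s - 0) *\<^sub>R F (y 0)) \<le> (s - 0) * (L * (M * s))"
  proof (rule flow_increment[OF lip y])
    show "norm (y r - y 0) \<le> M * s" if "r \<in> {0..s}" for r
      using near[of r] mult_left_mono[of r s M] that s \<open>0 \<le> M\<close> by auto
  qed (use s in auto)
  also have "(s - 0) * (L * (M * s)) \<le> L * M * t\<^sup>2"
  proof -
    have "L * M * (s * s) \<le> L * M * (t * t)" using s L \<open>0 \<le> M\<close> by (intro mult_left_mono mult_mono) auto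
    then show ?thesis by (simp add: power2_eq_square mult_ac)
  qed
  finally have 1: "norm (y s - y 0 - s *\<^sub>R F (y 0)) \<le> L * M * t\<^sup>2" by simp
  have "norm (s *\<^sub>R (F (y 0) - a)) = s * norm (F (y 0) - a)" using s by simp
  also have "\<dots> \<le> t * B" using s c(2) B by (intro mult_mono) auto
  finally have 2: "norm (s *\<^sub>R (F (y 0) - a)) \<le> t * B" .
  have eq: "y s - (c + s *\<^sub>R a) = (y s - y 0 - s *\<^sub>R F (y 0)) + ((y 0 - c) + s *\<^sub>R (F (y 0) - a))"
    by (simp add: algebra_simps)
  show ?thesis unfolding eq
    using norm_triangle_ineq[of "y s - y 0 - s *\<^sub>R F (y 0)" "(y 0 - c) + s *\<^sub>R (F (y 0) - a)"]
      norm_triangle_ineq[of "y 0 - c" "s *\<^sub>R (F (y 0) - a)"] 1 2 c(1) by linarith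
qed

section \<open>Displacement along the commutator loop\<close>

lemma inner_lipschitz:
  fixes F :: "'a::real_normed_vector \<Rightarrow> 'b::real_inner"
  assumes "L-lipschitz_on S F"
  shows "(norm p * L)-lipschitz_on S (\<lambda>z. p \<bullet> F z)"
proof (rule lipschitz_onI)
  fix x y assume "x \<in> S" "y \<in> S"
  have "dist (p \<bullet> F x) (p \<bullet> F y) = \<bar>p \<bullet> (F x - F y)\<bar>" by (simp add: dist_real_def inner_diff_right)
  also have "\<dots> \<le> norm p * dist (F x) (F y)" unfolding dist_norm by (rule Cauchy_Schwarz_ineq2)
  also have "\<dots> \<le> norm p * (L * dist x y)"
    using lipschitz_onD[OF assms \<open>x \<in> S\<close> \<open>y \<in> S\<close>] by (intro mult_left_mono) auto
  finally show "dist (p \<bullet> F x) (p \<bullet> F y) \<le> norm p * L * dist x y" by simp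
qed (use lipschitz_on_nonneg[OF assms] in simp)

context fields_on_ball begin

lemma single_field_step:
  assumes c: "c \<in> control_set" and t: "0 \<le> t" "L * t < 1" and inside: "dist x0 x + M * t \<le> R"
  obtains z where "reach f t (cball x (M * t)) x z"
    and "norm (z - (x + t *\<^sub>R control_field f c x)) \<le> L * M * t\<^sup>2" and "norm (z - x) \<le> M * t"
proof -
  obtain y where y: "y 0 = x"
    "\<And>s. s \<in> {0..t} \<Longrightarrow> (y has_vector_derivative control_field ext c (y s)) (at s within {0..t})"
    "\<And>s. s \<in> {0..t} \<Longrightarrow> norm (y s - x) \<le> M * s" "reach f t (cball x (M * t)) x (y t)"
    using flow[OF c t inside] by blast
  have "x \<in> cball x0 R" using inside t M_nonneg by (simp add: add_nonneg_nonneg order_trans[rotated, OF inside])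
  then have e: "control_field ext c x = control_field f c x" by (simp add: control_field_def ext_eq)
  have "norm (y t - (x + t *\<^sub>R control_field f c x)) \<le> 0 + t * 0 + L * M * t\<^sup>2"
    by (rule flow_first_order[OF control_field_ext_lipschitz[OF c] y(2)]) (use y M_nonneg t e in auto)
  then show ?thesis using that[OF y(4)] y(3)[of t] t by simp
qed

text \<open>To first order the four flows trace the sides of the parallelogram with vertices \<open>x\<close>, \<open>x + t a\<close>, \<open>x + t a + t b\<close>
  and \<open>x + t b\<close>, where \<open>a\<close> and \<open>b\<close> are the values of the fields at \<open>x\<close>. They deviate from it by at most a multiple of \<open>t\<^sup>2\<close>,
  which alters the integral of a Lipschitz field over a side by a multiple of \<open>t ^ 3\<close> only. Hence
  the displacement along \<open>p\<close> is, up to \<open>t ^ 3\<close>, the loop sum bounded by \<open>parallelogram_sum_le\<close>.\<close>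

lemma bracket_loop_step:
  assumes t: "0 < t" "L * t < 1" and inside: "dist x0 x + 4 * M * t < \<epsilon>" "\<epsilon> \<le> R"
    and curl: "AE z in lborel. z \<in> ball x0 \<epsilon> \<longrightarrow>
      (\<exists>u' w'. ((\<lambda>z. p \<bullet> ext i z) has_derivative u') (at z) \<and> ((\<lambda>z. p \<bullet> ext j z) has_derivative w') (at z) \<and>
        w' (f i x) - u' (f j x) \<le> - \<kappa>)"
  obtains z where "reach f (4 * t) (cball x (4 * M * t)) x z"
    and "p \<bullet> (z - x) \<le> - \<kappa> * t\<^sup>2 + 40 * norm p * L\<^sup>2 * M * t ^ 3" and "norm (z - x) \<le> 10 * L * M * t\<^sup>2"
proof -
  note M = M_nonneg note L = L_nonneg
  have Mt: "0 \<le> M * t" using M t by simp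
  define a where "a = f i x"
  define b where "b = f j x"
  have xin: "x \<in> cball x0 R" using inside Mt by auto
  have a: "ext i x = a" "norm a \<le> M" and b: "ext j x = b" "norm b \<le> M"
    using xin by (auto simp: a_def b_def ext_eq bound)
  have lipn: "norm (ext k z - ext k x) \<le> L * norm (z - x)" for k z
    using lipschitz_onD[OF ext_lipschitz, of z x k] by (simp add: dist_norm)
  have sub: "cball z r \<subseteq> cball x (4 * M * t)" if "norm (z - x) \<le> s" "s + r \<le> 4 * M * t" for z r s
  proof
    fix v assume "v \<in> cball z r"
    then show "v \<in> cball x (4 * M * t)"
      using that dist_triangle[of x v z] by (simp add: dist_norm norm_minus_commute)
  qed
  have step: "\<exists>y. y 0 = z \<and> (\<forall>s\<in>{0..t}. (y has_vector_derivative control_field ext c (y s)) (at s within {0..t}))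
      \<and> (\<forall>s\<in>{0..t}. norm (y s - z) \<le> M * s) \<and> reach f t (cball x (4 * M * t)) z (y t) \<and> norm (y t - x) \<le> real (Suc n) * (M * t)"
    if c: "c \<in> control_set" and n: "norm (z - x) \<le> real n * (M * t)" "n \<le> 3" for c z n
  proof -
    have nM: "real n * (M * t) \<le> 3 * (M * t)" using n Mt by (intro mult_right_mono) auto
    have "dist x0 z + M * t \<le> R"
      using dist_triangle[of x0 z x] n nM inside by (simp add: dist_norm norm_minus_commute)
    then obtain y where y: "y 0 = z"
      "\<And>s. s \<in> {0..t} \<Longrightarrow> (y has_vector_derivative control_field ext c (y s)) (at s within {0..t})"
      "\<And>s. s \<in> {0..t} \<Longrightarrow> norm (y s - z) \<le> M * s" "reach f t (cball z (M * t)) z (y t)"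
      using flow[OF c less_imp_le[OF t(1)] t(2)] by blast
    have "norm (y t - x) \<le> real (Suc n) * (M * t)"
      using y(3)[of t] n t norm_triangle_ineq[of "y t - z" "z - x"] by (simp add: algebra_simps)
    moreover have "reach f t (cball x (4 * M * t)) z (y t)"
      by (rule reach_mono[OF y(4) sub[OF n(1)]]) (use nM in simp)
    ultimately show ?thesis using y by blast
  qed
  obtain y1 where y1: "y1 0 = x" "\<And>s. s \<in> {0..t} \<Longrightarrow> (y1 has_vector_derivative ext i (y1 s)) (at s within {0..t})"
    "\<And>s. s \<in> {0..t} \<Longrightarrow> norm (y1 s - x) \<le> M * s" "reach f t (cball x (4 * M * t)) x (y1 t)" "norm (y1 t - x) \<le> 1 * (M * t)"
    using step[of "axis i 1" x 0] by auto
  obtain y2 where y2: "y2 0 = y1 t" "\<And>s. s \<in> {0..t} \<Longrightarrow> (y2 has_vector_derivative ext j (y2 s)) (at s within {0..t})"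
    "\<And>s. s \<in> {0..t} \<Longrightarrow> norm (y2 s - y1 t) \<le> M * s" "reach f t (cball x (4 * M * t)) (y1 t) (y2 t)" "norm (y2 t - x) \<le> 2 * (M * t)"
    using step[of "axis j 1" "y1 t" 1] y1(5) by auto
  obtain y3 where y3: "y3 0 = y2 t" "\<And>s. s \<in> {0..t} \<Longrightarrow> (y3 has_vector_derivative - ext i (y3 s)) (at s within {0..t})"
    "\<And>s. s \<in> {0..t} \<Longrightarrow> norm (y3 s - y2 t) \<le> M * s" "reach f t (cball x (4 * M * t)) (y2 t) (y3 t)" "norm (y3 t - x) \<le> 3 * (M * t)"
    using step[of "- axis i 1" "y2 t" 2] y2(5) by auto
  obtain y4 where y4: "y4 0 = y3 t" "\<And>s. s \<in> {0..t} \<Longrightarrow> (y4 has_vector_derivative - ext j (y4 s)) (at s within {0..t})"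
    "\<And>s. s \<in> {0..t} \<Longrightarrow> norm (y4 s - y3 t) \<le> M * s" "reach f t (cball x (4 * M * t)) (y3 t) (y4 t)"
    using step[of "- axis j 1" "y3 t" 3] y3(5) by auto
  \<comment> \<open>The unit in which the deviation of the loop from the parallelogram is measured.\<close>
  define Q where "Q = L * M * t\<^sup>2"
  have Q: "0 \<le> Q" using L M by (simp add: Q_def)
  have lip': "L-lipschitz_on UNIV (\<lambda>z. - ext k z)" for k
    using ext_lipschitz[of k] by (simp add: lipschitz_on_def dist_minus)
  have tLM: "t * (L * (r * (M * t))) = r * Q" for r by (simp add: Q_def power2_eq_square)
  have e1: "norm (y1 s - (x + s *\<^sub>R a)) \<le> Q" if "s \<in> {0..t}" for s
    using flow_first_order[OF ext_lipschitz y1(2) _ M _ _ that, where c = x and A = 0 and a = a and B = 0] y1 a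
    by (simp add: Q_def)
  have e2: "norm (y2 s - (x + t *\<^sub>R a + s *\<^sub>R b)) \<le> 3 * Q" if "s \<in> {0..t}" for s
  proof -
    have "norm (y2 s - (x + t *\<^sub>R a + s *\<^sub>R b)) \<le> Q + t * (L * (1 * (M * t))) + L * M * t\<^sup>2"
    proof (rule flow_first_order[OF ext_lipschitz y2(2) _ M _ _ that])
      show "norm (y2 0 - (x + t *\<^sub>R a)) \<le> Q" using e1[of t] t by (simp add: y2(1))
      show "norm (ext j (y2 0) - b) \<le> L * (1 * (M * t))" unfolding y2(1) b(1)[symmetric]
        by (rule order_trans[OF lipn mult_left_mono[OF y1(5) L]])
    qed (use y2 in auto)
    then show ?thesis unfolding tLM by (simp add: Q_def)
  qed
  have e3: "norm (y3 s - (x + t *\<^sub>R a + t *\<^sub>R b + s *\<^sub>R (- a))) \<le> 6 * Q" if "s \<in> {0..t}" for s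
  proof -
    have "norm (y3 s - (x + t *\<^sub>R a + t *\<^sub>R b + s *\<^sub>R (- a))) \<le> 3 * Q + t * (L * (2 * (M * t))) + L * M * t\<^sup>2"
    proof (rule flow_first_order[OF lip' y3(2) _ M _ _ that])
      show "norm (y3 0 - (x + t *\<^sub>R a + t *\<^sub>R b)) \<le> 3 * Q" using e2[of t] t by (simp add: y3(1))
      have "norm (ext i (y2 t) - ext i x) \<le> L * (2 * (M * t))"
        by (rule order_trans[OF lipn mult_left_mono[OF y2(5) L]])
      then show "norm (- ext i (y3 0) - - a) \<le> L * (2 * (M * t))"
        by (simp add: y3(1) a(1) norm_minus_commute)
    qed (use y3 in auto)
    then show ?thesis unfolding tLM by (simp add: Q_def)
  qed
  have e4: "norm (y4 s - (x + t *\<^sub>R b + s *\<^sub>R (- b))) \<le> 10 * Q" if "s \<in> {0..t}" for s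
  proof -
    have "norm (y4 s - (x + t *\<^sub>R b + s *\<^sub>R (- b))) \<le> 6 * Q + t * (L * (3 * (M * t))) + L * M * t\<^sup>2"
    proof (rule flow_first_order[OF lip' y4(2) _ M _ _ that])
      show "norm (y4 0 - (x + t *\<^sub>R b)) \<le> 6 * Q" using e3[of t] t by (simp add: y4(1) algebra_simps)
      have "norm (ext j (y3 t) - ext j x) \<le> L * (3 * (M * t))"
        by (rule order_trans[OF lipn mult_left_mono[OF y3(5) L]])
      then show "norm (- ext j (y4 0) - - b) \<le> L * (3 * (M * t))"
        by (simp add: y4(1) b(1) norm_minus_commute)
    qed (use y4 in auto)
    then show ?thesis unfolding tLM by (simp add: Q_def)
  qed
  have end_near: "norm (y4 t - x) \<le> 10 * L * M * t\<^sup>2"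
    using e4[of t] t by (simp add: Q_def algebra_simps)
  have re: "reach f (4 * t) (cball x (4 * M * t)) x (y4 t)"
    using reach_trans[OF y1(4) reach_trans[OF y2(4) reach_trans[OF y3(4) y4(4)]]] by simp
  define u where "u z = p \<bullet> ext i z" for z
  define w where "w z = p \<bullet> ext j z" for z
  define K where "K = norm p * (4 * (t * L))"
  have K: "0 \<le> K" using L t by (simp add: K_def)
  have "p \<bullet> (y4 t - x) \<le> - \<kappa> * t\<^sup>2 + K * (10 * Q) + \<mu>" if "\<mu> > 0" for \<mu>
  proof -
    define S where "S N = (\<Sum>k<N. t / N * (u (x + (real k * (t / N)) *\<^sub>R a) - u (x + (real k * (t / N)) *\<^sub>R a + t *\<^sub>R b)))
      + (\<Sum>k<N. t / N * (w (x + t *\<^sub>R a + (real k * (t / N)) *\<^sub>R b) - w (x + (real k * (t / N)) *\<^sub>R b)))" for N :: nat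
    have par: "dist x0 (x + s *\<^sub>R a + r *\<^sub>R b) \<le> dist x0 x + 2 * (M * t)" if "s \<in> {0..t}" "r \<in> {0..t}" for s r
    proof -
      have "norm (s *\<^sub>R a) \<le> M * t" "norm (r *\<^sub>R b) \<le> M * t"
        using that a(2) b(2) M by (auto simp: mult.commute[of M] intro!: mult_mono)
      moreover have "dist x (x + s *\<^sub>R a + r *\<^sub>R b) = norm (s *\<^sub>R a + r *\<^sub>R b)"
        by (simp add: dist_norm algebra_simps norm_minus_commute flip: norm_minus_cancel[of "s *\<^sub>R a + r *\<^sub>R b"])
      ultimately show ?thesis
        using dist_triangle[of x0 "x + s *\<^sub>R a + r *\<^sub>R b" x] norm_triangle_ineq[of "s *\<^sub>R a" "r *\<^sub>R b"]
        by linarith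
    qed
    have "\<forall>\<^sub>F N in sequentially. S N \<le> - \<kappa> * t\<^sup>2 + \<mu> / 2" unfolding S_def
    proof (rule parallelogram_sum_le[where z = x0 and \<epsilon> = \<epsilon> and \<epsilon>' = "dist x0 x + 2 * (M * t)" and L = "norm p * L"])
      show "(norm p * L)-lipschitz_on UNIV u" "(norm p * L)-lipschitz_on UNIV w"
        unfolding u_def w_def by (rule inner_lipschitz[OF ext_lipschitz])+
      show "AE z in lborel. z \<in> ball x0 \<epsilon> \<longrightarrow> (\<exists>u' w'. (u has_derivative u') (at z) \<and> (w has_derivative w') (at z) \<and> w' a - u' b \<le> - \<kappa>)"
        using curl unfolding u_def[abs_def] w_def[abs_def] a_def b_def .
      show "dist x0 x + 2 * (M * t) < \<epsilon>" using inside Mt by linarith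
    qed (use par t that in auto)
    moreover have "\<forall>\<^sub>F N in sequentially. K * (M * (t / real N)) < \<mu> / 2"
    proof (rule order_tendstoD)
      have "(\<lambda>N. (K * (M * t)) * (1 / real N)) \<longlonglongrightarrow> (K * (M * t)) * 0"
        by (intro tendsto_mult tendsto_const lim_1_over_n)
      then show "(\<lambda>N. K * (M * (t / real N))) \<longlonglongrightarrow> 0" by simp
    qed (use that in simp)
    moreover have "\<forall>\<^sub>F N::nat in sequentially. N > 0" by (rule eventually_gt_at_top)
    ultimately have "\<forall>\<^sub>F N in sequentially. S N \<le> - \<kappa> * t\<^sup>2 + \<mu> / 2 \<and> K * (M * (t / real N)) < \<mu> / 2 \<and> N > 0"
      by eventually_elim simp
    then obtain N where N: "S N \<le> - \<kappa> * t\<^sup>2 + \<mu> / 2" "K * (M * (t / real N)) < \<mu> / 2" "N > 0"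
      using eventually_happens'[OF sequentially_bot] by blast
    define \<delta> where "\<delta> = t / real N"
    have \<delta>: "\<delta> > 0" "real N * \<delta> = t" using N t by (auto simp: \<delta>_def)
    define \<eta> where "\<eta> = 10 * Q + M * \<delta>"
    have in_t: "s \<in> {0..t}" if "k < N" "s \<in> {real k * (t / N)..real (Suc k) * (t / N)}" for k s
    proof -
      have "real (Suc k) * \<delta> \<le> real N * \<delta>" using that \<delta> by (intro mult_right_mono) auto
      moreover have "0 \<le> real k * \<delta>" using \<delta> by simp
      ultimately show ?thesis using that(2) \<delta>(2) by (simp add: \<delta>_def)
    qed
    have bnd: "real k * \<delta> \<le> s" "s \<le> real k * \<delta> + \<delta>"
      if "k < N" "s \<in> {real k * (t / N)..real (Suc k) * (t / N)}" for k s
    proof -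
      have "real (Suc k) * \<delta> = real k * \<delta> + \<delta>" by (simp add: algebra_simps)
      then show "real k * \<delta> \<le> s" "s \<le> real k * \<delta> + \<delta>" using that(2) unfolding \<delta>_def[symmetric] by auto
    qed
    have samp: "norm (v - q) \<le> \<eta>" if "norm (v - q') \<le> 10 * Q" "q' - q = r *\<^sub>R d" "norm d \<le> M" "\<bar>r\<bar> \<le> \<delta>" for v q q' d :: "real^'n" and r
    proof -
      have "norm (q' - q) \<le> \<delta> * M" unfolding that(2) using that(3,4) \<delta> by (simp add: mult_mono)
      then show ?thesis using that(1) norm_triangle_ineq[of "v - q'" "q' - q"] by (simp add: \<eta>_def mult.commute)
    qed
    have s1: "norm (y1 t - y1 0 - (\<Sum>k<N. (t / N) *\<^sub>R ext i (x + (real k * \<delta>) *\<^sub>R a))) \<le> t * (L * \<eta>)"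
    proof (rule flow_sampled_sum[OF ext_lipschitz y1(2) N(3)])
      fix k s assume ks: "k < N" "s \<in> {real k * (t / N)..real (Suc k) * (t / N)}"
      show "norm (y1 s - (x + (real k * \<delta>) *\<^sub>R a)) \<le> \<eta>"
        by (rule samp[where q' = "x + s *\<^sub>R a" and d = a and r = "s - real k * \<delta>"])
          (use e1[OF in_t[OF ks]] Q a bnd[OF ks] in \<open>auto simp: algebra_simps\<close>)
    qed (use t in auto)
    have s2: "norm (y2 t - y2 0 - (\<Sum>k<N. (t / N) *\<^sub>R ext j (x + t *\<^sub>R a + (real k * \<delta>) *\<^sub>R b))) \<le> t * (L * \<eta>)"
    proof (rule flow_sampled_sum[OF ext_lipschitz y2(2) N(3)])
      fix k s assume ks: "k < N" "s \<in> {real k * (t / N)..real (Suc k) * (t / N)}"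
      show "norm (y2 s - (x + t *\<^sub>R a + (real k * \<delta>) *\<^sub>R b)) \<le> \<eta>"
        by (rule samp[where q' = "x + t *\<^sub>R a + s *\<^sub>R b" and d = b and r = "s - real k * \<delta>"])
          (use e2[OF in_t[OF ks]] Q b bnd[OF ks] in \<open>auto simp: algebra_simps\<close>)
    qed (use t in auto)
    \<comment> \<open>The last two sides are run through backwards: their sample points are those of the opposite sides in reverse order.\<close>
    have rev: "real (N - Suc k) * \<delta> = t - real (Suc k) * \<delta>" if "k < N" for k
    proof -
      have "real (N - Suc k) = real N - real (Suc k)" using that by (simp add: of_nat_diff)
      then show ?thesis using \<delta>(2) by (simp add: left_diff_distrib)
    qed
    have s3: "norm (y3 t - y3 0 - (\<Sum>k<N. (t / N) *\<^sub>R - ext i (x + (real (N - Suc k) * \<delta>) *\<^sub>R a + t *\<^sub>R b))) \<le> t * (L * \<eta>)"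
    proof (rule flow_sampled_sum[OF lip' y3(2) N(3)])
      fix k s assume ks: "k < N" "s \<in> {real k * (t / N)..real (Suc k) * (t / N)}"
      show "norm (y3 s - (x + (real (N - Suc k) * \<delta>) *\<^sub>R a + t *\<^sub>R b)) \<le> \<eta>"
        unfolding rev[OF ks(1)]
        by (rule samp[where q' = "x + t *\<^sub>R a + t *\<^sub>R b + s *\<^sub>R (- a)" and d = a and r = "real (Suc k) * \<delta> - s"])
          (use e3[OF in_t[OF ks]] Q a bnd[OF ks] in \<open>auto simp: algebra_simps\<close>)
    qed (use t in auto)
    have s4: "norm (y4 t - y4 0 - (\<Sum>k<N. (t / N) *\<^sub>R - ext j (x + (real (N - Suc k) * \<delta>) *\<^sub>R b))) \<le> t * (L * \<eta>)"
    proof (rule flow_sampled_sum[OF lip' y4(2) N(3)])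
      fix k s assume ks: "k < N" "s \<in> {real k * (t / N)..real (Suc k) * (t / N)}"
      show "norm (y4 s - (x + (real (N - Suc k) * \<delta>) *\<^sub>R b)) \<le> \<eta>"
        unfolding rev[OF ks(1)]
        by (rule samp[where q' = "x + t *\<^sub>R b + s *\<^sub>R (- b)" and d = b and r = "real (Suc k) * \<delta> - s"])
          (use e4[OF in_t[OF ks]] Q b bnd[OF ks] in \<open>auto simp: algebra_simps\<close>)
    qed (use t in auto)
    have in_le: "p \<bullet> v \<le> norm p * (t * (L * \<eta>)) + p \<bullet> q" if "norm (v - q) \<le> t * (L * \<eta>)" for v q
    proof -
      have "p \<bullet> (v - q) \<le> norm p * norm (v - q)" by (rule norm_cauchy_schwarz)
      also have "\<dots> \<le> norm p * (t * (L * \<eta>))" using that by (intro mult_left_mono) auto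
      finally show ?thesis by (simp add: inner_diff_right)
    qed
    have sum3: "(\<Sum>k<N. u (x + (real (N - Suc k) * \<delta>) *\<^sub>R a + t *\<^sub>R b)) = (\<Sum>k<N. u (x + (real k * \<delta>) *\<^sub>R a + t *\<^sub>R b))"
      by (rule sum.nat_diff_reindex[where g = "\<lambda>k. u (x + (real k * \<delta>) *\<^sub>R a + t *\<^sub>R b)"])
    have sum4: "(\<Sum>k<N. w (x + (real (N - Suc k) * \<delta>) *\<^sub>R b)) = (\<Sum>k<N. w (x + (real k * \<delta>) *\<^sub>R b))"
      by (rule sum.nat_diff_reindex[where g = "\<lambda>k. w (x + (real k * \<delta>) *\<^sub>R b)"])
    have "p \<bullet> (y4 t - x) = p \<bullet> (y1 t - y1 0) + p \<bullet> (y2 t - y2 0) + p \<bullet> (y3 t - y3 0) + p \<bullet> (y4 t - y4 0)"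
      by (simp add: y1(1) y2(1) y3(1) y4(1) inner_diff_right)
    also have "\<dots> \<le> 4 * (norm p * (t * (L * \<eta>))) + S N"
      using in_le[OF s1] in_le[OF s2] in_le[OF s3] in_le[OF s4] sum3 sum4
      unfolding S_def \<delta>_def[symmetric]
      by (simp add: inner_sum_right sum_negf sum_subtractf right_diff_distrib flip: u_def w_def sum_distrib_left)
    also have "4 * (norm p * (t * (L * \<eta>))) = K * (10 * Q) + K * (M * \<delta>)"
      by (simp add: K_def \<eta>_def algebra_simps)
    finally show ?thesis using N(1) N(2)[folded \<delta>_def] by linarith
  qed
  then have "p \<bullet> (y4 t - x) \<le> - \<kappa> * t\<^sup>2 + K * (10 * Q)" by (rule field_le_epsilon)
  also have "K * (10 * Q) = 40 * norm p * L\<^sup>2 * M * t ^ 3"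
    by (simp add: K_def Q_def power2_eq_square power3_eq_cube)
  finally show ?thesis using that[OF re _ end_near] by blast
qed

end

section \<open>Limiting gradients of semiconcave functions\<close>

definition semiconcave_bound :: "real \<Rightarrow> ('a::real_inner) set \<Rightarrow> ('a \<Rightarrow> real) \<Rightarrow> bool" where
  "semiconcave_bound \<rho> K F \<longleftrightarrow>
     (\<forall>z1\<in>K. \<forall>z2\<in>K. F z1 + F z2 - 2 * F ((1/2) *\<^sub>R (z1 + z2)) \<le> \<rho> * (norm (z1 - z2))\<^sup>2)"

text \<open>Midpoint semiconcavity bounds the remainder \<open>\<phi> s\<close> of the first-order expansion along a segment by
  \<open>2 * \<phi> (s / 2)\<close> plus a quadratic term. Iterating, the first-order part \<open>2 ^ n * \<phi> (1 / 2 ^ n)\<close> tends to zero and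
  the quadratic terms form a geometric series. The resulting constant does not depend on the point.\<close>

lemma gradient_quadratic_bound:
  fixes F :: "'a::euclidean_space \<Rightarrow> real"
  assumes K: "convex K" and sc: "semiconcave_bound \<rho> K F"
    and X: "X \<in> K" "X + h \<in> K" and G: "GDERIV F X :> G"
  shows "F (X + h) \<le> F X + G \<bullet> h + 2 * \<rho> * (norm h)\<^sup>2"
proof -
  define \<phi> where "\<phi> s = F (X + s *\<^sub>R h) - F X - s * (G \<bullet> h)" for s
  define c where "c = \<rho> * (norm h)\<^sup>2"
  have inK: "X + s *\<^sub>R h \<in> K" if "0 \<le> s" "s \<le> 1" for s
  proof -
    have "(1 - s) *\<^sub>R X + s *\<^sub>R (X + h) \<in> K" using K X that by (simp add: convex_def)
    then show ?thesis by (simp add: algebra_simps)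
  qed
  have half: "\<phi> s \<le> 2 * \<phi> (s / 2) + c * s\<^sup>2" if "0 \<le> s" "s \<le> 1" for s
  proof -
    have "F (X + s *\<^sub>R h) + F X - 2 * F ((1/2) *\<^sub>R ((X + s *\<^sub>R h) + X)) \<le> \<rho> * (norm ((X + s *\<^sub>R h) - X))\<^sup>2"
      using sc inK[OF that] X(1) unfolding semiconcave_bound_def by blast
    moreover have "(1/2) *\<^sub>R ((X + s *\<^sub>R h) + X) = X + (s / 2) *\<^sub>R h"
      by (simp add: algebra_simps flip: scaleR_add_left)
    ultimately show ?thesis by (simp add: \<phi>_def c_def power_mult_distrib mult_ac)
  qed
  have iter: "\<phi> 1 \<le> 2 ^ n * \<phi> (1 / 2 ^ n) + 2 * c * (1 - 1 / 2 ^ n)" for n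
  proof (induction n)
    case (Suc n)
    have "2 ^ n * \<phi> (1 / 2 ^ n) \<le> 2 ^ n * (2 * \<phi> (1 / 2 ^ n / 2) + c * (1 / 2 ^ n)\<^sup>2)"
      by (intro mult_left_mono half) auto
    also have "\<dots> = 2 ^ Suc n * \<phi> (1 / 2 ^ Suc n) + c * (1 / 2 ^ n)"
      by (simp add: field_simps power2_eq_square)
    finally show ?case using Suc.IH by (simp add: field_simps)
  qed simp
  have lim: "filterlim (\<lambda>n. 1 / 2 ^ n :: real) (at_right 0) sequentially"
    unfolding filterlim_at using LIMSEQ_realpow_zero[of "1/2"] by (simp add: power_one_over)
  have "(diff_quot F h X \<longlongrightarrow> h \<bullet> G) (at_right 0)"
    using tendsto_diff_quot_has_derivative[of F "\<lambda>h. h \<bullet> G" X h] G by (simp add: gderiv_def inner_commute)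
  from filterlim_compose[OF this lim]
  have "(\<lambda>n. diff_quot F h X (1 / 2 ^ n) - h \<bullet> G) \<longlonglongrightarrow> h \<bullet> G - h \<bullet> G" by (intro tendsto_diff tendsto_const)
  moreover have "diff_quot F h X (1 / 2 ^ n) - h \<bullet> G = 2 ^ n * \<phi> (1 / 2 ^ n)" for n
    by (simp add: diff_quot_def \<phi>_def field_simps inner_commute)
  ultimately have l0: "(\<lambda>n. 2 ^ n * \<phi> (1 / 2 ^ n)) \<longlonglongrightarrow> 0" by simp
  have "(\<lambda>n. 2 ^ n * \<phi> (1 / 2 ^ n) + 2 * c * (1 - 1 / 2 ^ n)) \<longlonglongrightarrow> 0 + 2 * c * (1 - 0)"
    by (intro tendsto_add l0 tendsto_mult tendsto_const tendsto_diff) (use lim in \<open>simp add: filterlim_at\<close>)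
  then have "\<phi> 1 \<le> 0 + 2 * c * (1 - 0)" by (rule LIMSEQ_le_const) (use iter in blast)
  then show ?thesis by (simp add: \<phi>_def c_def)
qed

lemma has_gradient_if_quadratic_error:
  fixes F :: "'a::real_inner \<Rightarrow> real"
  assumes "r > 0" and err: "\<And>h. norm h < r \<Longrightarrow> \<bar>F (X + h) - F X - G \<bullet> h\<bar> \<le> C * (norm h)\<^sup>2"
  shows "GDERIV F X :> G"
  unfolding gderiv_def has_derivative_at_alt
proof (intro conjI allI impI)
  show "bounded_linear (\<lambda>h. h \<bullet> G)" by (rule bounded_linear_inner_left)
  fix e :: real assume "e > 0"
  define d where "d = min r (e / (\<bar>C\<bar> + 1))"
  have d: "d > 0" using \<open>e > 0\<close> \<open>r > 0\<close> by (simp add: d_def add_nonneg_pos)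
  show "\<exists>d>0. \<forall>y. norm (y - X) < d \<longrightarrow> norm (F y - F X - (y - X) \<bullet> G) \<le> e * norm (y - X)"
  proof (intro exI[of _ d] conjI d allI impI)
    fix y assume y: "norm (y - X) < d"
    have "\<bar>F y - F X - G \<bullet> (y - X)\<bar> \<le> C * (norm (y - X))\<^sup>2" using err[of "y - X"] y by (simp add: d_def)
    also have "\<dots> \<le> (\<bar>C\<bar> + 1) * (norm (y - X))\<^sup>2" by (intro mult_right_mono) auto
    also have "\<dots> = ((\<bar>C\<bar> + 1) * norm (y - X)) * norm (y - X)" by (simp add: power2_eq_square)
    also have "\<dots> \<le> e * norm (y - X)"
    proof (rule mult_right_mono)
      have "(\<bar>C\<bar> + 1) * norm (y - X) \<le> (\<bar>C\<bar> + 1) * (e / (\<bar>C\<bar> + 1))" using y by (intro mult_left_mono) (auto simp: d_def)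
      then show "(\<bar>C\<bar> + 1) * norm (y - X) \<le> e" by (simp add: add_nonneg_pos less_imp_neq[symmetric])
    qed simp
    finally show "norm (F y - F X - (y - X) \<bullet> G) \<le> e * norm (y - X)" by (simp add: inner_commute)
  qed
qed

text \<open>Adding a steep paraboloid to \<open>F\<close> produces an interior minimum, where \<open>F\<close> has a quadratic lower bound; semiconcavity
  reflects it to a quadratic upper bound.\<close>

lemma dense_differentiability_semiconcave:
  fixes F :: "'a::euclidean_space \<Rightarrow> real"
  assumes r: "r > 0" and cont: "continuous_on (cball z r) F" and sc: "semiconcave_bound \<rho> (cball z r) F"
  shows "\<exists>X\<in>ball z r. \<exists>G. GDERIV F X :> G"
proof -
  have "bounded (F ` cball z r)" by (intro compact_imp_bounded compact_continuous_image cont compact_cball)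
  then obtain B where B: "B > 0" "\<And>v. v \<in> cball z r \<Longrightarrow> \<bar>F v\<bar> \<le> B" by (auto simp: bounded_pos)
  \<comment> \<open>Steep enough for the paraboloid to exceed the oscillation of \<open>F\<close> on the boundary of the ball.\<close>
  define k where "k = (2 * B + 1) / r\<^sup>2"
  have k: "k > 0" "k * r\<^sup>2 = 2 * B + 1" using B r by (auto simp: k_def)
  define g where "g v = F v + k * (norm (v - z))\<^sup>2" for v
  have "continuous_on (cball z r) g" unfolding g_def by (intro continuous_intros cont)
  then obtain X where X: "X \<in> cball z r" "\<And>v. v \<in> cball z r \<Longrightarrow> g X \<le> g v"
    using continuous_attains_inf[OF compact_cball, of z r g] r by auto
  have Xin: "X \<in> ball z r"
  proof (rule ccontr)
    assume "X \<notin> ball z r"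
    then have "norm (X - z) = r" using X(1) by (simp add: dist_norm norm_minus_commute)
    then have "g X = F X + (2 * B + 1)" using k by (simp add: g_def)
    moreover have "g X \<le> g z" using X(2)[of z] r by simp
    moreover have "g z = F z" by (simp add: g_def)
    ultimately show False using B(2)[OF X(1)] B(2)[of z] r by auto
  qed
  define \<epsilon> where "\<epsilon> = r - dist z X"
  have \<epsilon>: "\<epsilon> > 0" using Xin by (simp add: \<epsilon>_def)
  have inb: "X + h \<in> cball z r" if "norm h < \<epsilon>" for h
    using that dist_triangle[of z "X + h" X] by (simp add: \<epsilon>_def dist_norm)
  define G where "G = (- 2 * k) *\<^sub>R (X - z)"
  have lower: "- k * (norm h)\<^sup>2 \<le> F (X + h) - F X - G \<bullet> h" if "norm h < \<epsilon>" for h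
  proof -
    have "g X \<le> g (X + h)" by (rule X(2)[OF inb[OF that]])
    moreover have "(norm (X + h - z))\<^sup>2 = (norm (X - z))\<^sup>2 + 2 * ((X - z) \<bullet> h) + (norm h)\<^sup>2"
      unfolding power2_norm_eq_inner by (simp add: inner_add_left inner_add_right inner_diff_left inner_diff_right inner_commute algebra_simps)
    ultimately show ?thesis by (simp add: g_def G_def algebra_simps)
  qed
  have upper: "F (X + h) - F X - G \<bullet> h \<le> (4 * \<rho> + k) * (norm h)\<^sup>2" if "norm h < \<epsilon>" for h
  proof -
    have n: "norm (- h) < \<epsilon>" using that by simp
    have "F (X + h) + F (X + - h) - 2 * F ((1/2) *\<^sub>R ((X + h) + (X + - h))) \<le> \<rho> * (norm ((X + h) - (X + - h)))\<^sup>2"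
      using sc inb[OF that] inb[OF n] unfolding semiconcave_bound_def by blast
    moreover have "(1/2) *\<^sub>R ((X + h) + (X + - h)) = X" by (simp flip: scaleR_add_left add: scaleR_right_distrib[symmetric])
    moreover have "norm ((X + h) - (X + - h)) = 2 * norm h" by (simp flip: scaleR_2)
    ultimately show ?thesis using lower[OF n] by (simp add: power_mult_distrib algebra_simps)
  qed
  have "GDERIV F X :> G"
  proof (rule has_gradient_if_quadratic_error[OF \<epsilon>])
    fix h :: 'a assume h: "norm h < \<epsilon>"
    have "4 * \<rho> * (norm h)\<^sup>2 \<le> 4 * \<bar>\<rho>\<bar> * (norm h)\<^sup>2" by (intro mult_right_mono) auto
    moreover have "0 \<le> 4 * \<bar>\<rho>\<bar> * (norm h)\<^sup>2" by simp
    ultimately show "\<bar>F (X + h) - F X - G \<bullet> h\<bar> \<le> (4 * \<bar>\<rho>\<bar> + k) * (norm h)\<^sup>2"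
      using upper[OF h, unfolded distrib_right] lower[OF h] unfolding abs_le_iff distrib_right by linarith
  qed
  then show ?thesis using Xin by blast
qed

lemma limiting_gradient_near:
  assumes "w \<in> limiting_gradients D F x" "e > 0" "finite S"
  obtains X G where "X \<in> D" "X \<noteq> x" "X \<notin> S" "GDERIV F X :> G" "dist X x < e" "dist G w < e"
proof -
  obtain X G where XG: "\<And>k. X k \<in> D \<and> X k \<noteq> x \<and> (GDERIV F (X k) :> G k)" "X \<longlonglongrightarrow> x" "G \<longlonglongrightarrow> w"
    using assms(1) by (auto simp: limiting_gradients_def)
  have "\<forall>\<^sub>F k in sequentially. X k \<notin> S - {x}"
  proof -
    have "open (- (S - {x}))" by (intro open_Compl finite_imp_closed finite_Diff assms(3))
    then have "\<forall>\<^sub>F k in sequentially. X k \<in> - (S - {x})" by (rule topological_tendstoD[OF XG(2)]) simp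
    then show ?thesis by eventually_elim auto
  qed
  moreover have "\<forall>\<^sub>F k in sequentially. dist (X k) x < e" by (rule tendstoD[OF XG(2) assms(2)])
  moreover have "\<forall>\<^sub>F k in sequentially. dist (G k) w < e" by (rule tendstoD[OF XG(3) assms(2)])
  ultimately have "\<forall>\<^sub>F k in sequentially. X k \<notin> S - {x} \<and> dist (X k) x < e \<and> dist (G k) w < e"
    by eventually_elim simp
  then obtain k where "X k \<notin> S - {x} \<and> dist (X k) x < e \<and> dist (G k) w < e"
    using eventually_happens'[OF sequentially_bot] by blast
  then show ?thesis using that[of "X k" "G k"] XG(1)[of k] by blast
qed

lemma limiting_gradients_closed:
  assumes lg: "\<And>k. w k \<in> limiting_gradients D F (x k)" and "x \<longlonglongrightarrow> x0" "w \<longlonglongrightarrow> w0"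
  shows "w0 \<in> limiting_gradients D F x0"
proof -
  have "\<exists>X G. X \<in> D \<and> X \<noteq> x0 \<and> (GDERIV F X :> G) \<and> dist X (x k) < inverse (real (Suc k)) \<and> dist G (w k) < inverse (real (Suc k))" for k
    by (rule limiting_gradient_near[OF lg[of k], of "inverse (real (Suc k))" "{x0}"]) auto
  then obtain X G where XG: "\<And>k. X k \<in> D \<and> X k \<noteq> x0 \<and> (GDERIV F (X k) :> G k) \<and>
      dist (X k) (x k) < inverse (real (Suc k)) \<and> dist (G k) (w k) < inverse (real (Suc k))" by metis
  have conv: "a \<longlonglongrightarrow> b0" if "\<And>k. dist (a k) (b k) < inverse (real (Suc k))" "b \<longlonglongrightarrow> b0" for a b :: "nat \<Rightarrow> real^'n" and b0
  proof -
    have "\<forall>\<^sub>F k in sequentially. norm (a k - b k) \<le> inverse (real (Suc k))"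
      using that(1) by (auto simp: dist_norm less_imp_le intro!: always_eventually)
    then have "(\<lambda>k. a k - b k) \<longlonglongrightarrow> 0" by (rule Lim_null_comparison[OF _ LIMSEQ_inverse_real_of_nat])
    from tendsto_add[OF this that(2)] show ?thesis by simp
  qed
  have "X \<longlonglongrightarrow> x0" "G \<longlonglongrightarrow> w0" using conv[of X x] conv[of G w] XG assms by auto
  then show ?thesis unfolding limiting_gradients_def using XG by blast
qed

text \<open>Every point is a limit of points of differentiability, at which the quadratic bound holds with a common constant. The bound also
  controls the size of the gradients, so they accumulate, and it survives the passage to the limit. Points of
  differentiability different from \<open>x\<close> are chosen because limiting gradients ignore \<open>x\<close> itself.\<close>

lemma limiting_supergradients:
  fixes F :: "real^'n \<Rightarrow> real"
  assumes "open D" "x0 \<in> D" and sc: "locally_semiconcave_on D F"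
  obtains R \<rho> C where "R > 0" "\<rho> \<ge> 0" "cball x0 R \<subseteq> D"
    "\<And>x. x \<in> cball x0 R \<Longrightarrow> \<exists>p\<in>limiting_gradients D F x. norm p \<le> C \<and>
        (\<forall>z\<in>cball x0 R. F z \<le> F x + p \<bullet> (z - x) + \<rho> * (norm (z - x))\<^sup>2)"
proof -
  obtain r where r: "r > 0" "cball x0 r \<subseteq> D" using assms(1,2) open_contains_cball by blast
  have "semiconcave_on (cball x0 r) F" using sc r by (simp add: locally_semiconcave_on_def)
  then obtain \<rho> where \<rho>: "\<rho> > 0" and sb: "semiconcave_bound \<rho> (cball x0 r) F" and cF: "continuous_on (cball x0 r) F"
    unfolding semiconcave_on_def semiconcave_bound_def by (auto simp: closed_segment_subset)
  have "bounded (F ` cball x0 r)" by (intro compact_imp_bounded compact_continuous_image cF compact_cball)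
  then obtain B where B: "B > 0" "\<And>v. v \<in> cball x0 r \<Longrightarrow> \<bar>F v\<bar> \<le> B" by (auto simp: bounded_pos)
  define R where "R = r / 2"
  have R: "R > 0" "R < r" using r by (auto simp: R_def)
  define C where "C = (2 * B + 2 * \<rho> * (r / 4)\<^sup>2) / (r / 4)"
  have Gb: "norm G \<le> C" if X: "X \<in> ball x0 (3 * r / 4)" and G: "GDERIV F X :> G" for X G
  proof (cases "G = 0")
    case False
    \<comment> \<open>A large gradient would make \<open>F\<close> too small at distance \<open>r / 4\<close> against it.\<close>
    define h where "h = (- (r / 4) / norm G) *\<^sub>R G"
    have nh: "norm h = r / 4" using False r by (simp add: h_def)
    have Xh: "X \<in> cball x0 r" "X + h \<in> cball x0 r"
      using X r nh dist_triangle[of x0 "X + h" X] by (auto simp: dist_norm)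
    have "F (X + h) \<le> F X + G \<bullet> h + 2 * \<rho> * (norm h)\<^sup>2"
      by (rule gradient_quadratic_bound[OF convex_cball sb Xh G])
    moreover have "G \<bullet> h = - (r / 4) * norm G"
      using False by (simp add: h_def power2_norm_eq_inner[symmetric] power2_eq_square)
    ultimately have "(r / 4) * norm G \<le> 2 * B + 2 * \<rho> * (r / 4)\<^sup>2"
      using B(2)[OF Xh(1)] B(2)[OF Xh(2)] nh by (simp add: abs_le_iff)
    then show ?thesis using r by (simp add: C_def field_simps)
  qed (use B \<rho> r in \<open>simp add: C_def\<close>)
  have main: "\<exists>p\<in>limiting_gradients D F x. norm p \<le> C \<and>
        (\<forall>z\<in>cball x0 R. F z \<le> F x + p \<bullet> (z - x) + 2 * \<rho> * (norm (z - x))\<^sup>2)" if x: "x \<in> cball x0 R" for x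
  proof -
    have "\<exists>X G. X \<in> ball x0 (3 * r / 4) \<and> X \<noteq> x \<and> dist X x < inverse (real (Suc k)) \<and> (GDERIV F X :> G)" for k
    proof -
      define V where "V = ball x0 (3 * r / 4) \<inter> ball x (inverse (real (Suc k))) - {x}"
      have "open (V \<union> {x})" "x \<in> V \<union> {x}"
      proof -
        have "V \<union> {x} = ball x0 (3 * r / 4) \<inter> ball x (inverse (real (Suc k)))" using x r by (auto simp: V_def R_def)
        then show "open (V \<union> {x})" by (simp add: open_Int)
      qed simp
      then have "V \<noteq> {}" using not_open_singleton[of x] by auto
      then obtain v where "v \<in> V" by auto
      have "open V" unfolding V_def by (intro open_Diff open_Int) auto
      then obtain s where s: "s > 0" "cball v s \<subseteq> V" using \<open>v \<in> V\<close> open_contains_cball by blast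
      have sub: "cball v s \<subseteq> cball x0 r" using s(2) r by (auto simp: V_def subset_iff)
      have "\<exists>X\<in>ball v s. \<exists>G. GDERIV F X :> G"
      proof (rule dense_differentiability_semiconcave[OF s(1) continuous_on_subset[OF cF sub]])
        show "semiconcave_bound \<rho> (cball v s) F"
          using sb sub unfolding semiconcave_bound_def by blast
      qed
      then obtain X G where "X \<in> ball v s" "GDERIV F X :> G" by blast
      moreover from this have "X \<in> V" using s(2) by auto
      ultimately show ?thesis unfolding V_def by (auto simp: dist_commute)
    qed
    then obtain X G where XG: "\<And>k. X k \<in> ball x0 (3 * r / 4) \<and> X k \<noteq> x \<and> dist (X k) x < inverse (real (Suc k)) \<and> (GDERIV F (X k) :> G k)"
      by metis
    have Xlim: "X \<longlonglongrightarrow> x" unfolding tendsto_iff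
    proof (intro allI impI)
      fix e :: real assume "e > 0"
      then have "\<forall>\<^sub>F k in sequentially. inverse (real (Suc k)) < e" by (rule order_tendstoD(2)[OF LIMSEQ_inverse_real_of_nat])
      then show "\<forall>\<^sub>F k in sequentially. dist (X k) x < e" by eventually_elim (use XG in \<open>metis order_less_trans\<close>)
    qed
    have "bounded (range G)" unfolding bounded_iff using Gb XG by blast
    then obtain p \<sigma> where p: "strict_mono \<sigma>" "(G \<circ> \<sigma>) \<longlonglongrightarrow> p"
      using bounded_imp_convergent_subsequence by blast
    have X\<sigma>: "(X \<circ> \<sigma>) \<longlonglongrightarrow> x" by (rule LIMSEQ_subseq_LIMSEQ[OF Xlim p(1)])
    have Xr: "X k \<in> cball x0 r" for k using XG[of k] r by auto
    have "x \<in> cball x0 r" using x R by auto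
    have "p \<in> limiting_gradients D F x" unfolding limiting_gradients_def mem_Collect_eq
      using XG r(2) Xr X\<sigma> p(2) by (intro exI[of _ "X \<circ> \<sigma>"] exI[of _ "G \<circ> \<sigma>"]) auto
    moreover have "norm p \<le> C"
      by (rule LIMSEQ_le_const2[OF tendsto_norm[OF p(2)]]) (use Gb XG in auto)
    moreover have "F z \<le> F x + p \<bullet> (z - x) + 2 * \<rho> * (norm (z - x))\<^sup>2" if z: "z \<in> cball x0 R" for z
    proof (rule LIMSEQ_le_const)
      have "(\<lambda>k. F ((X \<circ> \<sigma>) k)) \<longlonglongrightarrow> F x"
        using cF \<open>x \<in> cball x0 r\<close> Xr X\<sigma> unfolding continuous_on_sequentially by (simp add: o_def)
      then show "(\<lambda>k. F ((X \<circ> \<sigma>) k) + (G \<circ> \<sigma>) k \<bullet> (z - (X \<circ> \<sigma>) k) + 2 * \<rho> * (norm (z - (X \<circ> \<sigma>) k))\<^sup>2)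
          \<longlonglongrightarrow> F x + p \<bullet> (z - x) + 2 * \<rho> * (norm (z - x))\<^sup>2"
        by (intro tendsto_intros p(2) X\<sigma>)
      have "F z \<le> F (X k) + G k \<bullet> (z - X k) + 2 * \<rho> * (norm (z - X k))\<^sup>2" for k
        using gradient_quadratic_bound[OF convex_cball sb Xr, of k "z - X k" "G k"] XG[of k] z R by auto
      then show "\<exists>N. \<forall>k\<ge>N. F z \<le> F ((X \<circ> \<sigma>) k) + (G \<circ> \<sigma>) k \<bullet> (z - (X \<circ> \<sigma>) k) + 2 * \<rho> * (norm (z - (X \<circ> \<sigma>) k))\<^sup>2"
        by simp
    qed
    ultimately show ?thesis by blast
  qed
  have "cball x0 R \<subseteq> D" using r R by auto
  then show ?thesis using that[of R "2 * \<rho>" C] main R(1) \<rho> by simp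
qed

section \<open>Class KL majorants\<close>

text \<open>Each sample \<open>e i t\<close> is spread, with continuous cut-offs, over the radii above \<open>r i / 2\<close> and the times before \<open>t + 1\<close>;
  the supremum over all samples is monotone in both variables and at \<open>(\<delta>, s)\<close> sees only samples with \<open>r i \<le> 2 * \<delta>\<close> and
  \<open>t \<ge> s - 1\<close>. Away from \<open>\<delta> = 0\<close> the cut-offs are equi-Lipschitz, hence so is the supremum; at \<open>\<delta> = 0\<close>
  continuity is the stability hypothesis. The term \<open>\<delta> * exp (- s)\<close> makes it strictly increasing and unbounded.\<close>

lemma class_KL_majorant:
  fixes r :: "'i \<Rightarrow> real" and e :: "'i \<Rightarrow> real \<Rightarrow> real"
  assumes r: "\<And>i. i \<in> I \<Longrightarrow> r i > 0" and e: "\<And>i t. i \<in> I \<Longrightarrow> t \<ge> 0 \<Longrightarrow> e i t \<ge> 0"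
    and bdd: "\<And>\<delta>. \<exists>B. \<forall>i\<in>I. r i \<le> \<delta> \<longrightarrow> (\<forall>t\<ge>0. e i t \<le> B)"
    and stable: "\<And>\<epsilon>. \<epsilon> > 0 \<Longrightarrow> \<exists>\<delta>>0. \<forall>i\<in>I. r i \<le> \<delta> \<longrightarrow> (\<forall>t\<ge>0. e i t \<le> \<epsilon>)"
    and attractive: "\<And>\<delta> \<epsilon>. \<epsilon> > 0 \<Longrightarrow> \<exists>\<Theta>\<ge>0. \<forall>i\<in>I. r i \<le> \<delta> \<longrightarrow> (\<forall>t\<ge>\<Theta>. e i t \<le> \<epsilon>)"
  shows "\<exists>\<beta>\<in>class_KL. \<forall>i\<in>I. \<forall>t\<ge>0. e i t \<le> \<beta> (r i) t"
proof -
  \<comment> \<open>Cut-offs: \<open>\<phi>\<close> climbs from \<open>0\<close> to \<open>1\<close> on \<open>{1/2..1}\<close>, and \<open>\<psi>\<close> descends from \<open>1\<close> to \<open>0\<close> on \<open>{0..1}\<close>.\<close>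
  define \<phi> where "\<phi> x = max 0 (min 1 (2 * x - 1))" for x :: real
  define \<psi> where "\<psi> x = max 0 (min 1 (1 - x))" for x :: real
  have \<phi>: "0 \<le> \<phi> x" "\<phi> x \<le> 1" "x \<le> x' \<Longrightarrow> \<phi> x \<le> \<phi> x'" "\<bar>\<phi> x - \<phi> x'\<bar> \<le> 2 * \<bar>x - x'\<bar>" for x x' by (auto simp: \<phi>_def max_def min_def abs_if)
  have \<psi>: "0 \<le> \<psi> x" "\<psi> x \<le> 1" "x \<le> x' \<Longrightarrow> \<psi> x' \<le> \<psi> x" "\<bar>\<psi> x - \<psi> x'\<bar> \<le> \<bar>x - x'\<bar>" for x x' by (auto simp: \<psi>_def max_def min_def abs_if)
  have \<phi>0: "\<phi> x = 0" if "x \<le> 1 / 2" for x using that by (simp add: \<phi>_def max_def)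
  have \<phi>1: "\<phi> x = 1" if "1 \<le> x" for x using that by (simp add: \<phi>_def max_def min_def)
  have pd: "x * d \<le> \<bar>d\<bar>" if "0 \<le> x" "x \<le> 1" for x d :: real
  proof -
    have "x * d \<le> x * \<bar>d\<bar>" using that by (intro mult_left_mono) auto
    also have "\<dots> \<le> 1 * \<bar>d\<bar>" using that by (intro mult_right_mono) auto
    finally show ?thesis by simp
  qed
  define X where "X i t \<delta> s = e i t * (\<phi> (\<delta> / r i) * \<psi> (s - t))" for i t \<delta> s
  define A where "A \<delta> s = insert 0 {X i t \<delta> s | i t. i \<in> I \<and> t \<ge> 0}" for \<delta> s
  define \<beta>0 where "\<beta>0 \<delta> s = Sup (A \<delta> s)" for \<delta> s
  have fp: "0 \<le> \<phi> x * \<psi> y" "\<phi> x * \<psi> y \<le> 1" for x y using \<phi>(1,2)[of x] \<psi>(1,2)[of y] by (auto simp: mult_le_one)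
  have X0: "X i t \<delta> s = 0" if "i \<in> I" "r i \<ge> 2 * \<delta> \<or> s - t \<ge> 1" for i t \<delta> s
    using that(2)
  proof
    assume "r i \<ge> 2 * \<delta>"
    then have "\<delta> / r i \<le> 1 / 2" using r[OF that(1)] by (simp add: field_simps)
    then show ?thesis by (simp add: X_def \<phi>0)
  qed (simp add: X_def \<psi>_def)
  have Xe: "X i t \<delta> s \<le> e i t" if "i \<in> I" "t \<ge> 0" for i t \<delta> s
    using mult_left_mono[OF fp(2) e[OF that], of "\<delta> / r i" "s - t"] by (simp add: X_def)
  have Xbound: "X i t \<delta> s \<le> c" if "i \<in> I" "t \<ge> 0" "0 \<le> c"
    "r i \<le> 2 * \<delta> \<Longrightarrow> t \<ge> s - 1 \<Longrightarrow> e i t \<le> c" for i t \<delta> s c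
  proof (cases "r i \<ge> 2 * \<delta> \<or> s - t \<ge> 1")
    case True
    then show ?thesis using X0[OF that(1)] that(3) by metis
  next
    case False
    then show ?thesis using Xe[OF that(1,2), of \<delta> s] that(4) by auto
  qed
  have Abdd: "bdd_above (A \<delta> s)" for \<delta> s
  proof -
    obtain B where B: "\<forall>i\<in>I. r i \<le> 2 * \<delta> \<longrightarrow> (\<forall>t\<ge>0. e i t \<le> B)" using bdd by blast
    have "x \<le> max 0 B" if "x \<in> A \<delta> s" for x
      using that unfolding A_def by (auto intro!: Xbound) (use B in \<open>force simp: max_def\<close>)+
    then show ?thesis by (auto simp: bdd_above_def)
  qed
  have up: "X i t \<delta> s \<le> \<beta>0 \<delta> s" if "i \<in> I" "t \<ge> 0" for i t \<delta> s
    unfolding \<beta>0_def by (rule cSup_upper[OF _ Abdd]) (use that in \<open>auto simp: A_def\<close>)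
  have \<beta>0_ge0: "0 \<le> \<beta>0 \<delta> s" for \<delta> s
    unfolding \<beta>0_def by (rule cSup_upper[OF _ Abdd]) (auto simp: A_def)
  have least: "\<beta>0 \<delta> s \<le> c" if "0 \<le> c" "\<And>i t. i \<in> I \<Longrightarrow> t \<ge> 0 \<Longrightarrow> X i t \<delta> s \<le> c" for \<delta> s c
    unfolding \<beta>0_def by (rule cSup_least) (use that in \<open>auto simp: A_def\<close>)
  have mono: "\<beta>0 \<delta> s \<le> \<beta>0 \<delta>' s'" if "\<delta> \<le> \<delta>'" "s' \<le> s" for \<delta> \<delta>' s s'
  proof (rule least[OF \<beta>0_ge0])
    fix i t assume it: "i \<in> I" "t \<ge> (0::real)"
    have "\<phi> (\<delta> / r i) * \<psi> (s - t) \<le> \<phi> (\<delta>' / r i) * \<psi> (s' - t)"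
      using \<phi> \<psi> that r[OF it(1)] by (intro mult_mono) (auto simp: divide_right_mono)
    then have "X i t \<delta> s \<le> X i t \<delta>' s'" unfolding X_def by (rule mult_left_mono[OF _ e[OF it]])
    also have "\<dots> \<le> \<beta>0 \<delta>' s'" by (rule up[OF it])
    finally show "X i t \<delta> s \<le> \<beta>0 \<delta>' s'" .
  qed
  have zero: "\<beta>0 0 s = 0" for s
    by (rule antisym[OF least \<beta>0_ge0]) (auto simp: X_def \<phi>_def)
  have small: "\<exists>d>0. \<forall>\<delta> s. \<delta> \<le> d \<longrightarrow> \<beta>0 \<delta> s \<le> \<epsilon>" if pos: "\<epsilon> > 0" for \<epsilon>
  proof -
    obtain \<delta>' where d: "\<delta>' > 0" "\<forall>i\<in>I. r i \<le> \<delta>' \<longrightarrow> (\<forall>t\<ge>0. e i t \<le> \<epsilon>)" using stable[OF pos] by blast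
    have "\<beta>0 \<delta> s \<le> \<epsilon>" if "\<delta> \<le> \<delta>' / 2" for \<delta> s
      by (rule least) (use that d \<open>\<epsilon> > 0\<close> in \<open>auto intro!: Xbound\<close>)
    then show ?thesis using d(1) by (intro exI[of _ "\<delta>' / 2"]) auto
  qed
  have late: "\<exists>\<Theta>\<ge>0. \<forall>s\<ge>\<Theta>. \<beta>0 \<delta> s \<le> \<epsilon>" if pos: "\<epsilon> > 0" for \<epsilon> \<delta>
  proof -
    obtain \<Theta> where \<Theta>: "\<Theta> \<ge> 0" "\<forall>i\<in>I. r i \<le> 2 * \<delta> \<longrightarrow> (\<forall>t\<ge>\<Theta>. e i t \<le> \<epsilon>)" using attractive[OF pos] by blast
    have "\<beta>0 \<delta> s \<le> \<epsilon>" if "s \<ge> \<Theta> + 1" for s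
      by (rule least) (use that \<Theta> \<open>\<epsilon> > 0\<close> in \<open>auto intro!: Xbound\<close>)
    then show ?thesis using \<Theta>(1) by (intro exI[of _ "\<Theta> + 1"]) auto
  qed
  have lip: "\<beta>0 \<delta> s \<le> \<beta>0 \<delta>' s' + B * (2 / a * \<bar>\<delta> - \<delta>'\<bar> + \<bar>s - s'\<bar>)"
    if "0 < a" "a \<le> \<delta>" "a \<le> \<delta>'" "\<delta> \<le> b" "\<delta>' \<le> b" "0 \<le> B" and B: "\<forall>i\<in>I. r i \<le> 2 * b \<longrightarrow> (\<forall>t\<ge>0. e i t \<le> B)"
    for a b B \<delta> \<delta>' s s'
  proof (rule least)
    define m where "m = 2 / a * \<bar>\<delta> - \<delta>'\<bar> + \<bar>s - s'\<bar>"
    have m: "m \<ge> 0" using that by (simp add: m_def)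
    show "0 \<le> \<beta>0 \<delta>' s' + B * (2 / a * \<bar>\<delta> - \<delta>'\<bar> + \<bar>s - s'\<bar>)"
      using m \<beta>0_ge0 \<open>0 \<le> B\<close> by (fold m_def) (simp add: add_nonneg_nonneg)
    fix i t assume it: "i \<in> I" "t \<ge> (0::real)"
    show "X i t \<delta> s \<le> \<beta>0 \<delta>' s' + B * (2 / a * \<bar>\<delta> - \<delta>'\<bar> + \<bar>s - s'\<bar>)"
    proof (cases "r i \<le> 2 * b")
      case False
      then have "X i t \<delta> s = 0" using that by (intro X0[OF it(1)]) auto
      then show ?thesis using m \<beta>0_ge0 \<open>0 \<le> B\<close> by (fold m_def) (simp add: add_nonneg_nonneg)
    next
      case True
      have \<phi>d: "\<bar>\<phi> (\<delta> / r i) - \<phi> (\<delta>' / r i)\<bar> \<le> 2 / a * \<bar>\<delta> - \<delta>'\<bar>"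
      proof (cases "r i \<le> a")
        case True
        then have "1 \<le> \<delta> / r i" "1 \<le> \<delta>' / r i" using r[OF it(1)] that by (auto simp: field_simps)
        then have "\<phi> (\<delta> / r i) = 1" "\<phi> (\<delta>' / r i) = 1" by (auto intro: \<phi>1)
        then show ?thesis using \<open>0 < a\<close> by simp
      next
        case False
        have "\<bar>\<phi> (\<delta> / r i) - \<phi> (\<delta>' / r i)\<bar> \<le> 2 * \<bar>\<delta> / r i - \<delta>' / r i\<bar>" by (rule \<phi>(4))
        also have "\<dots> = 2 * \<bar>\<delta> - \<delta>'\<bar> / r i" using r[OF it(1)] by (simp flip: diff_divide_distrib)
        also have "\<dots> \<le> 2 * \<bar>\<delta> - \<delta>'\<bar> / a" using False \<open>0 < a\<close> by (intro divide_left_mono) auto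
        finally show ?thesis by simp
      qed
      have \<psi>d: "\<bar>\<psi> (s - t) - \<psi> (s' - t)\<bar> \<le> \<bar>s - s'\<bar>" using \<psi>(4)[of "s - t" "s' - t"] by simp
      have split: "\<phi> (\<delta> / r i) * \<psi> (s - t) - \<phi> (\<delta>' / r i) * \<psi> (s' - t)
          = \<psi> (s - t) * (\<phi> (\<delta> / r i) - \<phi> (\<delta>' / r i)) + \<phi> (\<delta>' / r i) * (\<psi> (s - t) - \<psi> (s' - t))"
        by (simp add: algebra_simps)
      have arith: "P \<le> P' + (c + d)" if "P - P' = X1 + X2" "X1 \<le> c" "X2 \<le> d" for P P' X1 X2 c d :: real
        using that by linarith
      have "\<phi> (\<delta> / r i) * \<psi> (s - t) \<le> \<phi> (\<delta>' / r i) * \<psi> (s' - t) + m"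
        unfolding m_def
        by (rule arith[OF split order_trans[OF pd[OF \<psi>(1,2)] \<phi>d] order_trans[OF pd[OF \<phi>(1,2)] \<psi>d]])
      then have "X i t \<delta> s \<le> e i t * (\<phi> (\<delta>' / r i) * \<psi> (s' - t) + m)"
        unfolding X_def by (rule mult_left_mono[OF _ e[OF it]])
      also have "\<dots> = X i t \<delta>' s' + e i t * m" by (simp add: X_def distrib_left)
      also have "\<dots> \<le> \<beta>0 \<delta>' s' + B * m"
        using up[OF it] B it True m by (intro add_mono mult_right_mono) auto
      finally show ?thesis by (simp add: m_def)
    qed
  qed
  have cont: "continuous_on ({0..} \<times> {0..}) (\<lambda>(\<delta>, s). \<beta>0 \<delta> s)"
    unfolding continuous_on_iff
  proof (clarify, goal_cases)
    case (1 \<delta>0 s0 \<epsilon>)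
    show ?case
    proof (cases "\<delta>0 = 0")
      case True
      obtain d where d: "d > 0" "\<forall>\<delta> s. \<delta> \<le> d \<longrightarrow> \<beta>0 \<delta> s \<le> \<epsilon> / 2" using small[of "\<epsilon> / 2"] 1 by auto
      show ?thesis
      proof (intro exI[of _ d] conjI d(1), clarify)
        fix \<delta> s :: real assume "dist (\<delta>, s) (\<delta>0, s0) < d"
        then have "\<bar>\<delta> - \<delta>0\<bar> < d" using dist_fst_le[of "(\<delta>, s)" "(\<delta>0, s0)"] by (simp add: dist_real_def)
        then have "\<beta>0 \<delta> s \<le> \<epsilon> / 2" using d(2) True by auto
        then show "dist (\<beta>0 \<delta> s) (\<beta>0 \<delta>0 s0) < \<epsilon>" using \<beta>0_ge0[of \<delta> s] True zero 1 by (simp add: dist_real_def)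
      qed
    next
      case False
      then have \<delta>0: "\<delta>0 > 0" using 1 by simp
      obtain B0 where B0: "\<forall>i\<in>I. r i \<le> 2 * (2 * \<delta>0) \<longrightarrow> (\<forall>t\<ge>0. e i t \<le> B0)" using bdd by blast
      define B where "B = max 1 B0"
      have B: "B > 0" "\<forall>i\<in>I. r i \<le> 2 * (2 * \<delta>0) \<longrightarrow> (\<forall>t\<ge>0. e i t \<le> B)" using B0 by (auto simp: B_def intro: max.coboundedI2)
      define c where "c = B * (2 / (\<delta>0 / 2) + 1)"
      have c: "c > 0" using B \<delta>0 by (simp add: c_def add_pos_pos)
      define d where "d = min (\<delta>0 / 2) (\<epsilon> / (2 * c))"
      have "d > 0" using \<delta>0 c 1 by (simp add: d_def)
      show ?thesis
      proof (intro exI[of _ d] conjI \<open>d > 0\<close>, clarify)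
        fix \<delta> s :: real assume D: "dist (\<delta>, s) (\<delta>0, s0) < d"
        then have near: "\<bar>\<delta> - \<delta>0\<bar> < d" "\<bar>s - s0\<bar> < d"
          using dist_fst_le[of "(\<delta>, s)" "(\<delta>0, s0)"] dist_snd_le[of "(\<delta>, s)" "(\<delta>0, s0)"] by (auto simp: dist_real_def)
        have "\<bar>\<delta> - \<delta>0\<bar> < \<delta>0 / 2" using near(1) by (simp add: d_def)
        then have rng: "\<delta>0 / 2 \<le> \<delta>" "\<delta> \<le> 2 * \<delta>0" using \<delta>0 by arith+
        have "2 / (\<delta>0 / 2) * \<bar>\<delta> - \<delta>0\<bar> + \<bar>s - s0\<bar> \<le> 2 / (\<delta>0 / 2) * d + d"
          using near \<delta>0 by (intro add_mono mult_left_mono) auto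
        then have "B * (2 / (\<delta>0 / 2) * \<bar>\<delta> - \<delta>0\<bar> + \<bar>s - s0\<bar>) \<le> B * (2 / (\<delta>0 / 2) * d + d)"
          using B by (intro mult_left_mono) auto
        also have "\<dots> = c * d" by (simp add: c_def algebra_simps)
        also have "\<dots> \<le> c * (\<epsilon> / (2 * c))" using c by (intro mult_left_mono) (auto simp: d_def)
        also have "\<dots> < \<epsilon>" using c 1 by simp
        finally have E: "B * (2 / (\<delta>0 / 2) * \<bar>\<delta> - \<delta>0\<bar> + \<bar>s - s0\<bar>) < \<epsilon>" .
        have l1: "\<beta>0 \<delta> s \<le> \<beta>0 \<delta>0 s0 + B * (2 / (\<delta>0 / 2) * \<bar>\<delta> - \<delta>0\<bar> + \<bar>s - s0\<bar>)"
          by (rule lip[where b = "2 * \<delta>0"]) (use \<delta>0 rng B in auto)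
        have l2: "\<beta>0 \<delta>0 s0 \<le> \<beta>0 \<delta> s + B * (2 / (\<delta>0 / 2) * \<bar>\<delta>0 - \<delta>\<bar> + \<bar>s0 - s\<bar>)"
          by (rule lip[where b = "2 * \<delta>0"]) (use \<delta>0 rng B in auto)
        show "dist (\<beta>0 \<delta> s) (\<beta>0 \<delta>0 s0) < \<epsilon>"
          using l1 l2 E by (simp add: dist_real_def abs_minus_commute abs_less_iff)
      qed
    qed
  qed
  define \<beta> where "\<beta> \<delta> s = \<beta>0 \<delta> s + \<delta> * exp (- s)" for \<delta> s
  have "\<beta> \<in> class_KL" unfolding class_KL_def mem_Collect_eq
  proof (intro conjI allI impI)
    have "continuous_on ({0..} \<times> {0..}) (\<lambda>p::real \<times> real. (case p of (\<delta>, s) \<Rightarrow> \<beta>0 \<delta> s) + fst p * exp (- snd p))"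
      by (intro continuous_intros cont)
    then show "continuous_on ({0..} \<times> {0..}) (\<lambda>(\<delta>, s). \<beta> \<delta> s)" by (simp add: \<beta>_def case_prod_beta')
    show "0 \<le> \<beta> \<delta> s" if "0 \<le> \<delta>" for \<delta> s using that \<beta>0_ge0 by (simp add: \<beta>_def)
    show "\<beta> 0 s = 0" for s by (simp add: \<beta>_def zero)
    show "strict_mono_on {0..} (\<lambda>\<delta>. \<beta> \<delta> s)" for s
      unfolding \<beta>_def by (intro strict_mono_onI add_le_less_mono mono) auto
    show "\<not> bdd_above ((\<lambda>\<delta>. \<beta> \<delta> s) ` {0..})" for s
    proof
      assume "bdd_above ((\<lambda>\<delta>. \<beta> \<delta> s) ` {0..})"
      then obtain B where B: "\<And>\<delta>. \<delta> \<ge> 0 \<Longrightarrow> \<beta> \<delta> s \<le> B" by (auto simp: bdd_above_def)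
      define \<delta> where "\<delta> = (\<bar>B\<bar> + 1) * exp s"
      have "\<bar>B\<bar> + 1 = \<delta> * exp (- s)" by (simp add: \<delta>_def exp_minus)
      also have "\<dots> \<le> \<beta> \<delta> s" using \<beta>0_ge0 by (simp add: \<beta>_def)
      also have "\<dots> \<le> B" by (rule B) (simp add: \<delta>_def)
      finally show False by simp
    qed
    show "antimono_on {0..} (\<beta> \<delta>)" if "0 \<le> \<delta>" for \<delta>
      unfolding \<beta>_def using that by (intro monotone_onI add_mono mono mult_left_mono) auto
    show "(\<beta> \<delta> \<longlongrightarrow> 0) at_top" for \<delta>
    proof -
      have "(\<beta>0 \<delta> \<longlongrightarrow> 0) at_top"
      proof (rule tendstoI)
        fix \<epsilon> :: real assume "\<epsilon> > 0"
        then obtain \<Theta> where "\<forall>s\<ge>\<Theta>. \<beta>0 \<delta> s \<le> \<epsilon> / 2" using late[of "\<epsilon> / 2" \<delta>] by auto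
        then show "\<forall>\<^sub>F s in at_top. dist (\<beta>0 \<delta> s) 0 < \<epsilon>"
          using \<beta>0_ge0 \<open>\<epsilon> > 0\<close> unfolding eventually_at_top_linorder
          by (intro exI[of _ \<Theta>]) (auto simp: dist_real_def intro: le_less_trans)
      qed
      moreover have "((\<lambda>s. \<delta> * exp (- s)) \<longlongrightarrow> \<delta> * 0) at_top"
        by (intro tendsto_mult tendsto_const filterlim_compose[OF exp_at_bot filterlim_uminus_at_bot_at_top])
      ultimately show ?thesis unfolding \<beta>_def using tendsto_add by fastforce
    qed
  qed
  moreover have "e i t \<le> \<beta> (r i) t" if it: "i \<in> I" "t \<ge> 0" for i t
  proof -
    have "X i t (r i) t = e i t" using r[OF it(1)] by (simp add: X_def \<phi>_def \<psi>_def)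
    then show ?thesis using up[OF it, of "r i" t] r[OF it(1)] by (simp add: \<beta>_def add_increasing2)
  qed
  ultimately show ?thesis by blast
qed

section \<open>Local decrease of the Lyapunov function\<close>

lemma norm_frechet_derivative_le:
  fixes f :: "'a::real_normed_vector \<Rightarrow> 'b::real_normed_vector"
  assumes lip: "L-lipschitz_on S f" and "open S" "z \<in> S" and D: "(f has_derivative D) (at z)"
  shows "norm (D h) \<le> L * norm h"
proof (rule field_le_epsilon)
  fix e :: real assume "e > 0"
  have lin: "linear D" using D by (rule has_derivative_linear)
  obtain r where r: "r > 0" "ball z r \<subseteq> S" using \<open>open S\<close> \<open>z \<in> S\<close> openE by blast
  define e' where "e' = e / (norm h + 1)"
  have e': "e' > 0" using \<open>e > 0\<close> by (simp add: e'_def add_nonneg_pos)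
  have "\<exists>d>0. \<forall>y. norm (y - z) < d \<longrightarrow> norm (f y - f z - D (y - z)) \<le> e' * norm (y - z)"
    using D e' unfolding has_derivative_at_alt by blast
  then obtain d where d: "d > 0" "\<And>y. norm (y - z) < d \<Longrightarrow> norm (f y - f z - D (y - z)) \<le> e' * norm (y - z)"
    by blast
  define s where "s = min d r / 2 / (norm h + 1)"
  have nh: "norm h + 1 > 0" by (simp add: add_nonneg_pos)
  have s: "s > 0" using d(1) r(1) nh by (simp add: s_def)
  have "s * norm h \<le> s * (norm h + 1)" using s by simp
  also have "\<dots> = min d r / 2"
  proof -
    have "a / 2 / c * c = a / 2" if "c > 0" for a c :: real using that by simp
    from this[OF nh] show ?thesis by (simp only: s_def)
  qed
  finally have sh: "s * norm h < d" "s * norm h < r" using d(1) r(1) by linarith+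
  define y where "y = z + s *\<^sub>R h"
  have y: "y - z = s *\<^sub>R h" "norm (y - z) = s * norm h" using s by (auto simp: y_def)
  have "y \<in> S" using r(2) sh(2) y(2) by (auto simp: dist_norm norm_minus_commute subset_iff)
  then have 1: "norm (f y - f z) \<le> L * (s * norm h)"
    using lipschitz_onD[OF lip \<open>y \<in> S\<close> \<open>z \<in> S\<close>] y(2) by (simp add: dist_norm)
  have 2: "norm (f y - f z - D (y - z)) \<le> e' * (s * norm h)" using d(2)[of y] y(2) sh(1) by simp
  have "norm (D (y - z)) \<le> norm (f y - f z) + norm (f y - f z - D (y - z))"
    using norm_triangle_ineq4[of "f y - f z" "f y - f z - D (y - z)"] by simp
  also have "\<dots> \<le> L * (s * norm h) + e' * (s * norm h)" using 1 2 by (rule add_mono)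
  also have "norm (D (y - z)) = s * norm (D h)" using s by (simp add: y(1) linear_cmul[OF lin])
  finally have "s * norm (D h) \<le> s * (L * norm h + e' * norm h)" by (simp add: algebra_simps)
  then have "norm (D h) \<le> L * norm h + e' * norm h" using s by simp
  also have "e' * norm h \<le> e' * (norm h + 1)" using e' by simp
  also have "\<dots> = e" using nh by (simp add: e'_def)
  finally show "norm (D h) \<le> L * norm h + e" by simp
qed

lemma hamiltonian2_negativeE:
  assumes "hamiltonian2 T f x p < 0"
  obtains v where "v \<in> family2 T f x" "(SUP w\<in>v. p \<bullet> w) < 0"
proof -
  have "\<exists>v\<in>family2 T f x. (SUP w\<in>v. p \<bullet> w) < 0"
  proof (rule ccontr)
    assume "\<not> ?thesis"
    then have "0 \<le> (INF v\<in>family2 T f x. SUP w\<in>v. p \<bullet> w)"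
      by (intro cINF_greatest) (auto simp: family2_def family1_def not_less)
    then show False using assms by (simp add: hamiltonian2_def)
  qed
  then show ?thesis using that by blast
qed

context fields_on_ball begin

lemma norm_lie_bracket_le:
  assumes "z \<in> ball x0 R" "f i differentiable (at z)" "f j differentiable (at z)"
  shows "norm (lie_bracket (f i) (f j) z) \<le> 2 * L * M"
proof -
  have lipb: "L-lipschitz_on (ball x0 R) (f k)" for k
    by (rule lipschitz_on_subset[OF lip]) auto
  have D: "norm (frechet_derivative (f k) (at z) (f l z)) \<le> L * M" if "f k differentiable (at z)" for k l
  proof -
    have "norm (frechet_derivative (f k) (at z) (f l z)) \<le> L * norm (f l z)"
      by (rule norm_frechet_derivative_le[OF lipb open_ball assms(1)])
        (use that in \<open>simp add: frechet_derivative_works\<close>)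
    also have "\<dots> \<le> L * M" using assms(1) by (intro mult_left_mono bound L_nonneg) auto
    finally show ?thesis .
  qed
  have "norm (lie_bracket (f i) (f j) z) \<le> norm (frechet_derivative (f j) (at z) (f i z)) + norm (frechet_derivative (f i) (at z) (f j z))"
    unfolding lie_bracket_def by (rule norm_triangle_ineq4)
  then show ?thesis using D[OF assms(2), of j] D[OF assms(3), of i] by linarith
qed

text \<open>The supremum in the Hamiltonian is one of reals, so it is an upper bound only because the bracket set is bounded.\<close>

lemma lie_bracket_set_bounded:
  assumes "v \<in> lie_bracket_set (- T) (f i) (f j) x0"
  shows "norm v \<le> 2 * L * M"
proof -
  define S where "S = {v. \<exists>X. (\<forall>k::nat. X k \<in> diff_points (- T) (f i) \<inter> diff_points (- T) (f j)) \<and> X \<longlonglongrightarrow> x0 \<and>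
             (\<lambda>k. lie_bracket (f i) (f j) (X k)) \<longlonglongrightarrow> v}"
  have "S \<subseteq> cball 0 (2 * L * M)"
  proof
    fix v assume "v \<in> S"
    then obtain X where X: "\<And>k. X k \<in> diff_points (- T) (f i) \<inter> diff_points (- T) (f j)" "X \<longlonglongrightarrow> x0"
      "(\<lambda>k. lie_bracket (f i) (f j) (X k)) \<longlonglongrightarrow> v" by (auto simp: S_def)
    have "\<forall>\<^sub>F k in sequentially. X k \<in> ball x0 R"
      by (rule topological_tendstoD[OF X(2)]) (use R in auto)
    then have "\<forall>\<^sub>F k in sequentially. norm (lie_bracket (f i) (f j) (X k)) \<le> 2 * L * M"
    proof eventually_elim
      case (elim k)
      show ?case by (rule norm_lie_bracket_le[OF elim]) (use X(1)[of k] in \<open>auto simp: diff_points_def\<close>)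
    qed
    then have "norm v \<le> 2 * L * M" using tendsto_upperbound[OF tendsto_norm[OF X(3)]] by simp
    then show "v \<in> cball 0 (2 * L * M)" by simp
  qed
  then have "convex hull S \<subseteq> cball 0 (2 * L * M)" by (rule hull_minimal) (rule convex_cball)
  then show ?thesis using assms by (auto simp: lie_bracket_set_def S_def)
qed

text \<open>Otherwise bounded brackets at points tending to \<open>x0\<close> would accumulate at an element of the set-valued bracket on which
  \<open>p0\<close> is too large.\<close>

lemma lie_bracket_negative_near:
  assumes neg: "\<And>v. v \<in> lie_bracket_set (- T) (f i) (f j) x0 \<Longrightarrow> p0 \<bullet> v \<le> - \<kappa>" and "\<kappa> > 0"
  shows "\<exists>\<epsilon>>0. \<forall>z p. dist x0 z < \<epsilon> \<longrightarrow> dist p0 p < \<epsilon> \<longrightarrow> z \<in> diff_points (- T) (f i) \<inter> diff_points (- T) (f j) \<longrightarrow>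
    p \<bullet> lie_bracket (f i) (f j) z \<le> - \<kappa> / 2"
proof (rule ccontr)
  assume contra: "\<not> ?thesis"
  have "\<exists>z p. dist x0 z < min R (inverse (real (Suc k))) \<and> dist p0 p < min R (inverse (real (Suc k))) \<and>
      z \<in> diff_points (- T) (f i) \<inter> diff_points (- T) (f j) \<and> p \<bullet> lie_bracket (f i) (f j) z > - \<kappa> / 2" for k
  proof (rule ccontr)
    let ?e = "min R (inverse (real (Suc k)))"
    assume "\<not> ?thesis"
    then have "\<forall>z p. dist x0 z < ?e \<longrightarrow> dist p0 p < ?e \<longrightarrow> z \<in> diff_points (- T) (f i) \<inter> diff_points (- T) (f j) \<longrightarrow>
        p \<bullet> lie_bracket (f i) (f j) z \<le> - \<kappa> / 2"
      by (meson not_le)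
    moreover have "?e > 0" using R by simp
    ultimately show False using contra by blast
  qed
  then obtain z p where zp: "\<And>k. dist x0 (z k) < min R (inverse (real (Suc k)))" "\<And>k. dist p0 (p k) < min R (inverse (real (Suc k)))"
    "\<And>k. z k \<in> diff_points (- T) (f i) \<inter> diff_points (- T) (f j)" "\<And>k. p k \<bullet> lie_bracket (f i) (f j) (z k) > - \<kappa> / 2"
    by metis
  define b where "b k = lie_bracket (f i) (f j) (z k)" for k
  have conv: "a \<longlonglongrightarrow> a0" if "\<And>k. dist a0 (a k) < min R (inverse (real (Suc k)))" for a :: "nat \<Rightarrow> real^'n" and a0
  proof -
    have "\<forall>\<^sub>F k in sequentially. norm (a k - a0) \<le> inverse (real (Suc k))"
      using that by (auto simp: dist_norm norm_minus_commute less_imp_le intro!: always_eventually)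
    then have "(\<lambda>k. a k - a0) \<longlonglongrightarrow> 0" by (rule Lim_null_comparison[OF _ LIMSEQ_inverse_real_of_nat])
    then show ?thesis by (simp add: LIM_zero_iff)
  qed
  have "norm (b k) \<le> 2 * L * M" for k unfolding b_def
    by (rule norm_lie_bracket_le) (use zp(1,3)[of k] in \<open>auto simp: diff_points_def\<close>)
  then have "bounded (range b)" unfolding bounded_iff by blast
  then obtain v \<sigma> where v: "strict_mono \<sigma>" "(b \<circ> \<sigma>) \<longlonglongrightarrow> v"
    using bounded_imp_convergent_subsequence by blast
  have "(z \<circ> \<sigma>) \<longlonglongrightarrow> x0" "(p \<circ> \<sigma>) \<longlonglongrightarrow> p0"
    using conv[OF zp(1)] conv[OF zp(2)] LIMSEQ_subseq_LIMSEQ v(1) by blast+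
  then have "v \<in> lie_bracket_set (- T) (f i) (f j) x0" unfolding lie_bracket_set_def
    using zp(3) v(2) by (intro hull_inc CollectI exI[of _ "z \<circ> \<sigma>"]) (auto simp: b_def o_def)
  then have "p0 \<bullet> v \<le> - \<kappa>" by (rule neg)
  moreover have "- \<kappa> / 2 \<le> p0 \<bullet> v"
  proof (rule LIMSEQ_le_const)
    show "(\<lambda>k. (p \<circ> \<sigma>) k \<bullet> (b \<circ> \<sigma>) k) \<longlonglongrightarrow> p0 \<bullet> v" by (intro tendsto_inner v(2) \<open>(p \<circ> \<sigma>) \<longlonglongrightarrow> p0\<close>)
    show "\<exists>N. \<forall>k\<ge>N. - \<kappa> / 2 \<le> (p \<circ> \<sigma>) k \<bullet> (b \<circ> \<sigma>) k"
      using zp(4) by (auto simp: b_def less_imp_le)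
  qed
  ultimately show False using \<open>\<kappa> > 0\<close> by simp
qed

text \<open>In the loop the fields are frozen at the initial point \<open>x\<close>, whereas the bracket at \<open>z\<close> evaluates them at \<open>z\<close>; the Lipschitz
  property makes the difference negligible for \<open>x\<close> and \<open>z\<close> close to \<open>x0\<close>.\<close>

lemma bracket_curl_AE:
  assumes neg: "\<And>v. v \<in> lie_bracket_set (- T) (f i) (f j) x0 \<Longrightarrow> p0 \<bullet> v \<le> - \<kappa>" and "\<kappa> > 0"
    and "cball x0 R \<subseteq> - T"
  shows "\<exists>\<epsilon>>0. \<epsilon> \<le> R \<and> (\<forall>x p. dist x0 x < \<epsilon> \<longrightarrow> dist p0 p < \<epsilon> \<longrightarrow>
    (AE z in lborel. z \<in> ball x0 \<epsilon> \<longrightarrow>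
      (\<exists>u' w'. ((\<lambda>z. p \<bullet> ext i z) has_derivative u') (at z) \<and> ((\<lambda>z. p \<bullet> ext j z) has_derivative w') (at z) \<and>
        w' (f i x) - u' (f j x) \<le> - (\<kappa> / 4))))"
proof -
  obtain \<epsilon>1 where \<epsilon>1: "\<epsilon>1 > 0" "\<And>z p. dist x0 z < \<epsilon>1 \<Longrightarrow> dist p0 p < \<epsilon>1 \<Longrightarrow> z \<in> diff_points (- T) (f i) \<inter> diff_points (- T) (f j) \<Longrightarrow>
    p \<bullet> lie_bracket (f i) (f j) z \<le> - \<kappa> / 2"
    using lie_bracket_negative_near[OF neg \<open>\<kappa> > 0\<close>] by blast
  define P where "P = norm p0 + 1"
  have P: "P > 0" by (simp add: P_def add_nonneg_pos)
  define E where "E = P * (4 * (L * L))"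
  have E: "E \<ge> 0" using P L_nonneg by (simp add: E_def)
  define \<epsilon> where "\<epsilon> = min (min R 1) (min \<epsilon>1 (\<kappa> / (4 * (E + 1))))"
  have \<epsilon>: "\<epsilon> > 0" "\<epsilon> \<le> R" "\<epsilon> \<le> 1" "\<epsilon> \<le> \<epsilon>1" using R \<epsilon>1(1) \<open>\<kappa> > 0\<close> E by (auto simp: \<epsilon>_def)
  have E\<epsilon>: "E * \<epsilon> \<le> \<kappa> / 4"
  proof -
    have "\<epsilon> \<le> \<kappa> / (4 * (E + 1))" unfolding \<epsilon>_def by (rule min.coboundedI2, rule min.cobounded2)
    then have "E * \<epsilon> \<le> (E + 1) * (\<kappa> / (4 * (E + 1)))" using E \<epsilon>(1) by (intro mult_mono) auto
    also have "\<dots> = \<kappa> / 4" using E by (simp add: field_simps)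
    finally show ?thesis .
  qed
  have lipb: "L-lipschitz_on (ball x0 R) (f k)" for k by (rule lipschitz_on_subset[OF lip]) auto
  show ?thesis
  proof (intro exI[of _ \<epsilon>] conjI allI impI \<epsilon>(1,2))
    fix x p assume x: "dist x0 x < \<epsilon>" and p: "dist p0 p < \<epsilon>"
    have np: "norm p \<le> P" using p \<epsilon>(3) norm_triangle_sub[of p p0] by (simp add: P_def dist_norm norm_minus_commute)
    show "AE z in lborel. z \<in> ball x0 \<epsilon> \<longrightarrow>
      (\<exists>u' w'. ((\<lambda>z. p \<bullet> ext i z) has_derivative u') (at z) \<and> ((\<lambda>z. p \<bullet> ext j z) has_derivative w') (at z) \<and>
        w' (f i x) - u' (f j x) \<le> - (\<kappa> / 4))"
      using AE_differentiable_lipschitz[OF ext_lipschitz[of i]] AE_differentiable_lipschitz[OF ext_lipschitz[of j]]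
    proof eventually_elim
      case (elim z)
      show ?case
      proof
        assume z: "z \<in> ball x0 \<epsilon>"
        then have zR: "z \<in> ball x0 R" using \<epsilon>(2) by auto
        define A where "A k = frechet_derivative (ext k) (at z)" for k
        have ext_der: "(ext k has_derivative A k) (at z)" "(f k has_derivative A k) (at z)" if "ext k differentiable (at z)" for k
        proof -
          show 1: "(ext k has_derivative A k) (at z)" using that by (simp add: A_def frechet_derivative_works)
          show "(f k has_derivative A k) (at z)"
            by (rule has_derivative_transform_within_open[OF 1 open_ball zR]) (simp add: ext_eq)
        qed
        note i = ext_der[OF elim(1)] note j = ext_der[OF elim(2)]
        have "z \<in> cball x0 R" using zR by simp
        then have "z \<in> - T" using assms(3) by blast
        then have "z \<in> diff_points (- T) (f i) \<inter> diff_points (- T) (f j)"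
          using i(2) j(2) by (auto simp: diff_points_def differentiable_def)
        then have "p \<bullet> lie_bracket (f i) (f j) z \<le> - \<kappa> / 2"
          using z p \<epsilon>(4) by (intro \<epsilon>1(2)) auto
        also have "lie_bracket (f i) (f j) z = A j (f i z) - A i (f j z)"
          unfolding lie_bracket_def using frechet_derivative_at[OF i(2)] frechet_derivative_at[OF j(2)] by simp
        finally have br: "p \<bullet> (A j (f i z) - A i (f j z)) \<le> - \<kappa> / 2" .
        have d: "norm (A k (f l x) - A k (f l z)) \<le> L * (L * (2 * \<epsilon>))" if "(f k has_derivative A k) (at z)" for k l
        proof -
          have "A k (f l x) - A k (f l z) = A k (f l x - f l z)"
            using has_derivative_linear[OF that] by (simp add: linear_diff)
          also have "norm \<dots> \<le> L * norm (f l x - f l z)"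
            by (rule norm_frechet_derivative_le[OF lipb open_ball zR that])
          also have "\<dots> \<le> L * (L * dist x z)"
            using lipschitz_onD[OF lip, of x z] x zR \<epsilon>(2) by (intro mult_left_mono L_nonneg) (auto simp: dist_norm)
          also have "\<dots> \<le> L * (L * (2 * \<epsilon>))"
            using dist_triangle3[of x z x0] x z by (intro mult_left_mono L_nonneg) (auto simp: dist_commute)
          finally show ?thesis .
        qed
        define \<Delta> where "\<Delta> = (A j (f i x) - A j (f i z)) - (A i (f j x) - A i (f j z))"
        have "norm \<Delta> \<le> 2 * (L * (L * (2 * \<epsilon>)))"
          unfolding \<Delta>_def using norm_triangle_ineq4[of "A j (f i x) - A j (f i z)" "A i (f j x) - A i (f j z)"] d[OF i(2), of j] d[OF j(2), of i] by linarith
        then have "norm p * norm \<Delta> \<le> P * (2 * (L * (L * (2 * \<epsilon>))))"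
          using np by (intro mult_mono) (use P in auto)
        also have "\<dots> = E * \<epsilon>" by (simp add: E_def)
        finally have "p \<bullet> \<Delta> \<le> \<kappa> / 4" using norm_cauchy_schwarz[of p \<Delta>] E\<epsilon> by linarith
        moreover have "p \<bullet> A j (f i x) - p \<bullet> A i (f j x) = p \<bullet> (A j (f i z) - A i (f j z)) + p \<bullet> \<Delta>"
          by (simp add: \<Delta>_def inner_diff_right)
        ultimately have "p \<bullet> A j (f i x) - p \<bullet> A i (f j x) \<le> - (\<kappa> / 4)" using br by linarith
        moreover have "((\<lambda>z. p \<bullet> ext i z) has_derivative (\<lambda>h. p \<bullet> A i h)) (at z)"
          "((\<lambda>z. p \<bullet> ext j z) has_derivative (\<lambda>h. p \<bullet> A j h)) (at z)"
          by (intro has_derivative_inner_right i(1) j(1))+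
        ultimately show "\<exists>u' w'. ((\<lambda>z. p \<bullet> ext i z) has_derivative u') (at z) \<and> ((\<lambda>z. p \<bullet> ext j z) has_derivative w') (at z) \<and>
          w' (f i x) - u' (f j x) \<le> - (\<kappa> / 4)" by blast
      qed
    qed
  qed
qed

text \<open>Steps must not become arbitrarily short: otherwise infinitely many of them might fit into a finite time.\<close>

lemma wait:
  assumes t: "0 < t" "L * t < 1" "t \<le> 1" and inside: "dist x0 x + M * t \<le> R"
  obtains \<theta> where "1 \<le> \<theta>" "\<theta> \<le> 4" "reach f \<theta> (cball x (M * t)) x x"
proof -
  obtain z where z: "reach f t (cball x (M * t)) x z"
    by (rule single_field_step[OF axis_in_control_set(1)[of undefined] less_imp_le[OF t(1)] t(2) inside])
  define n where "n = nat \<lceil>1 / (2 * t)\<rceil>"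
  have n: "1 / (2 * t) \<le> real n" "real n \<le> 1 / (2 * t) + 1" using t(1) by (auto simp: n_def)
  have "1 \<le> real n * (2 * t)" using n(1) t(1) by (simp add: field_simps)
  moreover have "real n * (2 * t) \<le> (1 / (2 * t) + 1) * (2 * t)" using n(2) t(1) by (intro mult_right_mono) auto
  moreover have "(1 / (2 * t) + 1) * (2 * t) = 1 + 2 * t" using t(1) by (simp add: field_simps)
  ultimately have "1 \<le> real n * (2 * t)" "real n * (2 * t) \<le> 4" using t(3) by linarith+
  moreover have "reach f (real n * (2 * t)) (cball x (M * t)) x x"
    by (rule reach_back_and_forth[OF z]) (use t M_nonneg in simp)
  ultimately show ?thesis using that by blast
qed

text \<open>Both kinds of negative direction are brought to one form, a gain of order \<open>t\<^sup>2\<close> that is uniform in the initial point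
  and in the covector. In the first-order case the gain is even of order \<open>t\<close>, and in the second-order case the
  displacement is of order \<open>t\<^sup>2\<close>, so that the semiconcavity error is harmless in both.\<close>

lemma local_decrease:
  assumes sub: "cball x0 R \<subseteq> - T" and ham: "hamiltonian2 T f x0 p0 < 0" and "\<rho> \<ge> 0"
  shows "\<exists>\<epsilon>>0. \<exists>\<tau>>0. \<exists>c>0. \<forall>x p t. dist x0 x < \<epsilon> \<longrightarrow> dist p0 p < \<epsilon> \<longrightarrow> 0 < t \<longrightarrow> t < \<tau> \<longrightarrow>
    (\<exists>\<theta> z. 1 \<le> \<theta> \<and> \<theta> \<le> 8 \<and> reach f \<theta> (cball x (4 * M * t)) x z \<and> p \<bullet> (z - x) + \<rho> * (norm (z - x))\<^sup>2 \<le> - c * t\<^sup>2)"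
proof -
  note M = M_nonneg note L = L_nonneg
  define P where "P = norm p0 + 1"
  have P: "P > 0" by (simp add: P_def add_nonneg_pos)
  have nP: "norm p \<le> P" if "dist p0 p < 1" for p
    using that norm_triangle_sub[of p p0] by (simp add: P_def dist_norm norm_minus_commute)
  have x0: "x0 \<in> cball x0 R" using R by simp
  \<comment> \<open>Short enough for the flows to exist and for all trajectories to stay in the ball.\<close>
  define \<tau>0 where "\<tau>0 = min 1 (min (1 / (L + 1)) (R / (16 * (M + 1))))"
  have \<tau>0: "\<tau>0 > 0" using L M R by (simp add: \<tau>0_def add_nonneg_pos)
  have small: "t \<le> 1" "L * t < 1" "8 * (M * t) \<le> R / 2" if t: "0 < t" "t < \<tau>0" for t
  proof -
    show "t \<le> 1" using t by (simp add: \<tau>0_def)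
    have "L * t \<le> (L + 1) * t" using t by simp
    also have "\<dots> < (L + 1) * (1 / (L + 1))" using t L by (intro mult_strict_left_mono) (auto simp: \<tau>0_def)
    also have "\<dots> = 1" using L by simp
    finally show "L * t < 1" .
    have tM: "t \<le> R / (16 * (M + 1))" using t by (simp add: \<tau>0_def)
    have "8 * (M * t) \<le> 8 * ((M + 1) * t)" using t by simp
    also have "\<dots> \<le> 8 * ((M + 1) * (R / (16 * (M + 1))))" using tM M by (intro mult_left_mono) auto
    also have "\<dots> = R / 2" using M by (simp add: field_simps)
    finally show "8 * (M * t) \<le> R / 2" .
  qed
  have wait: "\<exists>\<theta>. 1 \<le> \<theta> \<and> \<theta> \<le> 4 \<and> reach f \<theta> (cball x (4 * M * t)) x x"
    if t: "0 < t" "t < \<tau>0" and x: "dist x0 x < R / 2" for x t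
  proof -
    have Mt: "0 \<le> M * t" using M t by simp
    obtain \<theta> where "1 \<le> \<theta>" "\<theta> \<le> 4" "reach f \<theta> (cball x (M * t)) x x"
      using wait[OF t(1) small(2)[OF t] small(1)[OF t], of x] small(3)[OF t] x Mt by auto
    moreover have "cball x (M * t) \<subseteq> cball x (4 * M * t)" using Mt by (intro subset_cball) simp
    ultimately show ?thesis using reach_mono by blast
  qed
  obtain v where v: "v \<in> family2 T f x0" "(SUP w\<in>v. p0 \<bullet> w) < 0" by (rule hamiltonian2_negativeE[OF ham])
  consider l where "v = {f l x0}" | l where "v = {- f l x0}" | i j where "v = lie_bracket_set (- T) (f i) (f j) x0"
    using v(1) unfolding family2_def family1_def by blast
  then consider (field) c where "c \<in> control_set" "p0 \<bullet> control_field f c x0 < 0"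
    | (bracket) i j where "v = lie_bracket_set (- T) (f i) (f j) x0"
  proof cases
    case (1 l) then show ?thesis using v(2) field[of "axis l 1"] by simp
  next
    case (2 l) then show ?thesis using v(2) field[of "- axis l 1"] by simp
  qed blast
  then show ?thesis
  proof cases
    case (field k)
    define F where "F = control_field f k"
    define c where "c = - (p0 \<bullet> F x0) / 2"
    have c: "c > 0" using field(2) by (simp add: c_def F_def)
    have FM: "norm (F z) \<le> M" if "z \<in> cball x0 R" for z
      unfolding F_def using norm_control_field_le[of k f z M] field(1) bound[OF that] by blast
    have FL: "norm (F x - F x0) \<le> L * dist x0 x" if "x \<in> cball x0 R" for x
    proof -
      have "F z = control_field ext k z" if "z \<in> cball x0 R" for z
        using that by (simp add: F_def control_field_def ext_eq)
      then show ?thesis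
        using lipschitz_onD[OF control_field_ext_lipschitz[OF field(1)], of x x0] that x0 by (simp add: dist_norm norm_minus_commute)
    qed
    define \<epsilon> where "\<epsilon> = min (min 1 (R / 2)) (c / (M + norm p0 * L + 1))"
    have den: "M + norm p0 * L + 1 > 0" using M L by (simp add: add_nonneg_pos)
    have \<epsilon>: "\<epsilon> > 0" using R c den by (simp add: \<epsilon>_def)
    have \<epsilon>c: "\<epsilon> * M + norm p0 * (L * \<epsilon>) \<le> c"
    proof -
      have "\<epsilon> \<le> c / (M + norm p0 * L + 1)" by (simp add: \<epsilon>_def)
      then have "\<epsilon> * (M + norm p0 * L + 1) \<le> c" using den by (simp add: pos_le_divide_eq)
      then show ?thesis using \<epsilon> by (simp add: algebra_simps)
    qed
    \<comment> \<open>Coefficient of the errors of higher order; likewise in the second case.\<close>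
    define E where "E = P * (L * M) + \<rho> * M\<^sup>2"
    have E: "E \<ge> 0" using P L M \<open>\<rho> \<ge> 0\<close> by (simp add: E_def)
    define \<tau> where "\<tau> = min \<tau>0 (c / (2 * (E + 1)))"
    have \<tau>: "\<tau> > 0" using \<tau>0 c E by (simp add: \<tau>_def add_nonneg_pos)
    show ?thesis
    proof (rule exI[of _ \<epsilon>], rule conjI[OF \<epsilon>], rule exI[of _ \<tau>], rule conjI[OF \<tau>], rule exI[of _ "c / 2"],
        intro conjI allI impI)
      show "c / 2 > 0" using c by simp
      fix x p t assume x: "dist x0 x < \<epsilon>" and p: "dist p0 p < \<epsilon>" and t: "0 < t" "t < \<tau>"
      have t0: "t < \<tau>0" "t < c / (2 * (E + 1))" using t by (auto simp: \<tau>_def)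
      note s = small[OF t(1) t0(1)]
      have Mt: "0 \<le> M * t" using M t by simp
      have xR: "dist x0 x < R / 2" using x by (simp add: \<epsilon>_def)
      then have xin: "x \<in> cball x0 R" using R by simp
      obtain \<theta> where \<theta>: "1 \<le> \<theta>" "\<theta> \<le> 4" "reach f \<theta> (cball x (4 * M * t)) x x" using wait[OF t(1) t0(1) xR] by blast
      obtain z where z: "reach f t (cball x (M * t)) x z" "norm (z - (x + t *\<^sub>R F x)) \<le> L * M * t\<^sup>2" "norm (z - x) \<le> M * t"
        unfolding F_def using single_field_step[OF field(1) less_imp_le[OF t(1)] s(2), of x] s(3) xR Mt by auto
      have "cball x (M * t) \<subseteq> cball x (4 * M * t)" using Mt by (intro subset_cball) simp
      then have "reach f (\<theta> + t) (cball x (4 * M * t)) x z" using reach_trans[OF \<theta>(3) reach_mono[OF z(1)]] by blast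
      moreover have "p \<bullet> (z - x) + \<rho> * (norm (z - x))\<^sup>2 \<le> - (c / 2) * t\<^sup>2"
      proof -
        have "p \<bullet> F x = p0 \<bullet> F x0 + ((p - p0) \<bullet> F x + p0 \<bullet> (F x - F x0))"
          by (simp add: inner_diff_left inner_diff_right)
        moreover have "(p - p0) \<bullet> F x \<le> \<epsilon> * M"
        proof -
          have "(p - p0) \<bullet> F x \<le> norm (p - p0) * norm (F x)" by (rule norm_cauchy_schwarz)
          also have "\<dots> \<le> \<epsilon> * M" using p FM[OF xin] \<epsilon> by (intro mult_mono) (auto simp: dist_norm norm_minus_commute)
          finally show ?thesis .
        qed
        moreover have "p0 \<bullet> (F x - F x0) \<le> norm p0 * (L * \<epsilon>)"
        proof -
          have "p0 \<bullet> (F x - F x0) \<le> norm p0 * norm (F x - F x0)" by (rule norm_cauchy_schwarz)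
          also have "\<dots> \<le> norm p0 * (L * \<epsilon>)"
            using order_trans[OF FL[OF xin] mult_left_mono[OF less_imp_le[OF x] L]] by (intro mult_left_mono) auto
          finally show ?thesis .
        qed
        ultimately have pF: "p \<bullet> F x \<le> - c" using \<epsilon>c by (simp add: c_def)
        have "p \<bullet> (z - x) = t * (p \<bullet> F x) + p \<bullet> (z - (x + t *\<^sub>R F x))"
          by (simp add: inner_diff_right inner_add_right)
        also have "\<dots> \<le> t * (- c) + P * (L * M * t\<^sup>2)"
        proof (rule add_mono)
          show "t * (p \<bullet> F x) \<le> t * (- c)" using pF t by (intro mult_left_mono) auto
          have "p \<bullet> (z - (x + t *\<^sub>R F x)) \<le> norm p * norm (z - (x + t *\<^sub>R F x))" by (rule norm_cauchy_schwarz)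
          also have "\<dots> \<le> P * (L * M * t\<^sup>2)" using z(2) nP[of p] p P by (intro mult_mono) (auto simp: \<epsilon>_def)
          finally show "p \<bullet> (z - (x + t *\<^sub>R F x)) \<le> P * (L * M * t\<^sup>2)" .
        qed
        finally have 1: "p \<bullet> (z - x) \<le> - c * t + P * (L * M * t\<^sup>2)" by (simp add: mult.commute)
        have "(norm (z - x))\<^sup>2 \<le> (M * t)\<^sup>2" using z(3) by (intro power_mono) auto
        then have 2: "\<rho> * (norm (z - x))\<^sup>2 \<le> \<rho> * (M * t)\<^sup>2" using \<open>\<rho> \<ge> 0\<close> by (rule mult_left_mono)
        have 3: "p \<bullet> (z - x) + \<rho> * (norm (z - x))\<^sup>2 \<le> - c * t + E * t\<^sup>2"
          using 1 2 by (simp add: E_def power_mult_distrib algebra_simps)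
        have 4: "E * t\<^sup>2 \<le> (c / 2) * t"
        proof -
          have "E * t \<le> (E + 1) * (c / (2 * (E + 1)))" using t t0(2) E by (intro mult_mono) auto
          also have "\<dots> = c / 2" using E by (simp add: field_simps)
          finally have "E * t * t \<le> c / 2 * t" using t by (intro mult_right_mono) auto
          then show ?thesis by (simp add: power2_eq_square mult.assoc)
        qed
        have 5: "(c / 2) * t\<^sup>2 \<le> (c / 2) * t"
        proof -
          have "t * t \<le> t * 1" using t s(1) by (intro mult_left_mono) auto
          then have "(c / 2) * (t * t) \<le> (c / 2) * t" using c by (intro mult_left_mono) auto
          then show ?thesis by (simp add: power2_eq_square)
        qed
        have "- c * t + (c / 2) * t = - ((c / 2) * t)" by simp
        then show ?thesis using 3 4 5 by linarith
      qed
      ultimately show "\<exists>\<theta> z. 1 \<le> \<theta> \<and> \<theta> \<le> 8 \<and> reach f \<theta> (cball x (4 * M * t)) x z \<and>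
          p \<bullet> (z - x) + \<rho> * (norm (z - x))\<^sup>2 \<le> - (c / 2) * t\<^sup>2"
        using \<theta>(1,2) t(1) s(1) by (intro exI[of _ "\<theta> + t"] exI[of _ z]) auto
    qed
  next
    case (bracket i j)
    define S where "S = (SUP w\<in>v. p0 \<bullet> w)"
    have "bdd_above ((\<lambda>w. p0 \<bullet> w) ` v)"
    proof (rule bdd_aboveI2)
      fix w assume "w \<in> v"
      then have "norm w \<le> 2 * L * M" using lie_bracket_set_bounded bracket by blast
      then have "norm p0 * norm w \<le> norm p0 * (2 * L * M)" by (intro mult_left_mono) auto
      then show "p0 \<bullet> w \<le> norm p0 * (2 * L * M)" using norm_cauchy_schwarz[of p0 w] by linarith
    qed
    then have neg: "p0 \<bullet> w \<le> - (- S)" if "w \<in> lie_bracket_set (- T) (f i) (f j) x0" for w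
      using cSUP_upper[of w v "\<lambda>w. p0 \<bullet> w"] that bracket by (simp add: S_def)
    define \<kappa> where "\<kappa> = - S"
    have \<kappa>: "\<kappa> > 0" using v(2) by (simp add: \<kappa>_def S_def)
    obtain \<epsilon>1 where \<epsilon>1: "\<epsilon>1 > 0" "\<epsilon>1 \<le> R" "\<And>x p. dist x0 x < \<epsilon>1 \<Longrightarrow> dist p0 p < \<epsilon>1 \<Longrightarrow>
      (AE z in lborel. z \<in> ball x0 \<epsilon>1 \<longrightarrow>
      (\<exists>u' w'. ((\<lambda>z. p \<bullet> ext i z) has_derivative u') (at z) \<and> ((\<lambda>z. p \<bullet> ext j z) has_derivative w') (at z) \<and>
        w' (f i x) - u' (f j x) \<le> - (\<kappa> / 4)))"
      using bracket_curl_AE[OF neg _ sub] \<kappa> unfolding \<kappa>_def by blast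
    define \<epsilon> where "\<epsilon> = min 1 (\<epsilon>1 / 2)"
    have \<epsilon>: "\<epsilon> > 0" "\<epsilon> \<le> 1" "\<epsilon> \<le> \<epsilon>1 / 2" using \<epsilon>1(1) by (auto simp: \<epsilon>_def)
    define E where "E = 40 * P * L\<^sup>2 * M + \<rho> * (10 * L * M)\<^sup>2"
    have E: "E \<ge> 0" using P L M \<open>\<rho> \<ge> 0\<close> by (simp add: E_def)
    define \<tau> where "\<tau> = min \<tau>0 (min (\<kappa> / (8 * (E + 1))) (\<epsilon>1 / (8 * (M + 1))))"
    have \<tau>: "\<tau> > 0" using \<tau>0 \<kappa> E M \<epsilon>1(1) by (simp add: \<tau>_def add_nonneg_pos)
    show ?thesis
    proof (rule exI[of _ \<epsilon>], rule conjI[OF \<epsilon>(1)], rule exI[of _ \<tau>], rule conjI[OF \<tau>], rule exI[of _ "\<kappa> / 8"],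
        intro conjI allI impI)
      show "\<kappa> / 8 > 0" using \<kappa> by simp
      fix x p t assume x: "dist x0 x < \<epsilon>" and p: "dist p0 p < \<epsilon>" and t: "0 < t" "t < \<tau>"
      have t0: "t < \<tau>0" "t \<le> \<kappa> / (8 * (E + 1))" "t \<le> \<epsilon>1 / (8 * (M + 1))" using t by (auto simp: \<tau>_def)
      note s = small[OF t(1) t0(1)]
      have Mt: "4 * M * t \<le> \<epsilon>1 / 2"
      proof -
        have "4 * M * t \<le> 4 * (M + 1) * (\<epsilon>1 / (8 * (M + 1)))" using M t t0(3) by (intro mult_mono) auto
        also have "\<dots> = \<epsilon>1 / 2" using M by (simp add: field_simps)
        finally show ?thesis .
      qed
      have "dist x0 x < \<epsilon>1" "dist p0 p < \<epsilon>1" using x p \<epsilon> \<epsilon>1(1) by auto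
      note curl = \<epsilon>1(3)[OF this]
      have ins: "dist x0 x + 4 * M * t < \<epsilon>1" using x \<epsilon>(3) Mt by linarith
      obtain z where z: "reach f (4 * t) (cball x (4 * M * t)) x z"
        "p \<bullet> (z - x) \<le> - (\<kappa> / 4) * t\<^sup>2 + 40 * norm p * L\<^sup>2 * M * t ^ 3" "norm (z - x) \<le> 10 * L * M * t\<^sup>2"
        by (rule bracket_loop_step[OF t(1) s(2) ins \<epsilon>1(2) curl]) auto
      have xR: "dist x0 x < R / 2" using x \<epsilon>(3) \<epsilon>1(2) by linarith
      obtain \<theta> where \<theta>: "1 \<le> \<theta>" "\<theta> \<le> 4" "reach f \<theta> (cball x (4 * M * t)) x x" using wait[OF t(1) t0(1) xR] by blast
      have "p \<bullet> (z - x) + \<rho> * (norm (z - x))\<^sup>2 \<le> - (\<kappa> / 8) * t\<^sup>2"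
      proof -
        have "40 * norm p * L\<^sup>2 * M * t ^ 3 \<le> 40 * P * L\<^sup>2 * M * t ^ 3"
          using nP[of p] p \<epsilon>(2) M t by (intro mult_right_mono) auto
        moreover have "\<rho> * (norm (z - x))\<^sup>2 \<le> \<rho> * (10 * L * M)\<^sup>2 * t ^ 3"
        proof -
          have "(norm (z - x))\<^sup>2 \<le> (10 * L * M * t\<^sup>2)\<^sup>2" using z(3) by (intro power_mono) auto
          also have "\<dots> = (10 * L * M)\<^sup>2 * t ^ 4" by (simp add: power_mult_distrib flip: power_mult)
          also have "\<dots> \<le> (10 * L * M)\<^sup>2 * t ^ 3" using t s(1) by (intro mult_left_mono power_decreasing) auto
          finally show ?thesis using \<open>\<rho> \<ge> 0\<close> by (simp add: mult_left_mono mult.assoc)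
        qed
        ultimately have 1: "p \<bullet> (z - x) + \<rho> * (norm (z - x))\<^sup>2 \<le> - (\<kappa> / 4) * t\<^sup>2 + E * t ^ 3"
          using z(2) by (simp add: E_def distrib_right)
        have 2: "E * t ^ 3 \<le> \<kappa> / 8 * t\<^sup>2"
        proof -
          have "E * t \<le> (E + 1) * (\<kappa> / (8 * (E + 1)))" using t t0(2) E by (intro mult_mono) auto
          also have "\<dots> = \<kappa> / 8" using E by (simp add: field_simps)
          finally have "E * t * t\<^sup>2 \<le> \<kappa> / 8 * t\<^sup>2" using t by (intro mult_right_mono) auto
          then show ?thesis by (simp add: power2_eq_square power3_eq_cube mult.assoc)
        qed
        have "- (\<kappa> / 4) * t\<^sup>2 + \<kappa> / 8 * t\<^sup>2 = - (\<kappa> / 8) * t\<^sup>2" by simp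
        then show ?thesis using 1 2 by linarith
      qed
      then show "\<exists>\<theta> z. 1 \<le> \<theta> \<and> \<theta> \<le> 8 \<and> reach f \<theta> (cball x (4 * M * t)) x z \<and>
          p \<bullet> (z - x) + \<rho> * (norm (z - x))\<^sup>2 \<le> - (\<kappa> / 8) * t\<^sup>2"
        using reach_trans[OF \<theta>(3) z(1)] \<theta>(1,2) t(1) s(1) by (intro exI[of _ "\<theta> + 4 * t"] exI[of _ z]) auto
    qed
  qed
qed

end

section \<open>Infinite concatenation of trajectories\<close>

lemma absolutely_continuous_if_lipschitz:
  assumes "M-lipschitz_on {a..b} y"
  shows "absolutely_continuous_on_interval a b y"
  unfolding absolutely_continuous_on_interval_def
proof (intro allI impI)
  fix \<epsilon> :: real assume "\<epsilon> > 0"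
  have M: "0 \<le> M" using lipschitz_on_nonneg[OF assms] .
  show "\<exists>\<delta>>0. \<forall>I. finite I \<and> (\<forall>(u, v)\<in>I. a \<le> u \<and> u \<le> v \<and> v \<le> b) \<and>
        disjoint_family_on (\<lambda>(u, v). {u<..<v}) I \<and> (\<Sum>(u, v)\<in>I. v - u) < \<delta>
        \<longrightarrow> (\<Sum>(u, v)\<in>I. norm (y v - y u)) < \<epsilon>"
  proof (intro exI[of _ "\<epsilon> / (M + 1)"] conjI allI impI)
    show "\<epsilon> / (M + 1) > 0" using \<open>\<epsilon> > 0\<close> M by (simp add: add_nonneg_pos)
    fix I :: "(real \<times> real) set"
    assume "finite I \<and> (\<forall>(u, v)\<in>I. a \<le> u \<and> u \<le> v \<and> v \<le> b) \<and>
        disjoint_family_on (\<lambda>(u, v). {u<..<v}) I \<and> (\<Sum>(u, v)\<in>I. v - u) < \<epsilon> / (M + 1)"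
    then have I: "\<forall>(u, v)\<in>I. a \<le> u \<and> u \<le> v \<and> v \<le> b" "(\<Sum>(u, v)\<in>I. v - u) < \<epsilon> / (M + 1)"
      by auto
    have "(\<Sum>(u, v)\<in>I. norm (y v - y u)) \<le> (\<Sum>(u, v)\<in>I. M * (v - u))"
    proof (intro sum_mono, clarify)
      fix u v assume "(u, v) \<in> I"
      then have "a \<le> u" "u \<le> v" "v \<le> b" using I by auto
      then show "norm (y v - y u) \<le> M * (v - u)"
        using lipschitz_onD[OF assms, of v u] by (simp add: dist_norm)
    qed
    also have "\<dots> = M * (\<Sum>(u, v)\<in>I. v - u)" by (simp add: sum_distrib_left case_prod_beta)
    also have "\<dots> \<le> M * (\<epsilon> / (M + 1))" using I(2) M by (intro mult_left_mono) auto
    also have "\<dots> < (M + 1) * (\<epsilon> / (M + 1))" using \<open>\<epsilon> > 0\<close> M by (intro mult_strict_right_mono) auto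
    also have "\<dots> = \<epsilon>" using M by simp
    finally show "(\<Sum>(u, v)\<in>I. norm (y v - y u)) < \<epsilon>" .
  qed
qed

text \<open>Each stage extends the previous one and the durations tend to infinity, so every time is decided at a finite stage. The exceptional
  times of all stages together are countable, and a uniform speed bound gives absolute continuity.\<close>

lemma trajectory_limit:
  fixes f :: "'m::finite \<Rightarrow> real^'n \<Rightarrow> real^'n"
  assumes tr: "\<And>n. trajectory f (\<theta> n) (y n) (\<alpha> n)"
    and \<theta>: "\<And>n. real n \<le> \<theta> n" "\<And>n. \<theta> n \<le> \<theta> (Suc n)"
    and ext: "\<And>n t. 0 \<le> t \<Longrightarrow> t \<le> \<theta> n \<Longrightarrow> y (Suc n) t = y n t"
      "\<And>n t. 0 \<le> t \<Longrightarrow> t < \<theta> n \<Longrightarrow> \<alpha> (Suc n) t = \<alpha> n t"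
    and bd: "\<And>n t i. 0 \<le> t \<Longrightarrow> t \<le> \<theta> n \<Longrightarrow> norm (f i (y n t)) \<le> M"
  obtains Y A where "\<And>n t. 0 \<le> t \<Longrightarrow> t \<le> \<theta> n \<Longrightarrow> Y t = y n t"
    and "A \<in> borel_measurable (lebesgue_on {0..})" "\<And>t. A t \<in> control_set" "solves_system_on f A \<infinity> Y"
proof -
  have \<theta>mono: "\<theta> m \<le> \<theta> n" if "m \<le> n" for m n
    using lift_Suc_mono_le[of \<theta>, OF \<theta>(2) that] .
  have yext: "y (m + k) t = y m t" if "0 \<le> t" "t \<le> \<theta> m" for m k t
  proof (induction k)
    case (Suc k)
    have "t \<le> \<theta> (m + k)" using that \<theta>mono[of m "m + k"] by simp
    then show ?case using ext(1)[OF that(1)] Suc by simp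
  qed simp
  have aext: "\<alpha> (m + k) t = \<alpha> m t" if "0 \<le> t" "t < \<theta> m" for m k t
  proof (induction k)
    case (Suc k)
    have "t < \<theta> (m + k)" using that \<theta>mono[of m "m + k"] by simp
    then show ?case using ext(2)[OF that(1)] Suc by simp
  qed simp
  have yeq: "y m t = y n t" if "0 \<le> t" "t \<le> \<theta> m" "t \<le> \<theta> n" for m n t
    using yext[OF that(1,2), of "n - m"] yext[OF that(1,3), of "m - n"] by (cases "m \<le> n") auto
  have aeq: "\<alpha> m t = \<alpha> n t" if "0 \<le> t" "t < \<theta> m" "t < \<theta> n" for m n t
    using aext[OF that(1,2), of "n - m"] aext[OF that(1,3), of "m - n"] by (cases "m \<le> n") auto
  define K where "K t = nat \<lceil>t\<rceil>" for t :: real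
  have K: "t \<le> \<theta> (K t)" "t < \<theta> (Suc (K t))" if "0 \<le> t" for t
  proof -
    have "t \<le> real (K t)" unfolding K_def using that by linarith
    then show "t \<le> \<theta> (K t)" "t < \<theta> (Suc (K t))" using \<theta>(1)[of "K t"] \<theta>(1)[of "Suc (K t)"] by auto
  qed
  define Y where "Y t = y (K t) t" for t
  define A where "A t = \<alpha> (Suc (K t)) t" for t
  have Y: "Y t = y n t" if "0 \<le> t" "t \<le> \<theta> n" for n t
    unfolding Y_def by (rule yeq[OF that(1) K(1)[OF that(1)] that(2)])
  have A: "A t = \<alpha> n t" if "0 \<le> t" "t < \<theta> n" for n t
    unfolding A_def by (rule aeq[OF that(1) K(2)[OF that(1)] that(2)])
  have "A \<in> borel_measurable (lebesgue_on {0..})"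
  proof (rule borel_measurable_LIMSEQ_metric)
    fix n
    have "\<alpha> n \<in> borel_measurable borel" using tr[of n] by (simp add: trajectory_def)
    then show "\<alpha> n \<in> borel_measurable (lebesgue_on {0..})"
      by (intro measurable_restrict_space1 measurable_completion) simp
  next
    fix t :: real assume "t \<in> space (lebesgue_on {0..})"
    then have t: "0 \<le> t" by simp
    have "\<forall>\<^sub>F n in sequentially. A t = \<alpha> n t"
    proof (rule eventually_sequentiallyI)
      fix n assume "Suc (K t) \<le> n"
      then have "t < \<theta> n" using K(2)[OF t] \<theta>mono[of "Suc (K t)" n] by simp
      then show "A t = \<alpha> n t" by (rule A[OF t])
    qed
    then show "(\<lambda>n. \<alpha> n t) \<longlonglongrightarrow> A t" by (rule Lim_transform_eventually[OF tendsto_const])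
  qed
  moreover have "A t \<in> control_set" for t using tr unfolding A_def trajectory_def by blast
  moreover have "solves_system_on f A \<infinity> Y" unfolding solves_system_on_def
  proof (intro conjI allI impI)
    fix b :: real assume "0 \<le> b"
    have "M-lipschitz_on {0..\<theta> (K b)} (y (K b))"
      by (rule trajectory_lipschitz[OF tr]) (use bd in auto)
    then have "M-lipschitz_on {0..b} (y (K b))" by (rule lipschitz_on_subset) (use K(1)[OF \<open>0 \<le> b\<close>] in auto)
    then have "M-lipschitz_on {0..b} Y"
      by (rule lipschitz_on_transform) (use Y[of _ "K b"] K(1)[OF \<open>0 \<le> b\<close>] in auto)
    then show "absolutely_continuous_on_interval 0 b Y" by (rule absolutely_continuous_if_lipschitz)
  next
    have "\<forall>n. \<exists>N. finite N \<and> (\<forall>t\<in>{0<..<\<theta> n} - N. (y n has_vector_derivative control_field f (\<alpha> n t) (y n t)) (at t))"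
      using tr unfolding trajectory_def by blast
    then obtain N where N: "\<And>n. finite (N n)"
      "\<And>n t. t \<in> {0<..<\<theta> n} - N n \<Longrightarrow> (y n has_vector_derivative control_field f (\<alpha> n t) (y n t)) (at t)"
      by metis
    define Z where "Z = insert 0 (\<Union>n. N n)"
    have "countable Z" unfolding Z_def using N(1) by (auto intro: countable_finite)
    then have "Z \<in> null_sets lebesgue" by (intro null_sets_completionI countable_imp_null_set_lborel)
    then have "AE t in lebesgue. t \<notin> Z" by (rule AE_not_in)
    then show "AE t in lebesgue. 0 \<le> t \<and> ereal t < \<infinity> \<longrightarrow>
        (Y has_vector_derivative (\<Sum>i\<in>UNIV. (A t $ i) *\<^sub>R f i (Y t))) (at t within {s. 0 \<le> s \<and> ereal s < \<infinity>})"
    proof eventually_elim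
      case (elim t)
      show ?case
      proof (intro impI, elim conjE)
        assume "0 \<le> t"
        then have t: "0 < t" using elim by (auto simp: Z_def order_le_less)
        let ?n = "Suc (K t)"
        have tn: "t < \<theta> ?n" using K(2) t by simp
        have "(y ?n has_vector_derivative control_field f (\<alpha> ?n t) (y ?n t)) (at t)"
          using N(2)[of t ?n] t tn elim by (auto simp: Z_def)
        then have "(Y has_vector_derivative control_field f (\<alpha> ?n t) (y ?n t)) (at t)"
          by (rule has_vector_derivative_transform_within_open[of _ _ _ "{0<..<\<theta> ?n}"]) (use t tn Y[of _ ?n] in auto)
        then have "(Y has_vector_derivative control_field f (A t) (Y t)) (at t)"
          using Y[of t ?n] A[of t ?n] t tn by simp
        then show "(Y has_vector_derivative (\<Sum>i\<in>UNIV. (A t $ i) *\<^sub>R f i (Y t))) (at t within {s. 0 \<le> s \<and> ereal s < \<infinity>})"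
          unfolding control_field_def by (rule has_vector_derivative_at_within)
      qed
    qed
  qed
  ultimately show ?thesis using that Y by blast
qed

section \<open>Global asymptotic controllability\<close>

lemma reach_in:
  assumes "reach f \<theta> W x z" shows "x \<in> W" "z \<in> W"
  using assms by (auto simp: reach_def trajectory_def image_subset_iff)

locale degree2_controlled =
  fixes T :: "(real^'n) set" and f :: "'m::finite \<Rightarrow> real^'n \<Rightarrow> real^'n" and U :: "real^'n \<Rightarrow> real"
  assumes nonempty: "T \<noteq> {}" and closed: "closed T" and compact_frontier: "compact (frontier T)"
    and fields: "\<And>\<Omega> i. open \<Omega> \<Longrightarrow> bounded \<Omega> \<Longrightarrow> bounded_lipschitz_on (\<Omega> - T) (f i)"
    and clf: "degree2_clf T f U"
begin

lemma open_off: "open (- T)" using closed by (simp add: open_Compl)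

lemma U_cont: "continuous_on (closure (- T)) U" using clf by (simp add: degree2_clf_def)

lemma U_pos: "x \<notin> T \<Longrightarrow> U x > 0" using clf by (simp add: degree2_clf_def positive_definite_off_def)

lemma frontier_iff: "x \<in> closure (- T) \<Longrightarrow> x \<in> frontier T \<longleftrightarrow> x \<in> T"
  using closed by (simp add: frontier_closures)

lemma U_zero: "x \<in> closure (- T) \<Longrightarrow> x \<in> T \<Longrightarrow> U x = 0"
  using clf frontier_iff[of x] by (simp add: degree2_clf_def positive_definite_off_def)

lemma U_isCont: "x \<notin> T \<Longrightarrow> isCont U x"
  using continuous_on_subset[OF U_cont closure_subset] open_off by (simp add: continuous_on_eq_continuous_at)

lemma compact_sublevel: "0 \<le> a \<Longrightarrow> compact {x \<in> closure (- T). U x \<in> {a..b}}"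
proof -
  assume "0 \<le> a"
  have "\<forall>K. compact K \<and> K \<subseteq> {0..} \<longrightarrow> compact {x \<in> closure (- T). U x \<in> K}"
    using clf by (simp add: degree2_clf_def proper_off_def)
  from this[rule_format, of "{a..b}"] show ?thesis using \<open>0 \<le> a\<close> by auto
qed

lemma fields_bounded_on_bounded:
  assumes "bounded S"
  obtains M where "\<And>i z. z \<in> S - T \<Longrightarrow> norm (f i z) \<le> M"
proof -
  obtain r where "S \<subseteq> ball 0 r" using assms bounded_subset_ballD by blast
  have "bounded (f i ` (ball 0 r - T))" for i
    using fields[OF open_ball bounded_ball] by (simp add: bounded_lipschitz_on_def)
  then have "\<forall>i. \<exists>M. \<forall>z\<in>ball 0 r - T. norm (f i z) \<le> M" unfolding bounded_iff by auto
  then obtain M where M: "\<And>i z. z \<in> ball 0 r - T \<Longrightarrow> norm (f i z) \<le> M i" by metis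
  have "norm (f i z) \<le> Max (range M)" if "z \<in> S - T" for i z
    using M[of z i] that \<open>S \<subseteq> ball 0 r\<close> by (intro order_trans[OF M Max_ge]) auto
  then show ?thesis using that by blast
qed

lemma fields_on_ball_at:
  assumes "x0 \<notin> T"
  obtains R L M where "fields_on_ball f x0 R L M" "cball x0 R \<subseteq> - T"
proof -
  obtain R where R: "R > 0" "cball x0 R \<subseteq> - T" using open_off assms open_contains_cball by blast
  have sub: "cball x0 R \<subseteq> ball x0 (R + 1) - T" using R by auto
  have "\<forall>i. \<exists>L. L-lipschitz_on (cball x0 R) (f i)"
    using fields[of "ball x0 (R + 1)"] lipschitz_on_subset[OF _ sub] unfolding bounded_lipschitz_on_def by blast
  then obtain L where L: "\<And>i. (L i)-lipschitz_on (cball x0 R) (f i)" by metis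
  obtain M where M: "\<And>i z. z \<in> cball x0 R - T \<Longrightarrow> norm (f i z) \<le> M"
    using fields_bounded_on_bounded[OF bounded_cball] by blast
  have "fields_on_ball f x0 R (Max (range L)) M"
  proof
    show "(Max (range L))-lipschitz_on (cball x0 R) (f i)" for i
      by (rule lipschitz_on_le[OF L]) (auto intro: Max_ge)
    show "norm (f i z) \<le> M" if "z \<in> cball x0 R" for i z using M[of z i] that R(2) by auto
  qed (rule R(1))
  then show ?thesis using that R(2) by blast
qed

text \<open>The duration bounds make infinite concatenation possible, and the factor \<open>2\<close> limits the overshoot between two nodes.\<close>

definition step :: "real^'n \<Rightarrow> nat \<Rightarrow> bool" where
  "step x k \<longleftrightarrow> (\<exists>\<theta> z. 1 \<le> \<theta> \<and> \<theta> \<le> 8 \<and> reach f \<theta> {v. v \<notin> T \<and> U v < 2 * U x} x z \<and> U z \<le> U x - 1 / real (Suc k))"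

lemma step_mono: "step x k \<Longrightarrow> k \<le> k' \<Longrightarrow> step x k'"
  unfolding step_def
proof (elim exE conjE, intro exI conjI)
  fix \<theta> z assume "k \<le> k'" "U z \<le> U x - 1 / real (Suc k)"
  then show "U z \<le> U x - 1 / real (Suc k')" using frac_le[of 1 1 "real (Suc k)" "real (Suc k')"] by simp
qed

text \<open>If no gain worked for all points of the compact shell, points without a step of gain \<open>1 / Suc k\<close> would accumulate at
  some \<open>x0\<close>, and their limiting gradients at some limiting gradient \<open>p0\<close> at \<open>x0\<close>. The local decrease near
  \<open>(x0, p0)\<close>, with one fixed \<open>t\<close>, then provides a step of a fixed gain at points far along the sequence.\<close>

lemma step_uniform:
  assumes "0 < a"
  shows "\<exists>k. \<forall>x. x \<notin> T \<longrightarrow> a \<le> U x \<longrightarrow> U x \<le> b \<longrightarrow> step x k"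
proof (rule ccontr)
  assume "\<not> ?thesis"
  then have "\<forall>k. \<exists>x. x \<notin> T \<and> a \<le> U x \<and> U x \<le> b \<and> \<not> step x k" by blast
  then obtain x where x: "\<And>k. x k \<notin> T" "\<And>k. a \<le> U (x k)" "\<And>k. U (x k) \<le> b" "\<And>k. \<not> step (x k) k" by metis
  have "compact {x \<in> closure (- T). U x \<in> {a..b}}" using compact_sublevel \<open>0 < a\<close> by simp
  moreover have "x k \<in> {x \<in> closure (- T). U x \<in> {a..b}}" for k
    using x(1-3)[of k] closure_subset[of "- T"] by auto
  ultimately obtain x0 \<sigma> where x0: "x0 \<in> {x \<in> closure (- T). U x \<in> {a..b}}" and \<sigma>: "strict_mono \<sigma>" "(x \<circ> \<sigma>) \<longlonglongrightarrow> x0"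
    using seq_compactE[OF compact_imp_seq_compact, of "{x \<in> closure (- T). U x \<in> {a..b}}" x] by blast
  have x0T: "x0 \<notin> T" using U_zero[of x0] x0 \<open>0 < a\<close> by auto
  have x0D: "x0 \<in> - T" using x0T by simp
  have sc: "locally_semiconcave_on (- T) U" using clf by (simp add: degree2_clf_def)
  obtain R1 \<rho> C where R1: "R1 > 0" "\<rho> \<ge> 0" "cball x0 R1 \<subseteq> - T"
    and sg: "\<And>x. x \<in> cball x0 R1 \<Longrightarrow> \<exists>p\<in>limiting_gradients (- T) U x. norm p \<le> C \<and>
        (\<forall>z\<in>cball x0 R1. U z \<le> U x + p \<bullet> (z - x) + \<rho> * (norm (z - x))\<^sup>2)"
    using limiting_supergradients[OF open_off x0D sc] by blast
  have "\<forall>\<^sub>F k in sequentially. (x \<circ> \<sigma>) k \<in> ball x0 R1"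
    by (rule topological_tendstoD[OF \<sigma>(2)]) (use R1 in auto)
  then obtain N where N: "\<And>k. k \<ge> N \<Longrightarrow> (x \<circ> \<sigma>) k \<in> ball x0 R1" by (auto simp: eventually_sequentially)
  \<comment> \<open>Discarding finitely many terms places all points where limiting supergradients are available.\<close>
  define y where "y k = x (\<sigma> (k + N))" for k
  have yb: "y k \<in> cball x0 R1" for k using N[of "k + N"] by (auto simp: y_def)
  have ylim: "y \<longlonglongrightarrow> x0" using LIMSEQ_ignore_initial_segment[OF \<sigma>(2), of N] by (simp add: y_def[abs_def] o_def)
  have nostep: "\<not> step (y k) j" if "j \<le> k" for j k
  proof -
    have "k \<le> \<sigma> (k + N)" using seq_suble[OF \<sigma>(1), of "k + N"] by simp
    then show ?thesis using x(4)[of "\<sigma> (k + N)"] step_mono[of "y k" j "\<sigma> (k + N)"] that by (auto simp: y_def)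
  qed
  have "\<forall>k. \<exists>p. p \<in> limiting_gradients (- T) U (y k) \<and> norm p \<le> C \<and>
        (\<forall>z\<in>cball x0 R1. U z \<le> U (y k) + p \<bullet> (z - y k) + \<rho> * (norm (z - y k))\<^sup>2)"
    using sg[OF yb] by blast
  then obtain p where p: "\<And>k. p k \<in> limiting_gradients (- T) U (y k)" "\<And>k. norm (p k) \<le> C"
    "\<And>k z. z\<in>cball x0 R1 \<Longrightarrow> U z \<le> U (y k) + p k \<bullet> (z - y k) + \<rho> * (norm (z - y k))\<^sup>2" by metis
  have "bounded (range p)" unfolding bounded_iff using p(2) by blast
  then obtain p0 \<sigma>2 where \<sigma>2: "strict_mono \<sigma>2" "(p \<circ> \<sigma>2) \<longlonglongrightarrow> p0"
    using bounded_imp_convergent_subsequence by blast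
  have y2: "(y \<circ> \<sigma>2) \<longlonglongrightarrow> x0" by (rule LIMSEQ_subseq_LIMSEQ[OF ylim \<sigma>2(1)])
  have "p0 \<in> limiting_gradients (- T) U x0"
    by (rule limiting_gradients_closed[OF _ y2 \<sigma>2(2)]) (simp add: p(1))
  then have ham: "hamiltonian2 T f x0 p0 < 0" using clf x0T by (simp add: degree2_clf_def)
  obtain R L M where RLM: "fields_on_ball f x0 R L M" and RT: "cball x0 R \<subseteq> - T" by (rule fields_on_ball_at[OF x0T])
  interpret fields_on_ball f x0 R L M by (rule RLM)
  obtain \<epsilon> \<tau> c where pos: "\<epsilon> > 0" "\<tau> > 0" "c > 0"
    and dec: "\<And>x p t. dist x0 x < \<epsilon> \<Longrightarrow> dist p0 p < \<epsilon> \<Longrightarrow> 0 < t \<Longrightarrow> t < \<tau> \<Longrightarrow>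
      \<exists>\<theta> z. 1 \<le> \<theta> \<and> \<theta> \<le> 8 \<and> reach f \<theta> (cball x (4 * M * t)) x z \<and> p \<bullet> (z - x) + \<rho> * (norm (z - x))\<^sup>2 \<le> - c * t\<^sup>2"
    using local_decrease[OF RT ham R1(2)] by blast
  have U0: "U x0 > 0" by (rule U_pos[OF x0T])
  obtain d where d: "d > 0" "\<And>v. dist v x0 < d \<Longrightarrow> dist (U v) (U x0) < U x0 / 8"
    using U_isCont[OF x0T] U0 unfolding continuous_at_eps_delta by (meson divide_pos_pos zero_less_numeral)
  \<comment> \<open>On this ball \<open>U\<close> varies so little that all values are below twice any other value.\<close>
  define \<eta> where "\<eta> = min R1 (d / 2)"
  have \<eta>: "\<eta> > 0" "\<eta> \<le> R1" "\<eta> < d" using R1 d(1) by (auto simp: \<eta>_def)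
  have Uv: "7 / 8 * U x0 < U v" "U v < 9 / 8 * U x0" if "v \<in> cball x0 \<eta>" for v
  proof -
    have "\<bar>U v - U x0\<bar> < U x0 / 8" using d(2)[of v] that \<eta>(3) by (simp add: dist_real_def dist_commute)
    then show "7 / 8 * U x0 < U v" "U v < 9 / 8 * U x0" by arith+
  qed
  define t where "t = min (\<tau> / 2) (\<eta> / (8 * (M + 1)))"
  have t: "t > 0" "t < \<tau>" using pos \<eta> M_nonneg by (auto simp: t_def min_less_iff_disj)
  have Mt: "4 * M * t \<le> \<eta> / 2"
  proof -
    have "4 * M * t \<le> 4 * (M + 1) * (\<eta> / (8 * (M + 1)))" using M_nonneg t by (intro mult_mono) (auto simp: t_def)
    also have "\<dots> = \<eta> / 2" using M_nonneg by (simp add: field_simps)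
    finally show ?thesis .
  qed
  obtain k0 :: nat where k0: "inverse (real (Suc k0)) < c * t\<^sup>2" using reals_Archimedean[of "c * t\<^sup>2"] pos t by auto
  have "\<forall>\<^sub>F k in sequentially. dist ((y \<circ> \<sigma>2) k) x0 < min \<epsilon> (\<eta> / 2)" by (rule tendstoD[OF y2]) (use pos \<eta> in auto)
  moreover have "\<forall>\<^sub>F k in sequentially. dist ((p \<circ> \<sigma>2) k) p0 < \<epsilon>" by (rule tendstoD[OF \<sigma>2(2) pos(1)])
  moreover have "\<forall>\<^sub>F k in sequentially. k0 \<le> k" by (rule eventually_ge_at_top)
  ultimately have "\<forall>\<^sub>F k in sequentially. dist ((y \<circ> \<sigma>2) k) x0 < min \<epsilon> (\<eta> / 2) \<and> dist ((p \<circ> \<sigma>2) k) p0 < \<epsilon> \<and> k0 \<le> k"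
    by eventually_elim simp
  then obtain k where k: "dist (y (\<sigma>2 k)) x0 < min \<epsilon> (\<eta> / 2)" "dist (p (\<sigma>2 k)) p0 < \<epsilon>" "k0 \<le> k"
    using eventually_happens'[OF sequentially_bot] by fastforce
  define v where "v = y (\<sigma>2 k)"
  define q where "q = p (\<sigma>2 k)"
  have v: "dist x0 v < \<epsilon>" "dist x0 v < \<eta> / 2" "dist p0 q < \<epsilon>" using k by (auto simp: v_def q_def dist_commute)
  obtain \<theta> z where z: "1 \<le> \<theta>" "\<theta> \<le> 8" "reach f \<theta> (cball v (4 * M * t)) v z"
    "q \<bullet> (z - v) + \<rho> * (norm (z - v))\<^sup>2 \<le> - c * t\<^sup>2"
    using dec[OF v(1,3) t] by blast
  have sub: "cball v (4 * M * t) \<subseteq> cball x0 \<eta>"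
  proof
    fix w assume "w \<in> cball v (4 * M * t)"
    then show "w \<in> cball x0 \<eta>" using dist_triangle[of x0 w v] v(2) Mt by simp
  qed
  have "cball v (4 * M * t) \<subseteq> {w. w \<notin> T \<and> U w < 2 * U v}"
  proof
    fix w assume "w \<in> cball v (4 * M * t)"
    then have w: "w \<in> cball x0 \<eta>" using sub by blast
    moreover have "v \<in> cball x0 \<eta>" using v(2) \<eta>(1) by simp
    moreover have "w \<in> cball x0 R1" using w \<eta>(2) by simp
    then have "w \<notin> T" using R1(3) by blast
    ultimately show "w \<in> {w. w \<notin> T \<and> U w < 2 * U v}" using Uv[of w] Uv[of v] U0 by auto
  qed
  then have re: "reach f \<theta> {w. w \<notin> T \<and> U w < 2 * U v} v z" by (rule reach_mono[OF z(3)])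
  have "z \<in> cball x0 R1" using reach_in(2)[OF z(3)] sub \<eta>(2) by auto
  then have "U z \<le> U v + (q \<bullet> (z - v) + \<rho> * (norm (z - v))\<^sup>2)" using p(3)[of z "\<sigma>2 k"] by (simp add: v_def q_def)
  also have "\<dots> \<le> U v - c * t\<^sup>2" using z(4) by simp
  also have "\<dots> \<le> U v - 1 / real (Suc k0)" using k0 by (simp add: inverse_eq_divide)
  finally have "step v k0" unfolding step_def using z(1,2) re by blast
  moreover have "k0 \<le> \<sigma>2 k" using k(3) seq_suble[OF \<sigma>2(1), of k] by simp
  ultimately show False using nostep[of k0 "\<sigma>2 k"] by (simp add: v_def)
qed

definition rate :: "real^'n \<Rightarrow> nat" where "rate x = (LEAST k. step x k)"

lemma step_rate:
  assumes "x \<notin> T"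
  shows "step x (rate x)"
proof -
  obtain k where "step x k" using step_uniform[OF U_pos[OF assms], of "U x"] assms by auto
  then show ?thesis unfolding rate_def by (rule LeastI)
qed

lemma rate_le: "step x k \<Longrightarrow> rate x \<le> k"
  unfolding rate_def by (rule Least_le)

text \<open>Take from each node a step whose guaranteed gain \<open>1 / Suc k\<close> is as large as possible. The values of \<open>U\<close> at the nodes decrease, between nodes they at most
  double, and as long as they exceed \<open>a\<close> each step gains at least \<open>1 / Suc k\<close>, so only about \<open>Suc k * U x\<close> steps,
  each of duration at most \<open>8\<close>, are possible above that level.\<close>

lemma steering:
  assumes x: "x \<notin> T"
  obtains Y A where "Y 0 = x" "A \<in> borel_measurable (lebesgue_on {0..})" "\<And>t. A t \<in> control_set"
    "solves_system_on f A \<infinity> Y" "\<And>t. t \<ge> 0 \<Longrightarrow> Y t \<notin> T \<and> U (Y t) < 2 * U x"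
    "\<And>a k t. 0 < a \<Longrightarrow> (\<And>v. v \<notin> T \<Longrightarrow> a \<le> U v \<Longrightarrow> U v \<le> U x \<Longrightarrow> step v k) \<Longrightarrow>
       8 * (real (Suc k) * U x + 2) \<le> t \<Longrightarrow> U (Y t) < 2 * a"
proof -
  \<comment> \<open>Stage \<open>n\<close>: a trajectory from \<open>x\<close> made of \<open>n\<close> steps, with its duration and control. The relation \<open>Q\<close> says that a stage extends the previous one by one step.\<close>
  define P where "P n s \<longleftrightarrow> (case s of (\<theta>, y, \<alpha>) \<Rightarrow> trajectory f \<theta> y \<alpha> \<and> y 0 = x \<and> real n \<le> \<theta> \<and> \<theta> \<le> 8 * real n \<and>
      (\<forall>t\<in>{0..\<theta>}. y t \<notin> T \<and> U (y t) < 2 * U x) \<and> U (y \<theta>) \<le> U x)" for n :: nat and s :: "real \<times> (real \<Rightarrow> real^'n) \<times> (real \<Rightarrow> real^'m)"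
  define Q where "Q s s' \<longleftrightarrow> (case s of (\<theta>, y, \<alpha>) \<Rightarrow> case s' of (\<theta>', y', \<alpha>') \<Rightarrow> \<theta> \<le> \<theta>' \<and>
      (\<forall>t. 0 \<le> t \<longrightarrow> t \<le> \<theta> \<longrightarrow> y' t = y t) \<and> (\<forall>t. 0 \<le> t \<longrightarrow> t < \<theta> \<longrightarrow> \<alpha>' t = \<alpha> t) \<and>
      U (y' \<theta>') \<le> U (y \<theta>) - 1 / real (Suc (rate (y \<theta>))) \<and> (\<forall>t\<in>{\<theta>..\<theta>'}. U (y' t) < 2 * U (y \<theta>)))"
    for s s' :: "real \<times> (real \<Rightarrow> real^'n) \<times> (real \<Rightarrow> real^'m)"
  have "\<exists>F. \<forall>n. P n (F n) \<and> Q (F n) (F (Suc n))"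
  proof (rule dependent_nat_choice)
    obtain y \<alpha> where "trajectory f 0 y \<alpha>" "y 0 = x"
      using reach_self[of x UNIV f] unfolding reach_def by blast
    then have "P 0 (0, y, \<alpha>)" using x U_pos[OF x] by (simp add: P_def)
    then show "\<exists>s. P 0 s" by blast
  next
    fix s n assume "P n s"
    obtain \<theta> y \<alpha> where s: "s = (\<theta>, y, \<alpha>)" by (cases s) auto
    have tr: "trajectory f \<theta> y \<alpha>" and y0: "y 0 = x" and \<theta>: "real n \<le> \<theta>" "\<theta> \<le> 8 * real n"
      and reg: "\<And>t. t \<in> {0..\<theta>} \<Longrightarrow> y t \<notin> T \<and> U (y t) < 2 * U x" and Ule: "U (y \<theta>) \<le> U x"
      using \<open>P n s\<close> by (auto simp: P_def s)
    have \<theta>0: "0 \<le> \<theta>" using \<theta> by linarith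
    define w where "w = y \<theta>"
    have "w \<notin> T" using reg[of \<theta>] \<theta>0 by (simp add: w_def)
    then obtain \<theta>2 z where z: "1 \<le> \<theta>2" "\<theta>2 \<le> 8" "reach f \<theta>2 {v. v \<notin> T \<and> U v < 2 * U w} w z"
      "U z \<le> U w - 1 / real (Suc (rate w))" using step_rate unfolding step_def by blast
    then obtain y2 \<alpha>2 where y2: "trajectory f \<theta>2 y2 \<alpha>2" "y2 0 = w" "y2 \<theta>2 = z"
      "\<And>t. t \<in> {0..\<theta>2} \<Longrightarrow> y2 t \<notin> T \<and> U (y2 t) < 2 * U w" unfolding reach_def by blast
    define y' where "y' t = (if t \<le> \<theta> then y t else y2 (t - \<theta>))" for t
    define \<alpha>' where "\<alpha>' t = (if t < \<theta> then \<alpha> t else \<alpha>2 (t - \<theta>))" for t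
    have tr': "trajectory f (\<theta> + \<theta>2) y' \<alpha>'"
      using trajectory_concat[OF tr y2(1)] y2(2) unfolding y'_def[abs_def] \<alpha>'_def[abs_def] w_def by blast
    have y'2: "y' t = y2 (t - \<theta>)" if "\<theta> \<le> t" for t using that y2(2) by (auto simp: y'_def w_def)
    have late: "y' t \<notin> T \<and> U (y' t) < 2 * U w" if "t \<in> {\<theta>..\<theta> + \<theta>2}" for t
      using y'2[of t] y2(4)[of "t - \<theta>"] that by auto
    have "y' t \<notin> T \<and> U (y' t) < 2 * U x" if "t \<in> {0..\<theta> + \<theta>2}" for t
    proof (cases "t \<le> \<theta>")
      case True then show ?thesis using reg[of t] that by (simp add: y'_def)
    next
      case False then show ?thesis using late[of t] that Ule by (auto simp: w_def)
    qed
    moreover have yend: "y' (\<theta> + \<theta>2) = z" using y'2[of "\<theta> + \<theta>2"] z(1) y2(3) by simp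
    moreover have "U z \<le> U x" using z(4) Ule by (simp add: w_def) (smt (verit) divide_nonneg_nonneg of_nat_0_le_iff)
    ultimately have "P (Suc n) (\<theta> + \<theta>2, y', \<alpha>')"
      using tr' y0 \<theta> z(1,2) \<theta>0 by (simp add: P_def y'_def)
    moreover have "Q s (\<theta> + \<theta>2, y', \<alpha>')"
      using z(1,4) late yend by (simp add: Q_def s y'_def \<alpha>'_def w_def)
    ultimately show "\<exists>s'. P (Suc n) s' \<and> Q s s'" by blast
  qed
  then obtain F where F: "\<And>n. P n (F n)" "\<And>n. Q (F n) (F (Suc n))" by blast
  define \<theta> where "\<theta> n = fst (F n)" for n
  define y where "y n = fst (snd (F n))" for n
  define \<alpha> where "\<alpha> n = snd (snd (F n))" for n
  have Feq: "F n = (\<theta> n, y n, \<alpha> n)" for n by (simp add: \<theta>_def y_def \<alpha>_def)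
  have tr: "trajectory f (\<theta> n) (y n) (\<alpha> n)" and y0: "y n 0 = x" and \<theta>: "real n \<le> \<theta> n" "\<theta> n \<le> 8 * real n"
    and reg: "\<And>t. t \<in> {0..\<theta> n} \<Longrightarrow> y n t \<notin> T \<and> U (y n t) < 2 * U x" and Ule: "U (y n (\<theta> n)) \<le> U x" for n
    using F(1)[of n] unfolding Feq P_def by auto
  have mono: "\<theta> n \<le> \<theta> (Suc n)"
    and ext: "\<And>t. 0 \<le> t \<Longrightarrow> t \<le> \<theta> n \<Longrightarrow> y (Suc n) t = y n t" "\<And>t. 0 \<le> t \<Longrightarrow> t < \<theta> n \<Longrightarrow> \<alpha> (Suc n) t = \<alpha> n t"
    and dec: "U (y (Suc n) (\<theta> (Suc n))) \<le> U (y n (\<theta> n)) - 1 / real (Suc (rate (y n (\<theta> n))))"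
    and over: "\<And>t. t \<in> {\<theta> n..\<theta> (Suc n)} \<Longrightarrow> U (y (Suc n) t) < 2 * U (y n (\<theta> n))" for n
    using F(2)[of n] unfolding Feq Q_def by auto
  have \<theta>0: "0 \<le> \<theta> n" for n using \<theta>(1)[of n] by linarith
  have "bounded {v \<in> closure (- T). U v \<in> {0..2 * U x}}" by (intro compact_imp_bounded compact_sublevel) simp
  then obtain M where M: "\<And>i z. z \<in> {v \<in> closure (- T). U v \<in> {0..2 * U x}} - T \<Longrightarrow> norm (f i z) \<le> M"
    using fields_bounded_on_bounded by blast
  have bd: "norm (f i (y n t)) \<le> M" if "0 \<le> t" "t \<le> \<theta> n" for n t i
    using reg[of t n] that U_pos[of "y n t"] closure_subset[of "- T"] by (intro M) auto
  have "\<exists>Y A. (\<forall>n t. 0 \<le> t \<longrightarrow> t \<le> \<theta> n \<longrightarrow> Y t = y n t) \<and> A \<in> borel_measurable (lebesgue_on {0..}) \<and>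
      (\<forall>t. A t \<in> control_set) \<and> solves_system_on f A \<infinity> Y"
  proof (rule trajectory_limit[where f = f and \<theta> = \<theta> and y = y and \<alpha> = \<alpha> and M = M])
    show "trajectory f (\<theta> n) (y n) (\<alpha> n)" "real n \<le> \<theta> n" "\<theta> n \<le> \<theta> (Suc n)" for n by (rule tr \<theta>(1) mono)+
    show "y (Suc n) t = y n t" if "0 \<le> t" "t \<le> \<theta> n" for n t using that by (rule ext(1))
    show "\<alpha> (Suc n) t = \<alpha> n t" if "0 \<le> t" "t < \<theta> n" for n t using that by (rule ext(2))
    show "norm (f i (y n t)) \<le> M" if "0 \<le> t" "t \<le> \<theta> n" for n t i using that by (rule bd)
  qed blast
  then obtain Y A where Y: "\<And>n t. 0 \<le> t \<Longrightarrow> t \<le> \<theta> n \<Longrightarrow> Y t = y n t"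
    and A: "A \<in> borel_measurable (lebesgue_on {0..})" "\<And>t. A t \<in> control_set" "solves_system_on f A \<infinity> Y"
    by blast
  define u where "u n = U (y n (\<theta> n))" for n
  have notT: "y n (\<theta> n) \<notin> T" for n using reg[of "\<theta> n" n] \<theta>0[of n] by simp
  have upos: "u n > 0" for n unfolding u_def by (rule U_pos[OF notT])
  have ule: "u n \<le> U x" for n unfolding u_def by (rule Ule)
  have udec: "u (Suc n) \<le> u n" for n
  proof -
    have "0 \<le> 1 / real (Suc (rate (y n (\<theta> n))))" by simp
    then show ?thesis using dec[of n] unfolding u_def by linarith
  qed
  have umono: "u n \<le> u m" if "m \<le> n" for m n using lift_Suc_antimono_le[of u, OF udec that] .
  have attract: "U (Y t) < 2 * a"
    if a: "0 < a" and k: "\<And>v. v \<notin> T \<Longrightarrow> a \<le> U v \<Longrightarrow> U v \<le> U x \<Longrightarrow> step v k"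
      and t: "8 * (real (Suc k) * U x + 2) \<le> t" for a k t
  proof -
    \<comment> \<open>More steps than can be taken above the level \<open>a\<close>.\<close>
    define n where "n = nat \<lceil>real (Suc k) * U x\<rceil> + 1"
    have Ux: "0 \<le> real (Suc k) * U x" using U_pos[OF x] by simp
    have n: "real (Suc k) * U x < real n" "real n \<le> real (Suc k) * U x + 2"
      unfolding n_def using Ux by linarith+
    have "u n < a"
    proof (rule ccontr)
      assume "\<not> u n < a"
      have "u j \<le> U x - real j / real (Suc k)" if "j \<le> n" for j using that
      proof (induction j)
        case 0 then show ?case using ule[of 0] by simp
      next
        case (Suc j)
        have "a \<le> u j" using umono[of j n] Suc.prems \<open>\<not> u n < a\<close> by linarith
        then have "step (y j (\<theta> j)) k" using k[OF notT] ule[of j] by (simp add: u_def)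
        then have "rate (y j (\<theta> j)) \<le> k" by (rule rate_le)
        then have "1 / real (Suc k) \<le> 1 / real (Suc (rate (y j (\<theta> j))))" by (intro frac_le) auto
        then have "u (Suc j) \<le> u j - 1 / real (Suc k)" using dec[of j] unfolding u_def by linarith
        then show ?case using Suc by (simp add: add_divide_distrib)
      qed
      from this[OF order_refl] have "u n \<le> U x - real n / real (Suc k)" .
      moreover have "U x < real n / real (Suc k)" using n(1) by (simp add: field_simps)
      ultimately show False using upos[of n] by linarith
    qed
    have tn: "\<theta> n \<le> t" by (rule order_trans[OF \<theta>(2) order_trans[OF mult_left_mono[OF n(2)] t]]) simp
    then have t0: "0 \<le> t" using \<theta>0[of n] by linarith
    have ex: "\<exists>m. t < \<theta> m"
    proof -
      obtain m :: nat where "t < real m" using reals_Archimedean2 by blast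
      then show ?thesis using \<theta>(1)[of m] by (intro exI[of _ m]) linarith
    qed
    define m where "m = (LEAST m. t < \<theta> m)"
    have m: "t < \<theta> m" unfolding m_def by (rule LeastI_ex[OF ex])
    have mmin: "\<not> t < \<theta> j" if "j < m" for j using not_less_Least[of j "\<lambda>m. t < \<theta> m"] that by (simp add: m_def)
    have \<theta>mono: "\<theta> i \<le> \<theta> j" if "i \<le> j" for i j using lift_Suc_mono_le[of \<theta>, OF mono that] .
    have "n < m"
    proof (rule ccontr)
      assume "\<not> n < m"
      then show False using \<theta>mono[of m n] m tn by simp
    qed
    then obtain j where j: "m = Suc j" "n \<le> j" by (cases m) auto
    have "\<theta> j \<le> t" using mmin[of j] j by simp
    then have "U (y m t) < 2 * u j" using over[of t j] m unfolding j(1) u_def by simp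
    moreover have "U (Y t) = U (y m t)" using Y[OF t0, of m] m by simp
    ultimately show ?thesis using umono[OF j(2)] \<open>u n < a\<close> by linarith
  qed
  have "Y t \<notin> T \<and> U (Y t) < 2 * U x" if "t \<ge> 0" for t
  proof -
    obtain n :: nat where "t < real n" using reals_Archimedean2 by blast
    then have "t \<le> \<theta> n" using \<theta>(1)[of n] by linarith
    then show ?thesis using Y[OF that] reg[of t n] that by simp
  qed
  moreover have "Y 0 = x" using Y[of 0 0] \<theta>0 y0 by simp
  ultimately show ?thesis using that[of Y A] A attract by blast
qed

text \<open>A segment from \<open>x\<close> to a nearest point of the target meets its compact frontier.\<close>

lemma bounded_near_target: "bounded {x. x \<notin> T \<and> infdist x T \<le> \<delta>}"
proof -
  obtain B where B: "\<And>z. z \<in> frontier T \<Longrightarrow> norm z \<le> B" using compact_imp_bounded[OF compact_frontier] by (auto simp: bounded_iff)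
  have "norm x \<le> B + \<delta>" if "x \<notin> T" "infdist x T \<le> \<delta>" for x
  proof -
    obtain y where y: "y \<in> T" "infdist x T = dist x y" using infdist_attains_inf[OF closed nonempty] by metis
    have "closed_segment x y \<inter> frontier T \<noteq> {}"
      by (rule connected_Int_frontier) (use y that in auto)
    then obtain z where z: "z \<in> closed_segment x y" "z \<in> frontier T" by blast
    have "dist x z \<le> dist x y" using dist_in_closed_segment[OF z(1)] by (simp add: dist_commute)
    then show ?thesis using B[OF z(2)] y(2) that(2) norm_triangle_sub[of x z] by (simp add: dist_norm)
  qed
  then show ?thesis unfolding bounded_iff by blast
qed

lemma U_bounded_near: "\<exists>B. \<forall>x. x \<notin> T \<longrightarrow> infdist x T \<le> \<delta> \<longrightarrow> U x \<le> B"
proof -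
  let ?S = "{x. x \<notin> T \<and> infdist x T \<le> \<delta>}"
  have "compact (closure ?S)" using bounded_near_target by (simp add: compact_closure)
  moreover have "closure ?S \<subseteq> closure (- T)" by (rule closure_mono) auto
  ultimately have "bounded (U ` closure ?S)"
    by (intro compact_imp_bounded compact_continuous_image continuous_on_subset[OF U_cont])
  then obtain B where "\<And>x. x \<in> closure ?S \<Longrightarrow> norm (U x) \<le> B" by (auto simp: bounded_iff)
  then have "U x \<le> B" if "x \<in> ?S" for x using that closure_subset[of ?S] by fastforce
  then show ?thesis by blast
qed

lemma U_small_near:
  assumes "\<eta> > 0"
  shows "\<exists>\<delta>>0. \<forall>x. x \<notin> T \<longrightarrow> infdist x T \<le> \<delta> \<longrightarrow> U x \<le> \<eta>"
proof (rule ccontr)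
  assume contra: "\<not> ?thesis"
  have "\<exists>x. x \<notin> T \<and> infdist x T \<le> inverse (real (Suc k)) \<and> \<eta> < U x" for k
    using contra by (force simp: not_le)
  then obtain x where x: "\<And>k. x k \<notin> T" "\<And>k. infdist (x k) T \<le> inverse (real (Suc k))" "\<And>k. \<eta> < U (x k)" by metis
  have "infdist (x k) T \<le> 1" for k using x(2)[of k] by (rule order_trans) (simp add: inverse_le_1_iff)
  then have "range x \<subseteq> {x. x \<notin> T \<and> infdist x T \<le> 1}" using x(1) by auto
  then have "bounded (range x)" by (rule bounded_subset[OF bounded_near_target])
  then obtain x0 \<sigma> where \<sigma>: "strict_mono \<sigma>" "(x \<circ> \<sigma>) \<longlonglongrightarrow> x0" using bounded_imp_convergent_subsequence by blast
  have in_cl: "(x \<circ> \<sigma>) k \<in> closure (- T)" for k using x(1) closure_subset[of "- T"] by auto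
  have "x0 \<in> closure (- T)" using closed_sequentially[OF closed_closure, of "x \<circ> \<sigma>"] in_cl \<sigma>(2) by blast
  have "(\<lambda>k. infdist ((x \<circ> \<sigma>) k) T) \<longlonglongrightarrow> infdist x0 T" by (intro tendsto_infdist \<sigma>(2))
  moreover have "(\<lambda>k. infdist (x k) T) \<longlonglongrightarrow> 0"
    by (rule Lim_null_comparison[OF _ LIMSEQ_inverse_real_of_nat])
      (intro always_eventually allI, unfold real_norm_def abs_of_nonneg[OF infdist_nonneg], rule x(2))
  then have "(\<lambda>k. infdist ((x \<circ> \<sigma>) k) T) \<longlonglongrightarrow> 0" using LIMSEQ_subseq_LIMSEQ[OF _ \<sigma>(1)] by (force simp: o_def)
  ultimately have "infdist x0 T = 0" by (rule LIMSEQ_unique)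
  then have "x0 \<in> T" using in_closed_iff_infdist_zero[OF closed nonempty] by simp
  then have "U x0 = 0" using U_zero \<open>x0 \<in> closure (- T)\<close> by simp
  moreover have "(\<lambda>k. U ((x \<circ> \<sigma>) k)) \<longlonglongrightarrow> U x0"
    using U_cont in_cl \<sigma>(2) \<open>x0 \<in> closure (- T)\<close> unfolding continuous_on_sequentially by (simp add: o_def)
  then have "\<eta> \<le> U x0" by (rule LIMSEQ_le_const) (use x(3) in \<open>auto simp: less_imp_le\<close>)
  ultimately show False using \<open>\<eta> > 0\<close> by simp
qed

lemma near_if_U_small:
  assumes "\<eta> > 0"
  shows "\<exists>u>0. \<forall>x. x \<notin> T \<longrightarrow> U x \<le> u \<longrightarrow> infdist x T \<le> \<eta>"
proof (rule ccontr)
  assume contra: "\<not> ?thesis"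
  have "\<exists>x. x \<notin> T \<and> U x \<le> inverse (real (Suc k)) \<and> \<eta> < infdist x T" for k
    using contra by (force simp: not_le)
  then obtain x where x: "\<And>k. x k \<notin> T" "\<And>k. U (x k) \<le> inverse (real (Suc k))" "\<And>k. \<eta> < infdist (x k) T" by metis
  have cl: "x k \<in> {x \<in> closure (- T). U x \<in> {0..1}}" for k
  proof -
    have "U (x k) \<le> 1" using x(2)[of k] by (rule order_trans) (simp add: inverse_le_1_iff)
    then show ?thesis using x(1)[of k] U_pos[of "x k"] closure_subset[of "- T"] by auto
  qed
  obtain x0 \<sigma> where x0: "x0 \<in> {x \<in> closure (- T). U x \<in> {0..1}}" and \<sigma>: "strict_mono \<sigma>" "(x \<circ> \<sigma>) \<longlonglongrightarrow> x0"
    using seq_compactE[OF compact_imp_seq_compact[OF compact_sublevel[of 0 1]], of x] cl by blast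
  have "(\<lambda>k. U ((x \<circ> \<sigma>) k)) \<longlonglongrightarrow> U x0"
    using U_cont cl \<sigma>(2) x0 unfolding continuous_on_sequentially by (simp add: o_def)
  moreover have "(\<lambda>k. U (x k)) \<longlonglongrightarrow> 0"
    by (rule Lim_null_comparison[OF _ LIMSEQ_inverse_real_of_nat])
      (intro always_eventually allI, use x(2) cl in \<open>simp del: of_nat_Suc\<close>)
  then have "(\<lambda>k. U ((x \<circ> \<sigma>) k)) \<longlonglongrightarrow> 0" using LIMSEQ_subseq_LIMSEQ[OF _ \<sigma>(1)] by (force simp: o_def)
  ultimately have "U x0 = 0" by (rule LIMSEQ_unique)
  then have "x0 \<in> T" using U_pos[of x0] by force
  have "(\<lambda>k. infdist ((x \<circ> \<sigma>) k) T) \<longlonglongrightarrow> infdist x0 T" by (intro tendsto_infdist \<sigma>(2))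
  then have "\<eta> \<le> infdist x0 T" by (rule LIMSEQ_le_const) (use x(3) in \<open>auto simp: less_imp_le\<close>)
  then show False using \<open>\<eta> > 0\<close> \<open>x0 \<in> T\<close> by simp
qed

lemma infdist_bounded_on_sublevel: "\<exists>B. \<forall>x. x \<notin> T \<longrightarrow> U x \<le> u \<longrightarrow> infdist x T \<le> B"
proof -
  have "compact ((\<lambda>x. infdist x T) ` {x \<in> closure (- T). U x \<in> {0..u}})"
    by (intro compact_continuous_image compact_sublevel continuous_intros) simp
  then obtain B where B: "\<And>x. x \<in> closure (- T) \<Longrightarrow> U x \<in> {0..u} \<Longrightarrow> norm (infdist x T) \<le> B"
    using compact_imp_bounded[of "(\<lambda>x. infdist x T) ` {x \<in> closure (- T). U x \<in> {0..u}}"] unfolding bounded_iff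
    by (auto simp del: norm_conv_dist real_norm_def)
  have "infdist x T \<le> B" if "x \<notin> T" "U x \<le> u" for x
    using B[of x] that U_pos[of x] closure_subset[of "- T"] infdist_nonneg[of x T] by auto
  then show ?thesis by blast
qed

lemma gac: "globally_asymptotically_controllable T f"
proof -
  define good where "good x Y A \<longleftrightarrow> Y 0 = x \<and> A \<in> borel_measurable (lebesgue_on {0..}) \<and> (\<forall>t. A t \<in> control_set) \<and>
    solves_system_on f A \<infinity> Y \<and> (\<forall>t\<ge>0. Y t \<notin> T \<and> U (Y t) < 2 * U x) \<and>
    (\<forall>a k t. 0 < a \<longrightarrow> (\<forall>v. v \<notin> T \<longrightarrow> a \<le> U v \<longrightarrow> U v \<le> U x \<longrightarrow> step v k) \<longrightarrow>
       8 * (real (Suc k) * U x + 2) \<le> t \<longrightarrow> U (Y t) < 2 * a)" for x Y A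
  have "\<exists>Y A. good x Y A" if x: "x \<notin> T" for x
    by (rule steering[OF x]) (unfold good_def, blast)
  then have "\<forall>x. \<exists>Y A. x \<notin> T \<longrightarrow> good x Y A" by blast
  then obtain Y A where "\<And>x. x \<notin> T \<Longrightarrow> good x (Y x) (A x)" by metis
  note g = this[unfolded good_def]
  have reg: "Y x t \<notin> T" "U (Y x t) < 2 * U x" if "x \<notin> T" "t \<ge> 0" for x t using g[OF that(1)] that(2) by blast+
  have attr: "\<exists>\<Theta>\<ge>0. \<forall>x. x \<notin> T \<longrightarrow> U x \<le> b \<longrightarrow> (\<forall>t\<ge>\<Theta>. U (Y x t) < 2 * a)" if pos: "a > 0" for a b
  proof -
    obtain k where k: "\<And>v. v \<notin> T \<Longrightarrow> a \<le> U v \<Longrightarrow> U v \<le> b \<Longrightarrow> step v k" using step_uniform[OF pos] by blast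
    show ?thesis
    proof (intro exI[of _ "8 * (real (Suc k) * \<bar>b\<bar> + 2)"] conjI allI impI)
      fix x t assume x: "x \<notin> T" "U x \<le> b" and t: "8 * (real (Suc k) * \<bar>b\<bar> + 2) \<le> t"
      have "8 * (real (Suc k) * U x + 2) \<le> 8 * (real (Suc k) * \<bar>b\<bar> + 2)"
        using x by (intro mult_left_mono add_right_mono) auto
      then have "8 * (real (Suc k) * U x + 2) \<le> t" using t by (rule order_trans)
      moreover have "\<forall>v. v \<notin> T \<longrightarrow> a \<le> U v \<longrightarrow> U v \<le> U x \<longrightarrow> step v k" using k x by auto
      ultimately show "U (Y x t) < 2 * a" using g[OF x(1)] pos by blast
    qed simp
  qed
  have "\<exists>\<beta>\<in>class_KL. \<forall>x\<in>- T. \<forall>t\<ge>0. infdist (Y x t) T \<le> \<beta> (infdist x T) t"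
  proof (rule class_KL_majorant)
    show "infdist x T > 0" if "x \<in> - T" for x using infdist_pos_not_in_closed[OF closed nonempty] that by auto
    show "\<exists>B. \<forall>x\<in>- T. infdist x T \<le> \<delta> \<longrightarrow> (\<forall>t\<ge>0. infdist (Y x t) T \<le> B)" for \<delta>
    proof -
      obtain B1 where B1: "\<And>x. x \<notin> T \<Longrightarrow> infdist x T \<le> \<delta> \<Longrightarrow> U x \<le> B1" using U_bounded_near by blast
      obtain B where B: "\<And>x. x \<notin> T \<Longrightarrow> U x \<le> 2 * B1 \<Longrightarrow> infdist x T \<le> B" using infdist_bounded_on_sublevel by blast
      have "infdist (Y x t) T \<le> B" if "x \<notin> T" "infdist x T \<le> \<delta>" "t \<ge> 0" for x t
        using B[OF reg(1)[OF that(1,3)]] reg(2)[OF that(1,3)] B1[OF that(1,2)] by simp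
      then show ?thesis by auto
    qed
    show "\<exists>\<delta>>0. \<forall>x\<in>- T. infdist x T \<le> \<delta> \<longrightarrow> (\<forall>t\<ge>0. infdist (Y x t) T \<le> \<epsilon>)" if "\<epsilon> > 0" for \<epsilon>
    proof -
      obtain u where u: "u > 0" "\<And>x. x \<notin> T \<Longrightarrow> U x \<le> u \<Longrightarrow> infdist x T \<le> \<epsilon>" using near_if_U_small[OF \<open>\<epsilon> > 0\<close>] by blast
      obtain \<delta> where \<delta>: "\<delta> > 0" "\<And>x. x \<notin> T \<Longrightarrow> infdist x T \<le> \<delta> \<Longrightarrow> U x \<le> u / 2" using U_small_near[of "u / 2"] u(1) by auto
      have "infdist (Y x t) T \<le> \<epsilon>" if "x \<notin> T" "infdist x T \<le> \<delta>" "t \<ge> 0" for x t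
        using u(2)[OF reg(1)[OF that(1,3)]] reg(2)[OF that(1,3)] \<delta>(2)[OF that(1,2)] by simp
      then show ?thesis using \<delta>(1) by auto
    qed
    show "\<exists>\<Theta>\<ge>0. \<forall>x\<in>- T. infdist x T \<le> \<delta> \<longrightarrow> (\<forall>t\<ge>\<Theta>. infdist (Y x t) T \<le> \<epsilon>)" if "\<epsilon> > 0" for \<delta> \<epsilon>
    proof -
      obtain u where u: "u > 0" "\<And>x. x \<notin> T \<Longrightarrow> U x \<le> u \<Longrightarrow> infdist x T \<le> \<epsilon>" using near_if_U_small[OF \<open>\<epsilon> > 0\<close>] by blast
      obtain B1 where B1: "\<And>x. x \<notin> T \<Longrightarrow> infdist x T \<le> \<delta> \<Longrightarrow> U x \<le> B1" using U_bounded_near by blast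
      obtain \<Theta> where \<Theta>: "\<Theta> \<ge> 0" "\<And>x t. x \<notin> T \<Longrightarrow> U x \<le> B1 \<Longrightarrow> t \<ge> \<Theta> \<Longrightarrow> U (Y x t) < 2 * (u / 2)"
        using attr[of "u / 2" B1] u(1) by auto
      have "infdist (Y x t) T \<le> \<epsilon>" if "x \<notin> T" "infdist x T \<le> \<delta>" "t \<ge> \<Theta>" for x t
        using u(2)[OF reg(1)] \<Theta>(1) \<Theta>(2)[OF that(1) B1[OF that(1,2)] that(3)] that by simp
      then show ?thesis using \<Theta>(1) by auto
    qed
  qed (rule infdist_nonneg)
  then obtain \<beta> where \<beta>: "\<beta> \<in> class_KL" "\<And>x t. x \<notin> T \<Longrightarrow> t \<ge> 0 \<Longrightarrow> infdist (Y x t) T \<le> \<beta> (infdist x T) t" by auto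
  have "admissible_pair T f x (Y x) (A x)" if x: "x \<notin> T" for x
  proof -
    have "(\<beta> (infdist x T) \<longlongrightarrow> 0) at_top" using \<beta>(1) infdist_nonneg[of x T] by (simp add: class_KL_def)
    moreover have "\<forall>\<^sub>F t in at_top. norm (infdist (Y x t) T) \<le> \<beta> (infdist x T) t"
      using eventually_ge_at_top[of 0]
    proof eventually_elim
      case (elim t)
      show ?case using \<beta>(2)[OF x elim] infdist_nonneg[of "Y x t" T] by simp
    qed
    ultimately have "((\<lambda>t. infdist (Y x t) T) \<longlongrightarrow> 0) at_top" by (rule Lim_null_comparison[rotated])
    then show ?thesis unfolding admissible_pair_def using g[OF x] by (auto intro!: exI[of _ \<infinity>])
  qed
  then show ?thesis unfolding globally_asymptotically_controllable_def using \<beta> by (intro bexI[of _ \<beta>] ballI) auto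
qed

end

theorem theorem4p1:
  fixes T :: "(real^'n) set" and f :: "'m::finite \<Rightarrow> real^'n \<Rightarrow> real^'n"
  assumes "T \<noteq> {}" and "closed T" and "compact (frontier T)"
    and "\<And>\<Omega> i. open \<Omega> \<Longrightarrow> bounded \<Omega> \<Longrightarrow> bounded_lipschitz_on (\<Omega> - T) (f i)"
    and "\<exists>U. degree2_clf T f U"
  shows "globally_asymptotically_controllable T f"
proof -
  obtain U where "degree2_clf T f U" using assms(5) by blast
  then interpret degree2_controlled T f U using assms(1-4) by unfold_locales auto
  show ?thesis by (rule gac)
qed

end
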